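(* Let $(T,\Sigma,\mu)$ be a non-atomic, $\sigma$-finite measure space and let $\Phi$ be a Musielak--Orlicz function on $T$. The Musielak--Orlicz space $L_0^\Phi$ (that is, $L^\Phi$ equipped with the Orlicz norm $\|\cdot\|_{\Phi,0}$) is smooth if and only if the following three conditions all hold: (a) $\Phi^*(t,b_{\Phi^*}(t))=\infty$ for $\mu$-a.e. $t\in T$; (b) $\Phi$ satisfies the $\Delta_2$-condition; (c) $\Phi(t,\cdot)$ is continuously differentiable (with $\Phi'_+(t,0)=0$) for $\mu$-a.e. $t\in T$.
   Context: A function $\Phi\colon T\times[0,\infty]\to[0,\infty]$ is a Musielak--Orlicz function if, for $\mu$-a.e. $t\in T$: (i) $\Phi(t,\cdot)$ is convex and lower semi-continuous; (ii) $\Phi(t,0)=\lim_{u\downarrow0}\Phi(t,u)=0$ and $\Phi(t,\infty)=\infty$; and (iii) $\Phi(\cdot,u)$ is measurable for all $u\ge0$. The complementary function is $\Phi^*(t,v)=\sup_{u>0}(uv-\Phi(t,u))$, $v\ge0$; it is again a Musielak--Orlicz function. Put $b_{\Phi}(t)=\sup\{u\ge0:\Phi(t,u)<\infty\}$, and similarly $b_{\Phi^*}$ for $\Phi^*$. $\Phi'_+(t,u)$ is the right derivative of $\Phi(t,\cdot)$ at $u$. $L^0$ is the space of real-valued measurable functions on $T$ (equality $\mu$-a.e.), and $I_\Phi(u)=\int_T\Phi(t,|u(t)|)\,d\mu$. Let $L^\Phi=\{u\in L^0: I_\Phi(\lambda u)<\infty\text{ for some }\lambda>0\}$ and $\tilde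 L^\Phi=\{u\in L^0:I_\Phi(u)<\infty\}$. The Orlicz norm on $L^\Phi$ is $\|u\|_{\Phi,0}=\sup\{|\int_T uv\,d\mu|: v\in\tilde L^{\Phi^*},\ I_{\Phi^*}(v)\le1\}$; it makes $L^\Phi$ a Banach space, denoted $L_0^\Phi$. $\Phi$ satisfies the $\Delta_2$-condition if there exist a non-negative function $f\in\tilde L^\Phi$ and a constant $K>0$ such that, for $\mu$-a.e. $t\in T$, $\Phi(t,2u)\le K\Phi(t,u)$ for all $u\ge f(t)$. A support functional at $x\ne0$ in a Banach space $X$ is an $f\in X^*$ with $\|f\|=1$ and $f(x)=\|x\|$; $x\neq 0$ is a smooth point if it has exactly one support functional; $X$ is smooth if every $x\in X\setminus\{0\}$ is a smooth point. *)

theory Defs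
  imports "HOL-Analysis.Analysis"
begin

definition non_atomic :: "'a measure \<Rightarrow> bool" where
  "non_atomic M \<longleftrightarrow>
     (\<forall>A\<in>sets M. 0 < emeasure M A \<longrightarrow>
        (\<exists>B\<in>sets M. B \<subseteq> A \<and> 0 < emeasure M B \<and> emeasure M B < emeasure M A))"


subsection \<open>Musielak--Orlicz functions\<close>

text \<open>The interval of extended nonnegative reals, including infinity, is the type
  \<^typ>\<open>ennreal\<close>; there \<open>0 * \<infinity> = 0\<close>.\<close>

definition convex_ennreal :: "(ennreal \<Rightarrow> ennreal) \<Rightarrow> bool" where
  "convex_ennreal \<phi> \<longleftrightarrow>
     (\<forall>u v. \<forall>l\<in>{0..1}. \<phi> (ennreal (1 - l) * u + ennreal l * v)
                        \<le> ennreal (1 - l) * \<phi> u + ennreal l * \<phi> v)"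

text \<open>Lower semicontinuity is required at \<open>\<infinity>\<close> as well. Together with
  \<open>\<phi> \<infinity> = \<infinity>\<close> it excludes functions vanishing on all finite arguments.\<close>

definition lsc_ennreal :: "(ennreal \<Rightarrow> ennreal) \<Rightarrow> bool" where
  "lsc_ennreal \<phi> \<longleftrightarrow> (\<forall>u. \<phi> u \<le> Liminf (at u) \<phi>)"

definition musielak_orlicz :: "'a measure \<Rightarrow> ('a \<Rightarrow> ennreal \<Rightarrow> ennreal) \<Rightarrow> bool" where
  "musielak_orlicz M \<Phi> \<longleftrightarrow>
     (AE t in M. convex_ennreal (\<Phi> t) \<and> lsc_ennreal (\<Phi> t) \<and>
        \<Phi> t 0 = 0 \<and> (\<Phi> t \<longlongrightarrow> 0) (at_right 0) \<and> \<Phi> t \<infinity> = \<infinity>) \<and>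
     (\<forall>u. (\<lambda>t. \<Phi> t u) \<in> borel_measurable M)"

text \<open>Subtraction on \<^typ>\<open>ennreal\<close> is truncated at \<open>0\<close>. This does not change the supremum,
  which is nonnegative because \<open>\<Phi> t u\<close> tends to \<open>0\<close> as \<open>u\<close> does. The index \<open>u = \<infinity>\<close> is
  left out because there \<open>\<infinity> - \<infinity> = \<infinity>\<close>.\<close>

definition complementary ::
    "('a \<Rightarrow> ennreal \<Rightarrow> ennreal) \<Rightarrow> 'a \<Rightarrow> ennreal \<Rightarrow> ennreal" where
  "complementary \<Phi> t v = (SUP u\<in>{0<..<\<infinity>}. u * v - \<Phi> t u)"

definition b_fun :: "('a \<Rightarrow> ennreal \<Rightarrow> ennreal) \<Rightarrow> 'a \<Rightarrow> ennreal" where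
  "b_fun \<Phi> t = Sup {u. \<Phi> t u < \<infinity>}"


subsection \<open>The space with the Orlicz norm\<close>

text \<open>Elements of the spaces are represented by measurable functions; equality of elements is
  equality almost everywhere.\<close>

definition modular :: "'a measure \<Rightarrow> ('a \<Rightarrow> ennreal \<Rightarrow> ennreal) \<Rightarrow> ('a \<Rightarrow> real) \<Rightarrow> ennreal" where
  "modular M \<Phi> u = (\<integral>\<^sup>+ t. \<Phi> t (ennreal \<bar>u t\<bar>) \<partial>M)"

definition mo_space :: "'a measure \<Rightarrow> ('a \<Rightarrow> ennreal \<Rightarrow> ennreal) \<Rightarrow> ('a \<Rightarrow> real) set" where
  "mo_space M \<Phi> = {u \<in> borel_measurable M. \<exists>l>0. modular M \<Phi> (\<lambda>t. l * u t) < \<infinity>}"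

definition mo_class :: "'a measure \<Rightarrow> ('a \<Rightarrow> ennreal \<Rightarrow> ennreal) \<Rightarrow> ('a \<Rightarrow> real) set" where
  "mo_class M \<Phi> = {u \<in> borel_measurable M. modular M \<Phi> u < \<infinity>}"

definition orlicz_norm :: "'a measure \<Rightarrow> ('a \<Rightarrow> ennreal \<Rightarrow> ennreal) \<Rightarrow> ('a \<Rightarrow> real) \<Rightarrow> real" where
  "orlicz_norm M \<Phi> u =
     (SUP v\<in>{v \<in> mo_class M (complementary \<Phi>). modular M (complementary \<Phi>) v \<le> 1}.
        \<bar>\<integral>t. u t * v t \<partial>M\<bar>)"

definition delta2 :: "'a measure \<Rightarrow> ('a \<Rightarrow> ennreal \<Rightarrow> ennreal) \<Rightarrow> bool" where
  "delta2 M \<Phi> \<longleftrightarrow>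
     (\<exists>f\<in>mo_class M \<Phi>. \<exists>K::real. (\<forall>t\<in>space M. 0 \<le> f t) \<and> 0 < K \<and>
        (AE t in M. \<forall>u\<ge>ennreal (f t). \<Phi> t (2 * u) \<le> ennreal K * \<Phi> t u))"


subsection \<open>Smoothness\<close>

text \<open>Below, \<open>E\<close> is a linear space of measurable functions, taken modulo equality almost
  everywhere, with norm \<open>N\<close>. A functional on the quotient is a functional on \<open>E\<close> that does not
  distinguish almost everywhere equal functions; membership in \<^term>\<open>extensional E\<close> fixes its
  irrelevant values outside \<open>E\<close>, so that equality of functionals is equality on \<open>E\<close>.\<close>

definition dual_space ::
    "'a measure \<Rightarrow> ('a \<Rightarrow> real) set \<Rightarrow> (('a \<Rightarrow> real) \<Rightarrow> real) \<Rightarrow> (('a \<Rightarrow> real) \<Rightarrow> real) set" where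
  "dual_space M E N = {F \<in> extensional E.
     (\<forall>u\<in>E. \<forall>v\<in>E. (AE t in M. u t = v t) \<longrightarrow> F u = F v) \<and>
     (\<forall>u\<in>E. \<forall>v\<in>E. F (\<lambda>t. u t + v t) = F u + F v) \<and>
     (\<forall>c. \<forall>u\<in>E. F (\<lambda>t. c * u t) = c * F u) \<and>
     (\<exists>C. \<forall>u\<in>E. \<bar>F u\<bar> \<le> C * N u)}"

definition dual_norm ::
    "('a \<Rightarrow> real) set \<Rightarrow> (('a \<Rightarrow> real) \<Rightarrow> real) \<Rightarrow> (('a \<Rightarrow> real) \<Rightarrow> real) \<Rightarrow> real" where
  "dual_norm E N F = (SUP u\<in>{u\<in>E. N u \<le> 1}. \<bar>F u\<bar>)"

definition support_functional ::
    "'a measure \<Rightarrow> ('a \<Rightarrow> real) set \<Rightarrow> (('a \<Rightarrow> real) \<Rightarrow> real) \<Rightarrow>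
     ('a \<Rightarrow> real) \<Rightarrow> (('a \<Rightarrow> real) \<Rightarrow> real) \<Rightarrow> bool" where
  "support_functional M E N x F \<longleftrightarrow>
     F \<in> dual_space M E N \<and> dual_norm E N F = 1 \<and> F x = N x"

definition smooth_point ::
    "'a measure \<Rightarrow> ('a \<Rightarrow> real) set \<Rightarrow> (('a \<Rightarrow> real) \<Rightarrow> real) \<Rightarrow> ('a \<Rightarrow> real) \<Rightarrow> bool" where
  "smooth_point M E N x \<longleftrightarrow>
     x \<in> E \<and> \<not> (AE t in M. x t = 0) \<and> (\<exists>!F. support_functional M E N x F)"

definition smooth_space ::
    "'a measure \<Rightarrow> ('a \<Rightarrow> real) set \<Rightarrow> (('a \<Rightarrow> real) \<Rightarrow> real) \<Rightarrow> bool" where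
  "smooth_space M E N \<longleftrightarrow> (\<forall>x\<in>E. \<not> (AE t in M. x t = 0) \<longrightarrow> smooth_point M E N x)"


subsection \<open>Differentiability\<close>

text \<open>Since \<^const>\<open>enn2real\<close> sends \<open>\<infinity>\<close> to \<open>0\<close>, finiteness on the half-line has to be
  demanded explicitly. The derivative at \<open>0\<close> is the right derivative.\<close>

definition continuously_differentiable :: "(ennreal \<Rightarrow> ennreal) \<Rightarrow> bool" where
  "continuously_differentiable \<phi> \<longleftrightarrow>
     (\<forall>u<\<infinity>. \<phi> u < \<infinity>) \<and>
     (\<exists>D. continuous_on {0..} D \<and>
        (\<forall>x\<ge>0. ((\<lambda>y. enn2real (\<phi> (ennreal y))) has_real_derivative D x) (at x within {0..})))"

definition has_right_derivative :: "(ennreal \<Rightarrow> ennreal) \<Rightarrow> real \<Rightarrow> real \<Rightarrow> bool" where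
  "has_right_derivative \<phi> d x \<longleftrightarrow>
     ((\<lambda>y. enn2real (\<phi> (ennreal y))) has_real_derivative d) (at_right x)"

end

theory Submission
  imports Defs
begin

text \<open>
  Write \<open>I\<close> and \<open>J\<close> for the modulars of \<open>\<Phi>\<close> and of its conjugate. Separation gives the Amemiya
  formula \<open>N y = inf {(1 + I (k y)) / k | k > 0}\<close>, which controls the norm without a
  description of the dual space.

  If the three conditions hold and \<open>x \<noteq> 0\<close>, the function \<open>k \<mapsto> J (\<Phi>'(k \<bar>x\<bar>))\<close> is continuous,
  vanishes at \<open>0\<close> and is unbounded, so it takes the value \<open>1\<close> at some \<open>k\<close>; then
  \<open>w = \<Phi>'(k \<bar>x\<bar>) sgn x\<close> gives equality in Young's inequality and a support functional. Any support
  functional is a subgradient of \<open>u \<mapsto> I (k u) / k\<close> at \<open>x\<close>, and that function is Gateaux differentiable.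

  Conversely, if the conjugate is finite at its endpoint \<open>b\<close> on a set of positive measure, the
  indicator of a small part of that set is supported by \<open>b\<close> on this part, and the values elsewhere are free.
  If there is \<open>u\<close> with \<open>I u < \<infinity> = I (2 u)\<close>, non-atomicity yields disjoint pieces of multiples of \<open>u\<close> whose
  sum \<open>x\<close> satisfies \<open>I x < \<infinity>\<close> while \<open>I (l x) = \<infinity>\<close> for \<open>l > 1\<close> on two disjoint sets; the
  one-sided derivatives of the norm at \<open>x\<close> in the direction of one of the two halves differ, and
  Hahn--Banach extends them to different support functionals. If there is no such \<open>u\<close>, a gliding hump argument
  gives the \<open>\<Delta>\<^sub>2\<close>-condition. Finally, on a set where \<open>\<Phi>\<close> has a kink at \<open>a\<close>, two different
  selections of the subdifferential at \<open>a\<close> with the same \<open>J\<close> support the same function, once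
  \<open>J\<close> has been filled up to \<open>1\<close> on a disjoint set.
\<close>

subsection \<open>Young functions and their conjugates\<close>

text \<open>When the doubling condition fails, the dual may contain functionals that are not
  integrals against a function. For this reason the necessity of doubling is proved through
  one-sided derivatives of the norm, whereas the other two conditions are refuted by pairs of
  explicit integral functionals. The order in which the conditions are derived matters: the kink
  argument raises \<open>J\<close> to exactly 1 on a spare set, which needs finite values of
  \<open>\<Phi>\<close> (a consequence of doubling) and unbounded conjugate values along the
  derivative (a consequence of the endpoint condition). Two technical obstacles shape the text.
  Suprema over all arguments would destroy measurability and a.e. statements, so everything is
  reduced to nonnegative rationals, and measurable maximisers are replaced by running choices among
  the first rationals. Subtraction of \<open>ennreal\<close> is truncated and gives
  \<open>\<infinity> - \<infinity> = \<infinity>\<close>, so differences are formed only behind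
  finiteness or positivity guards. All hypotheses on \<open>\<Phi>\<close> hold only almost
  everywhere; changing \<open>\<Phi>\<close> on null sets reduces to the case where they hold
  everywhere.\<close>

definition young :: "(ennreal \<Rightarrow> ennreal) \<Rightarrow> bool" where
  "young \<phi> \<longleftrightarrow> convex_ennreal \<phi> \<and> lsc_ennreal \<phi> \<and> \<phi> 0 = 0 \<and> (\<phi> \<longlongrightarrow> 0) (at_right 0) \<and> \<phi> \<infinity> = \<infinity>"

definition conjugate :: "(ennreal \<Rightarrow> ennreal) \<Rightarrow> ennreal \<Rightarrow> ennreal" where
  "conjugate \<phi> v = (SUP u\<in>{0<..<\<infinity>}. u * v - \<phi> u)"

lemma complementary_eq_conjugate: "complementary \<Phi> t = conjugate (\<Phi> t)"
  by (simp add: fun_eq_iff complementary_def conjugate_def)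

text \<open>An enumeration of the nonnegative rationals. Suprema along it are countable, which
  preserves measurability and allows exchanging quantifiers with \<open>AE\<close>.\<close>

definition qseq :: "nat \<Rightarrow> real" where
  "qseq = from_nat_into {q \<in> \<rat>. 0 \<le> q}"

lemma range_qseq: "range qseq = {q \<in> \<rat>. 0 \<le> q}"
proof -
  have "countable {q::real. q \<in> \<rat> \<and> 0 \<le> q}"
    by (rule countable_subset[OF _ countable_rat]) auto
  then show ?thesis
    unfolding qseq_def by (intro range_from_nat_into) (auto intro: exI[of _ 0])
qed

lemma qseq_nonneg [simp]: "0 \<le> qseq i"
  using range_qseq by auto

lemma qseq_dense:
  assumes "0 \<le> a" "a < b"
  obtains i where "a < qseq i" "qseq i < b"
proof -
  obtain q where "q \<in> \<rat>" "a < q" "q < b" using Rats_dense_in_real[OF assms(2)] by auto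
  then have "q \<in> range qseq" using assms by (auto simp: range_qseq)
  then show ?thesis using that \<open>a < q\<close> \<open>q < b\<close> by auto
qed

lemma qseq_dense_ennreal:
  assumes "a < (b::ennreal)"
  obtains i where "a < ennreal (qseq i)" "ennreal (qseq i) < b"
proof -
  obtain c where c: "a < c" "c < b" using dense[OF assms] by auto
  obtain d where d: "a < d" "d < c" using dense[OF c(1)] by auto
  have "c < top" "d < top" using c d by (auto intro: less_trans simp: less_top[symmetric])
  then obtain c' d' where cd: "c = ennreal c'" "0 \<le> c'" "d = ennreal d'" "0 \<le> d'"
    by (metis ennreal_cases less_irrefl infinity_ennreal_def)
  then have "d' < c'" using d by (simp add: ennreal_less_iff)
  then obtain i where "d' < qseq i" "qseq i < c'" using qseq_dense[OF cd(4)] by blast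
  then have "d < ennreal (qseq i)" "ennreal (qseq i) < c" using cd by (auto simp: ennreal_less_iff)
  then show ?thesis using that c d by (meson less_trans)
qed

lemma young_zero [simp]: "young \<phi> \<Longrightarrow> \<phi> 0 = 0"
  by (simp add: young_def)

lemma young_top [simp]: "young \<phi> \<Longrightarrow> \<phi> top = top"
  by (simp add: young_def)

lemma young_scale:
  assumes "young \<phi>" "0 \<le> l" "l \<le> 1"
  shows "\<phi> (ennreal l * u) \<le> ennreal l * \<phi> u"
proof -
  have "\<phi> (ennreal (1 - l) * 0 + ennreal l * u) \<le> ennreal (1 - l) * \<phi> 0 + ennreal l * \<phi> u"
    using assms unfolding young_def convex_ennreal_def by (meson atLeastAtMost_iff)
  then show ?thesis using assms by simp
qed

text \<open>Below a finite positive \<open>v\<close>, every \<open>u\<close> is \<open>v\<close>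
  scaled by a factor at most 1, and convexity with \<open>\<phi> 0 = 0\<close> controls
  scaling.\<close>

lemma young_mono:
  assumes "young \<phi>" "u \<le> v"
  shows "\<phi> u \<le> \<phi> v"
proof (cases "v = top \<or> v = 0")
  case True
  then show ?thesis using assms by auto
next
  case False
  then obtain v' where v: "v = ennreal v'" "0 < v'"
    by (metis ennreal_cases ennreal_eq_0_iff less_eq_real_def order_refl not_le)
  obtain u' where u: "u = ennreal u'" "0 \<le> u'" using assms(2) v
    by (metis ennreal_cases ennreal_less_top not_le)
  have "u' \<le> v'" using assms(2) u v by (simp add: ennreal_le_iff2)
  then have l: "0 \<le> u'/v'" "u'/v' \<le> 1" using u v by auto
  have "\<phi> (ennreal (u'/v') * v) \<le> ennreal (u'/v') * \<phi> v"
    by (rule young_scale[OF assms(1) l])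
  also have "\<dots> \<le> 1 * \<phi> v" using l by (intro mult_right_mono) (auto simp: ennreal_le_1)
  also have "ennreal (u'/v') * v = u" using v u by (simp add: ennreal_mult[symmetric])
  finally show ?thesis by simp
qed

lemma young_convex:
  assumes "young \<phi>" "0 \<le> u" "0 \<le> v" "0 \<le> l" "l \<le> 1"
  shows "\<phi> (ennreal ((1 - l) * u + l * v)) \<le> ennreal (1 - l) * \<phi> (ennreal u) + ennreal l * \<phi> (ennreal v)"
proof -
  have "\<phi> (ennreal (1 - l) * ennreal u + ennreal l * ennreal v)
      \<le> ennreal (1 - l) * \<phi> (ennreal u) + ennreal l * \<phi> (ennreal v)"
    using assms unfolding young_def convex_ennreal_def by (meson atLeastAtMost_iff)
  then show ?thesis using assms by (simp add: ennreal_mult[symmetric] ennreal_plus[symmetric] del: ennreal_plus)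
qed

text \<open>Lower semicontinuity is used only from the left. The case \<open>u = \<infinity>\<close>
  is included; it is what makes finite arguments reach arbitrarily large values.\<close>

lemma young_left_lsc:
  assumes "young \<phi>" "c < \<phi> u"
  obtains i where "ennreal (qseq i) < u" "c < \<phi> (ennreal (qseq i))"
proof -
  have "0 < u" using assms by (metis not_gr_zero not_less_zero young_zero)
  have "c < Liminf (at u) \<phi>"
    using assms unfolding young_def lsc_ennreal_def by (metis less_le_trans)
  then have "eventually (\<lambda>s. c < \<phi> s) (at u)" by (rule less_LiminfD)
  then have "eventually (\<lambda>s. c < \<phi> s) (at_left u)" by (simp add: eventually_at_split)
  then obtain b where b: "b < u" "\<And>s. b < s \<Longrightarrow> s < u \<Longrightarrow> c < \<phi> s"
    using eventually_at_left[OF \<open>0 < u\<close>] by auto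
  then obtain i where "b < ennreal (qseq i)" "ennreal (qseq i) < u"
    using qseq_dense_ennreal by blast
  then show ?thesis using that b by blast
qed

text \<open>Strict comparison \<open>qseq i < u\<close> keeps the family countable and depending
  measurably on \<open>u\<close>, so \<open>\<Phi> t (w t)\<close> is measurable for measurable
  \<open>w\<close>.\<close>

lemma young_eq_SUP:
  assumes "young \<phi>"
  shows "\<phi> u = (SUP i. if ennreal (qseq i) < u then \<phi> (ennreal (qseq i)) else 0)"
proof (rule antisym)
  show "\<phi> u \<le> (SUP i. if ennreal (qseq i) < u then \<phi> (ennreal (qseq i)) else 0)"
  proof (rule dense_le)
    fix c assume "c < \<phi> u"
    then obtain i where i: "ennreal (qseq i) < u" "c < \<phi> (ennreal (qseq i))"
      using young_left_lsc assms by blast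
    then have "c \<le> (if ennreal (qseq i) < u then \<phi> (ennreal (qseq i)) else 0)" by simp
    also have "\<dots> \<le> (SUP i. if ennreal (qseq i) < u then \<phi> (ennreal (qseq i)) else 0)"
      by (rule SUP_upper) simp
    finally show "c \<le> \<dots>" .
  qed
  show "(SUP i. if ennreal (qseq i) < u then \<phi> (ennreal (qseq i)) else 0) \<le> \<phi> u"
    by (rule SUP_least) (auto intro: young_mono[OF assms] less_imp_le)
qed

text \<open>A value strictly below \<open>\<phi>\<close> at the supremum is already exceeded at a
  rational strictly below it, hence below some \<open>u i\<close>; no monotonicity of the sequence
  is involved.\<close>

lemma young_SUP_le:
  assumes "young \<phi>" "\<And>i. \<phi> (u i) \<le> c"
  shows "\<phi> (SUP i. u i) \<le> c"
proof (rule dense_le)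
  fix d assume "d < \<phi> (SUP i. u i)"
  then obtain j where j: "ennreal (qseq j) < (SUP i. u i)" "d < \<phi> (ennreal (qseq j))"
    using young_left_lsc assms(1) by blast
  then obtain i where "ennreal (qseq j) < u i" by (auto simp: less_SUP_iff)
  then have "\<phi> (ennreal (qseq j)) \<le> \<phi> (u i)" using young_mono[OF assms(1)] by simp
  then show "d \<le> c" using j assms(2)[of i] by simp
qed

lemma young_small:
  assumes "young \<phi>" "0 < e"
  obtains d where "0 < d" "\<phi> (ennreal d) < e"
proof -
  have "eventually (\<lambda>s. \<phi> s < e) (at_right 0)"
    using assms unfolding young_def by (auto dest: order_tendstoD)
  then obtain b :: ennreal where b: "0 < b" "\<And>s. 0 < s \<Longrightarrow> s < b \<Longrightarrow> \<phi> s < e"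
    using eventually_at_right[of 0 1 "\<lambda>s. \<phi> s < e"] by auto
  then obtain i where "0 < ennreal (qseq i)" "ennreal (qseq i) < b"
    using qseq_dense_ennreal by blast
  then show ?thesis using that b by (metis ennreal_less_zero_iff)
qed

lemma young_large:
  assumes "young \<phi>" "c < top"
  obtains u where "0 < u" "c < \<phi> (ennreal u)"
proof -
  have "c < \<phi> top" using assms by simp
  then obtain i where i: "c < \<phi> (ennreal (qseq i))" using young_left_lsc[OF assms(1)] by blast
  then have "qseq i \<noteq> 0" using assms(1) by auto
  then show ?thesis using that i qseq_nonneg[of i] by (metis less_eq_real_def)
qed

section \<open>Young's inequality, the conjugate and biconjugation\<close>

lemma young_inequality:
  assumes "young \<phi>" "u < top"
  shows "u * v \<le> \<phi> u + conjugate \<phi> v"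
proof (cases "u = 0")
  case False
  then have "u * v - \<phi> u \<le> conjugate \<phi> v"
    unfolding conjugate_def using assms by (intro SUP_upper) (auto simp: zero_less_iff_neq_zero)
  then show ?thesis by (metis ennreal_minus_le_iff)
qed auto

lemma conjugate_le:
  assumes "v < top" "\<And>u. 0 < u \<Longrightarrow> ennreal u * v \<le> \<phi> (ennreal u) + c"
  shows "conjugate \<phi> v \<le> c"
  unfolding conjugate_def
proof (rule SUP_least)
  fix u :: ennreal assume "u \<in> {0<..<\<infinity>}"
  then obtain u' where u: "u = ennreal u'" "0 < u'"
    by (metis ennreal_cases ennreal_less_zero_iff greaterThanLessThan_iff infinity_ennreal_def less_irrefl)
  then have "u * v < top" using assms(1) by (simp add: ennreal_mult_less_top)
  then show "u * v - \<phi> u \<le> c" using assms(2)[OF u(2)] u by (auto simp: ennreal_minus_le_iff)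
qed

lemma conjugate_eq_SUP:
  assumes "young \<phi>"
  shows "conjugate \<phi> v = (SUP i. ennreal (qseq i) * v - \<phi> (ennreal (qseq i)))"
proof (rule antisym)
  show "conjugate \<phi> v \<le> (SUP i. ennreal (qseq i) * v - \<phi> (ennreal (qseq i)))"
    unfolding conjugate_def
  proof (rule SUP_least, rule dense_le)
    fix u c :: ennreal assume u: "u \<in> {0<..<\<infinity>}" and c: "c < u * v - \<phi> u"
    \<comment> \<open>Moving \<open>u\<close> down to a nearby rational keeps the product above
      \<open>c + \<phi> u\<close> and only decreases \<open>\<phi>\<close>. For
      \<open>v = top\<close> any positive rational at which \<open>\<phi>\<close> is finite gives an
      infinite difference.\<close>
    have "\<exists>i. ennreal (qseq i) \<le> u \<and> c + \<phi> u < ennreal (qseq i) * v \<or> v = top \<and> 0 < qseq i \<and> \<phi> (ennreal (qseq i)) < top"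
    proof (cases "v = top")
      case True
      obtain d where d: "0 < d" "\<phi> (ennreal d) < top" using young_small[OF assms, of top] by auto
      then obtain i where "0 < qseq i" "qseq i < d" using qseq_dense by blast
      then show ?thesis using True young_mono[OF assms, of "ennreal (qseq i)" "ennreal d"] d
        by (intro exI[of _ i]) (auto intro: le_less_trans simp: ennreal_leI)
    next
      case False
      then have "u * v < top" using u by (simp add: ennreal_mult_less_top less_top)
      have "\<phi> u < top"
      proof (rule ccontr)
        assume "\<not> ?thesis"
        then have "\<phi> u = top" by (simp add: less_top[symmetric])
        then have "u * v - \<phi> u = 0" using \<open>u * v < top\<close> by (simp add: minus_top_ennreal)
        then show False using c by simp
      qed
      then have "c + \<phi> u < u * v" using c \<open>u * v < top\<close>
        by (metis add.commute ennreal_minus_le_iff less_irrefl less_top not_le)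
      have "u * v = (SUP s\<in>{..<u}. s) * v" using u by (simp add: Sup_lessThan)
      also have "\<dots> = (SUP s\<in>{..<u}. s * v)" using u by (subst SUP_mult_right_ennreal) auto
      finally obtain s where s: "s < u" "c + \<phi> u < s * v"
        using \<open>c + \<phi> u < u * v\<close> by (auto simp: less_SUP_iff)
      then obtain i where "s < ennreal (qseq i)" "ennreal (qseq i) < u" using qseq_dense_ennreal by blast
      then have "c + \<phi> u < ennreal (qseq i) * v" using s
        by (meson less_imp_le less_le_trans mult_right_mono zero_le)
      then show ?thesis using \<open>ennreal (qseq i) < u\<close> by (intro exI[of _ i]) auto
    qed
    then obtain i where "c \<le> ennreal (qseq i) * v - \<phi> (ennreal (qseq i))"
    proof (elim exE disjE conjE)
      fix i assume i: "ennreal (qseq i) \<le> u" "c + \<phi> u < ennreal (qseq i) * v"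
      then have "\<phi> (ennreal (qseq i)) + c \<le> \<phi> u + c" using young_mono[OF assms] by (simp add: add_right_mono)
      also have "\<dots> \<le> ennreal (qseq i) * v" using i by (simp add: add.commute)
      finally have "c \<le> ennreal (qseq i) * v - \<phi> (ennreal (qseq i))"
        by (simp add: ennreal_le_minus_iff add.commute)
      then show thesis by (rule that)
    next
      fix i assume i: "v = top" "0 < qseq i" "\<phi> (ennreal (qseq i)) < top"
      then have "c \<le> ennreal (qseq i) * v - \<phi> (ennreal (qseq i))"
        by (simp add: ennreal_mult_top)
      then show thesis by (rule that)
    qed
    then show "c \<le> (SUP i. ennreal (qseq i) * v - \<phi> (ennreal (qseq i)))" by (meson SUP_upper2 UNIV_I)
  qed
  show "(SUP i. ennreal (qseq i) * v - \<phi> (ennreal (qseq i))) \<le> conjugate \<phi> v"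
  proof (rule SUP_least)
    fix i
    show "ennreal (qseq i) * v - \<phi> (ennreal (qseq i)) \<le> conjugate \<phi> v"
      unfolding conjugate_def
    proof (cases "qseq i = 0")
      case False
      then have "0 < qseq i" using qseq_nonneg[of i] by linarith
      then show "ennreal (qseq i) * v - \<phi> (ennreal (qseq i)) \<le> (SUP u\<in>{0<..<\<infinity>}. u * v - \<phi> u)"
        by (intro SUP_upper) auto
    qed auto
  qed
qed

lemma conjugate_mono: "v \<le> w \<Longrightarrow> conjugate \<phi> v \<le> conjugate \<phi> w"
  unfolding conjugate_def by (intro SUP_subset_mono ennreal_minus_mono mult_left_mono) auto

lemma conjugate_zero [simp]: "conjugate \<phi> 0 = 0"
  by (simp add: conjugate_def)

lemma conjugate_top [simp]:
  assumes "young \<phi>" shows "conjugate \<phi> top = top"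
proof -
  obtain d where d: "0 < d" "\<phi> (ennreal d) < top" using young_small[OF assms, of top] by auto
  then have "top = ennreal d * top - \<phi> (ennreal d)" by (simp add: ennreal_mult_top)
  also have "\<dots> \<le> conjugate \<phi> top" unfolding conjugate_def using d by (intro SUP_upper) auto
  finally show ?thesis by (simp add: top_unique)
qed

text \<open>If \<open>\<phi>\<close> exceeds 1 at \<open>u0\<close>, convexity forces growth of
  slope at least \<open>1/u0\<close> beyond \<open>u0\<close>, so the line of that slope exceeds
  \<open>\<phi>\<close> by at most 1 anywhere.\<close>

lemma conjugate_finite:
  assumes "young \<phi>"
  obtains d where "0 < d" "conjugate \<phi> (ennreal d) < top"
proof -
  obtain u0 where u0: "0 < u0" "1 < \<phi> (ennreal u0)" using young_large[OF assms, of 1] by auto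
  have "conjugate \<phi> (ennreal (1/u0)) \<le> 1"
  proof (rule conjugate_le)
    fix u :: real assume u: "0 < u"
    show "ennreal u * ennreal (1/u0) \<le> \<phi> (ennreal u) + 1"
    proof (cases "u \<le> u0")
      case True
      then have "ennreal u * ennreal (1/u0) \<le> 1" using u u0
        by (simp add: ennreal_mult[symmetric] ennreal_le_1)
      then show ?thesis by (simp add: add_increasing)
    next
      case False
      have "1 \<le> \<phi> (ennreal (u0/u) * ennreal u)" using u0 u by (simp add: ennreal_mult[symmetric])
      also have "\<dots> \<le> ennreal (u0/u) * \<phi> (ennreal u)" using u0 u False by (intro young_scale[OF assms]) auto
      finally have "ennreal (u/u0) * 1 \<le> ennreal (u/u0) * (ennreal (u0/u) * \<phi> (ennreal u))" 
        by (rule mult_left_mono) simp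
      also have "\<dots> = \<phi> (ennreal u)" using u0 u
        by (simp add: mult.assoc[symmetric] ennreal_mult[symmetric])
      finally show ?thesis using u u0 by (simp add: ennreal_mult[symmetric] add_increasing2)
    qed
  qed simp
  then show ?thesis using that[of "1/u0"] u0 le_less_trans[OF _ ennreal_one_less_top] by auto
qed

lemma conjugate_convex:
  assumes "young \<phi>" "0 \<le> u" "0 \<le> v" "0 \<le> l" "l \<le> 1"
  shows "conjugate \<phi> (ennreal ((1 - l) * u + l * v)) \<le> ennreal (1 - l) * conjugate \<phi> (ennreal u) + ennreal l * conjugate \<phi> (ennreal v)"
proof (rule conjugate_le)
  fix s :: real assume s: "0 < s"
  have "ennreal s * ennreal ((1 - l) * u + l * v) = ennreal (1 - l) * (ennreal s * ennreal u) + ennreal l * (ennreal s * ennreal v)"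
    using assms s by (simp add: ennreal_mult[symmetric] ennreal_plus[symmetric] del: ennreal_plus) (simp add: algebra_simps)
  also have "\<dots> \<le> ennreal (1 - l) * (\<phi> (ennreal s) + conjugate \<phi> (ennreal u)) + ennreal l * (\<phi> (ennreal s) + conjugate \<phi> (ennreal v))"
    by (intro add_mono mult_left_mono young_inequality assms) auto
  also have "\<dots> = (ennreal (1 - l) + ennreal l) * \<phi> (ennreal s) + (ennreal (1 - l) * conjugate \<phi> (ennreal u) + ennreal l * conjugate \<phi> (ennreal v))"
    by (simp only: distrib_left distrib_right ac_simps)
  also have "ennreal (1 - l) + ennreal l = 1" using assms by (simp add: ennreal_plus[symmetric] del: ennreal_plus)
  finally show "ennreal s * ennreal ((1 - l) * u + l * v) \<le> \<phi> (ennreal s) + (ennreal (1 - l) * conjugate \<phi> (ennreal u) + ennreal l * conjugate \<phi> (ennreal v))"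
    by simp
qed simp

text \<open>The second identity is the chord value with its denominator cleared, so that three-point
  estimates become comparisons of linear expressions.\<close>

lemma convex_coeff:
  fixes a b c :: real
  assumes "a < c" "l = (b - a) / (c - a)"
  shows "(1 - l) * a + l * c = b" "(c - a) * ((1 - l) * x + l * y) = (c - b) * x + (b - a) * y"
proof -
  have l: "l * (c - a) = b - a" using assms by simp
  show "(1 - l) * a + l * c = b" using l by (simp add: algebra_simps)
  have "(c - a) * ((1 - l) * x + l * y) = (c - a) * x - (l * (c - a)) * x + (l * (c - a)) * y"
    by (simp add: algebra_simps)
  then show "(c - a) * ((1 - l) * x + l * y) = (c - b) * x + (b - a) * y"
    unfolding l by (simp add: algebra_simps)
qed

text \<open>Fenchel--Moreau with rational slopes: for \<open>c0 < c1\<close> below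
  \<open>\<phi> u\<close>, a line through \<open>(u, c1)\<close> lies below \<open>\<phi>\<close>,
  and a slightly flatter one of rational slope through \<open>(u, c0)\<close> still does.\<close>

lemma young_biconjugate:
  assumes "young \<phi>" "0 \<le> u"
  shows "\<phi> (ennreal u) = (SUP i. ennreal (u * qseq i) - conjugate \<phi> (ennreal (qseq i)))"
proof (rule antisym)
  show "(SUP i. ennreal (u * qseq i) - conjugate \<phi> (ennreal (qseq i))) \<le> \<phi> (ennreal u)"
  proof (rule SUP_least)
    fix i
    have "ennreal (u * qseq i) \<le> conjugate \<phi> (ennreal (qseq i)) + \<phi> (ennreal u)"
      using young_inequality[OF assms(1), of "ennreal u" "ennreal (qseq i)"] assms(2)
      by (simp add: ennreal_mult add.commute)
    then show "ennreal (u * qseq i) - conjugate \<phi> (ennreal (qseq i)) \<le> \<phi> (ennreal u)"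
      by (simp add: ennreal_minus_le_iff)
  qed
  show "\<phi> (ennreal u) \<le> (SUP i. ennreal (u * qseq i) - conjugate \<phi> (ennreal (qseq i)))"
  proof (rule dense_le)
    fix c assume c: "c < \<phi> (ennreal u)"
    obtain c' where c': "c < c'" "c' < \<phi> (ennreal u)" using dense[OF c] by auto
    obtain c0 where c0: "c = ennreal c0" "0 \<le> c0" using c'(1) less_trans[OF c'] top.not_eq_extremum by (cases c) (auto simp: less_top[symmetric])
    obtain c1 where c1: "c' = ennreal c1" "0 \<le> c1" using c'(2) by (cases c') auto
    have c01: "c0 < c1" using c' c0 c1 by (simp add: ennreal_less_iff)
    have "0 < u" using c assms by (cases "u = 0") auto
    obtain k where k: "ennreal (qseq k) < ennreal u" "c' < \<phi> (ennreal (qseq k))"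
      using young_left_lsc[OF assms(1) c'(2)] by blast
    define u0 where "u0 = qseq k"
    have u0: "0 \<le> u0" "u0 < u" "ennreal c1 < \<phi> (ennreal u0)"
      using k c1 by (auto simp: u0_def ennreal_less_iff)
    \<comment> \<open>The slope \<open>v'\<close> is the least one whose line through
      \<open>(u, c1)\<close> stays below \<open>\<phi>\<close> at the points of \<open>S\<close>.
      Since \<open>\<phi>\<close> exceeds \<open>c1\<close> at \<open>u0 < u\<close>, the set
      \<open>S\<close> stays left of \<open>u0\<close> and the slopes are bounded.\<close>
    define S where "S = {s. 0 \<le> s \<and> s < u \<and> \<phi> (ennreal s) \<le> ennreal c1}"
    define r where "r = (\<lambda>s. (c1 - enn2real (\<phi> (ennreal s))) / (u - s))"
    define v' where "v' = (SUP s\<in>S. r s)"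
    have S0: "0 \<in> S" using \<open>0 < u\<close> assms(1) by (simp add: S_def)
    have Su0: "s < u0" if "s \<in> S" for s
    proof (rule ccontr)
      assume "\<not> s < u0"
      then have "\<phi> (ennreal u0) \<le> \<phi> (ennreal s)" using u0 by (intro young_mono[OF assms(1)]) (simp add: ennreal_leI)
      then show False using that u0 by (auto simp: S_def)
    qed
    have Sfin: "\<phi> (ennreal s) = ennreal (enn2real (\<phi> (ennreal s)))" "enn2real (\<phi> (ennreal s)) \<le> c1" if "s \<in> S" for s
      using that c1 by (auto simp: S_def intro!: enn2real_leI ennreal_enn2real[symmetric] intro: le_less_trans)
    have rS: "r s \<le> c1 / (u - u0)" if "s \<in> S" for s
      unfolding r_def using Su0[OF that] u0 c1 Sfin[OF that] by (intro frac_le) auto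
    then have bdd: "bdd_above (r ` S)" by (auto intro!: bdd_aboveI2)
    have A: "r s \<le> v'" if "s \<in> S" for s unfolding v'_def using bdd that by (rule cSUP_upper2) auto
    have v'0: "c1 \<le> u * v'" using A[OF S0] \<open>0 < u\<close> assms(1) by (simp add: r_def field_simps)
    have "0 \<le> c1 / u" using c1 \<open>0 < u\<close> by simp
    then have v'nn: "0 \<le> v'" using A[OF S0] assms(1) by (simp add: r_def)
    have line: "c1 + v' * (s - u) \<le> enn2real (\<phi> (ennreal s))" if s: "0 \<le> s" "\<phi> (ennreal s) < top" for s
    proof -
      consider "s \<in> S" | "s \<notin> S" "s \<le> u" | "u < s" by (cases "s \<le> u") auto
      then show ?thesis
      proof cases
        case 1
        have "(c1 - enn2real (\<phi> (ennreal s))) \<le> v' * (u - s)"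
          using A[OF 1] 1 by (simp add: r_def S_def field_simps)
        then show ?thesis by (simp add: algebra_simps)
      next
        case 2
        have "ennreal c1 \<le> \<phi> (ennreal s)"
          using 2 s c1 c' by (cases "s = u") (auto simp: S_def)
        then have "c1 \<le> enn2real (\<phi> (ennreal s))"
          by (metis c1(2) enn2real_ennreal enn2real_mono s(2))
        moreover have "v' * (s - u) \<le> 0" using 2 v'nn by (simp add: mult_nonneg_nonpos)
        ultimately show ?thesis by simp
      next
        case 3
        \<comment> \<open>To the right of \<open>u\<close> the line is safe because
          \<open>c1\<close> is below \<open>\<phi> u\<close>, hence below the chord from any
          \<open>s1 \<in> S\<close> to \<open>s\<close>: each left slope is at most the right
          slope.\<close>
        have "v' \<le> (enn2real (\<phi> (ennreal s)) - c1) / (s - u)"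
          unfolding v'_def
        proof (rule cSUP_least)
          show "S \<noteq> {}" using S0 by auto
          fix s1 assume s1: "s1 \<in> S"
          have s1': "0 \<le> s1" "s1 < u" using s1 by (auto simp: S_def)
          define l where "l = (u - s1) / (s - s1)"
          have l: "0 \<le> l" "l \<le> 1" using s1' 3 by (auto simp: l_def)
          have lu: "(1 - l) * s1 + l * s = u" using s1' 3 convex_coeff(1)[OF _ l_def] by simp
          have "ennreal c1 \<le> \<phi> (ennreal u)" using c' c1 by simp
          also have "\<dots> \<le> ennreal (1 - l) * \<phi> (ennreal s1) + ennreal l * \<phi> (ennreal s)"
            using young_convex[OF assms(1) s1'(1) s(1) l] lu by simp
          also have "\<dots> = ennreal ((1 - l) * enn2real (\<phi> (ennreal s1)) + l * enn2real (\<phi> (ennreal s)))"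
          proof -
            obtain z where z: "\<phi> (ennreal s) = ennreal z" "0 \<le> z" using s by (auto simp: less_top_ennreal)
            have "\<phi> (ennreal s1) < top" using s1 c1 by (auto simp: S_def intro: le_less_trans)
            then obtain x where x: "\<phi> (ennreal s1) = ennreal x" "0 \<le> x" by (auto simp: less_top_ennreal)
            show ?thesis using l x z by (simp add: ennreal_mult)
          qed
          finally have "c1 \<le> (1 - l) * enn2real (\<phi> (ennreal s1)) + l * enn2real (\<phi> (ennreal s))"
            using l by (subst (asm) ennreal_le_iff) auto
          then have "(s - s1) * c1 \<le> (s - s1) * ((1 - l) * enn2real (\<phi> (ennreal s1)) + l * enn2real (\<phi> (ennreal s)))"
            using s1' 3 by (intro mult_left_mono) auto
          also have "\<dots> = (s - u) * enn2real (\<phi> (ennreal s1)) + (u - s1) * enn2real (\<phi> (ennreal s))"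
            using s1' 3 by (intro convex_coeff(2)[OF _ l_def]) simp
          finally show "r s1 \<le> (enn2real (\<phi> (ennreal s)) - c1) / (s - u)"
            unfolding r_def using s1' 3 by (simp add: field_simps)
        qed
        then show ?thesis using 3 by (simp add: field_simps)
      qed
    qed
    \<comment> \<open>Replacing \<open>v'\<close> by a smaller rational lifts the line to the left
      of \<open>u\<close>, by at most \<open>(v' - qseq j) * u\<close> on nonnegative arguments;
      lowering its height at \<open>u\<close> from \<open>c1\<close> to \<open>c0\<close> pays for
      this.\<close>
    obtain j where j: "qseq j \<le> v'" "(v' - qseq j) * u \<le> c1 - c0"
    proof (cases "v' = 0")
      case True
      have "0 \<in> range qseq" by (simp add: range_qseq)
      then obtain j where "qseq j = 0" by (metis rangeE)
      then show ?thesis using that[of j] True c01 by simp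
    next
      case False
      have "max 0 (v' - (c1 - c0) / u) < v'" using False v'nn c01 \<open>0 < u\<close> by auto
      then obtain j where "max 0 (v' - (c1 - c0) / u) < qseq j" "qseq j < v'"
        using qseq_dense[of "max 0 (v' - (c1 - c0) / u)" v'] by auto
      then show ?thesis using that[of j] \<open>0 < u\<close> by (simp add: field_simps)
    qed
    have line2: "c0 + qseq j * (s - u) \<le> c1 + v' * (s - u)" if "0 \<le> s" for s
    proof (cases "s \<le> u")
      case True
      have "(v' - qseq j) * (u - s) \<le> (v' - qseq j) * u" using j that by (intro mult_left_mono) auto
      then show ?thesis using j by (simp add: algebra_simps)
    next
      case False
      then have "qseq j * (s - u) \<le> v' * (s - u)" using j by (intro mult_right_mono) auto
      then show ?thesis using c01 by simp
    qed
    have nn: "0 \<le> u * qseq j - c0" using line2[of 0] v'0 line[of 0] assms(1) by (simp add: algebra_simps)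
    have "conjugate \<phi> (ennreal (qseq j)) \<le> ennreal (u * qseq j - c0)"
    proof (rule conjugate_le)
      fix s :: real assume s: "0 < s"
      show "ennreal s * ennreal (qseq j) \<le> \<phi> (ennreal s) + ennreal (u * qseq j - c0)"
      proof (cases "\<phi> (ennreal s) = top")
        case False
        then have f: "\<phi> (ennreal s) < top" by (simp add: less_top)
        have "s * qseq j \<le> enn2real (\<phi> (ennreal s)) + (u * qseq j - c0)"
          using line[of s] line2[of s] s f by (simp add: algebra_simps)
        then have "ennreal (s * qseq j) \<le> ennreal (enn2real (\<phi> (ennreal s)) + (u * qseq j - c0))"
          by (rule ennreal_leI)
        also have "\<dots> = \<phi> (ennreal s) + ennreal (u * qseq j - c0)" using nn f by (simp add: ennreal_enn2real)
        finally show ?thesis using s by (simp add: ennreal_mult)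
      qed simp
    qed simp
    then have "ennreal c0 \<le> ennreal (u * qseq j) - conjugate \<phi> (ennreal (qseq j))"
    proof -
      assume "conjugate \<phi> (ennreal (qseq j)) \<le> ennreal (u * qseq j - c0)"
      then have "ennreal c0 + conjugate \<phi> (ennreal (qseq j)) \<le> ennreal c0 + ennreal (u * qseq j - c0)"
        by (rule add_left_mono)
      also have "\<dots> = ennreal (u * qseq j)" using nn c0 by (simp add: ennreal_plus[symmetric] del: ennreal_plus)
      finally show ?thesis by (simp add: ennreal_le_minus_iff)
    qed
    then show "c \<le> (SUP i. ennreal (u * qseq i) - conjugate \<phi> (ennreal (qseq i)))"
      unfolding c0(1) by (meson SUP_upper2 UNIV_I)
  qed
qed

text \<open>A kink of \<open>\<phi>\<close> at \<open>a\<close> is an affine piece of the conjugate with slope \<open>a\<close>. Testing midpoints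
  of rational intervals detects such pieces and yields \<open>a\<close> as a measurable function.\<close>

lemma conjugate_affine:
  assumes "young \<phi>" "0 \<le> v" "v < w"
    and fin: "conjugate \<phi> (ennreal w) < top"
    and aff: "conjugate \<phi> (ennreal v) + conjugate \<phi> (ennreal w) = 2 * conjugate \<phi> (ennreal ((v + w) / 2))"
  defines "a \<equiv> (enn2real (conjugate \<phi> (ennreal w)) - enn2real (conjugate \<phi> (ennreal v))) / (w - v)"
  shows "0 \<le> a" "ennreal (a * v) = \<phi> (ennreal a) + conjugate \<phi> (ennreal v)"
    "ennreal (a * w) = \<phi> (ennreal a) + conjugate \<phi> (ennreal w)"
proof -
  define m where "m = (v + w) / 2"
  define g where "g = (\<lambda>s. enn2real (conjugate \<phi> (ennreal s)))"
  have m: "v < m" "m < w" "0 \<le> m" using assms by (auto simp: m_def)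
  have le: "conjugate \<phi> (ennreal s) \<le> conjugate \<phi> (ennreal w)" if "s \<le> w" for s
    using that by (intro conjugate_mono ennreal_leI)
  have gv: "conjugate \<phi> (ennreal v) = ennreal (g v)" and gm: "conjugate \<phi> (ennreal m) = ennreal (g m)"
    and gw: "conjugate \<phi> (ennreal w) = ennreal (g w)"
    unfolding g_def using le[of v] le[of m] fin m assms(3) by (auto intro!: ennreal_enn2real[symmetric] intro: le_less_trans)
  have gnn: "0 \<le> g s" for s by (simp add: g_def)
  have sum: "g v + g w = 2 * g m"
  proof -
    have "ennreal (g v + g w) = ennreal (2 * g m)"
      using aff gv gm gw gnn by (simp add: ennreal_mult m_def)
    then show ?thesis using gnn ennreal_inj[of "g v + g w" "2 * g m"] by (simp del: ennreal_plus)
  qed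
  have "g v \<le> g w" using le[of v] gv gw assms gnn by simp
  then show a0: "0 \<le> a" using assms by (simp add: a_def g_def)
  have aw: "g w = g m + a * (w - m)" and av: "g v = g m + a * (v - m)"
  proof -
    have "a * (w - v) = g w - g v" using assms(3) by (simp add: a_def g_def)
    moreover have "w - m = (w - v) / 2" "v - m = - ((w - v) / 2)" by (simp_all add: m_def field_simps)
    ultimately have "a * (w - m) = (g w - g v) / 2" "a * (v - m) = - ((g w - g v) / 2)"
      by (metis times_divide_eq_right mult_minus_right)+
    then show "g w = g m + a * (w - m)" "g v = g m + a * (v - m)" using sum by (simp_all add: field_simps)
  qed
  have three: "g y \<le> (1 - l) * g x + l * g z"
    if "0 \<le> x" "0 \<le> z" "0 \<le> l" "l \<le> 1" "y = (1 - l) * x + l * z" "conjugate \<phi> (ennreal x) < top" "conjugate \<phi> (ennreal z) < top" for x y z l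
  proof -
    have "conjugate \<phi> (ennreal y) \<le> ennreal (1 - l) * conjugate \<phi> (ennreal x) + ennreal l * conjugate \<phi> (ennreal z)"
      using conjugate_convex[OF assms(1) that(1-4)] that(5) by simp
    also have "\<dots> = ennreal (1 - l) * ennreal (g x) + ennreal l * ennreal (g z)"
      using that by (simp add: g_def ennreal_enn2real)
    also have "\<dots> = ennreal ((1 - l) * g x + l * g z)"
      using that gnn by (simp add: ennreal_mult)
    finally show ?thesis
      unfolding g_def using that by (intro enn2real_leI) (auto simp: g_def)
  qed
  \<comment> \<open>Equality at the midpoint puts \<open>v\<close>, \<open>m\<close>,
    \<open>w\<close> on one line, and by convexity a finite value under its extension would violate
    the three-point inequality. Hence the line of slope \<open>a\<close> supports \<open>g\<close>,
    and biconjugation evaluates \<open>\<phi>\<close> at \<open>a\<close>.\<close>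
  have sub: "g m + a * (q - m) \<le> g q" if q: "0 \<le> q" "conjugate \<phi> (ennreal q) < top" for q
  proof -
    consider "q = m" | "q < m" | "m < q" by linarith
    then show ?thesis
    proof cases
      case 2
      define l where "l = (m - q) / (w - q)"
      have l: "0 \<le> l" "l \<le> 1" using 2 m by (auto simp: l_def)
      have "m = (1 - l) * q + l * w" using 2 m convex_coeff(1)[OF _ l_def] by simp
      then have "g m \<le> (1 - l) * g q + l * g w" using three[of q w l m] q l assms(2,3) fin by auto
      then have "(w - q) * g m \<le> (w - q) * ((1 - l) * g q + l * g w)" using 2 m by (intro mult_left_mono) auto
      also have "\<dots> = (w - m) * g q + (m - q) * g w" using 2 m by (intro convex_coeff(2)[OF _ l_def]) simp
      finally have "0 \<le> (w - m) * (g q - g m - a * (q - m))" unfolding aw by (simp add: algebra_simps)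
      then show ?thesis using m by (simp add: zero_le_mult_iff)
    next
      case 3
      define l where "l = (m - v) / (q - v)"
      have l: "0 \<le> l" "l \<le> 1" using 3 m by (auto simp: l_def)
      have "m = (1 - l) * v + l * q" using 3 m convex_coeff(1)[OF _ l_def] by simp
      then have "g m \<le> (1 - l) * g v + l * g q" using three[of v q l m] q l assms(2,3) le[of v] fin by (auto intro: le_less_trans)
      then have "(q - v) * g m \<le> (q - v) * ((1 - l) * g v + l * g q)" using 3 m by (intro mult_left_mono) auto
      also have "\<dots> = (q - m) * g v + (m - v) * g q" using 3 m by (intro convex_coeff(2)[OF _ l_def]) simp
      finally have "0 \<le> (m - v) * (g q - g m - a * (q - m))" unfolding av by (simp add: algebra_simps)
      then show ?thesis using m by (simp add: zero_le_mult_iff)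
    qed simp
  qed
  have nn: "0 \<le> a * m - g m" using sub[of 0] by (simp add: g_def)
  have "\<phi> (ennreal a) \<le> ennreal (a * m - g m)"
    unfolding young_biconjugate[OF assms(1) a0]
  proof (rule SUP_least)
    fix i
    show "ennreal (a * qseq i) - conjugate \<phi> (ennreal (qseq i)) \<le> ennreal (a * m - g m)"
    proof (cases "conjugate \<phi> (ennreal (qseq i)) = top")
      case False
      then have fin': "conjugate \<phi> (ennreal (qseq i)) < top" by (simp add: less_top)
      then have "a * qseq i \<le> g (qseq i) + (a * m - g m)" using sub[of "qseq i"] by (simp add: algebra_simps)
      then have "ennreal (a * qseq i) \<le> ennreal (g (qseq i)) + ennreal (a * m - g m)"
        using gnn nn by (metis ennreal_leI ennreal_plus)
      then show ?thesis using fin' by (simp add: ennreal_minus_le_iff g_def ennreal_enn2real)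
    qed simp
  qed
  moreover have "ennreal (a * m - g m) \<le> \<phi> (ennreal a)"
  proof -
    have "ennreal (a * m) \<le> \<phi> (ennreal a) + ennreal (g m)"
      using young_inequality[OF assms(1), of "ennreal a" "ennreal m"] a0 m gm by (simp add: ennreal_mult)
    then have "ennreal (a * m) - ennreal (g m) \<le> \<phi> (ennreal a)" by (simp add: ennreal_minus_le_iff add.commute)
    then show ?thesis using gnn by (simp add: ennreal_minus)
  qed
  ultimately have \<phi>a: "\<phi> (ennreal a) = ennreal (a * m - g m)" by simp
  show "ennreal (a * v) = \<phi> (ennreal a) + conjugate \<phi> (ennreal v)"
    unfolding \<phi>a gv using nn gnn av by (simp add: ennreal_plus[symmetric] algebra_simps del: ennreal_plus)
  show "ennreal (a * w) = \<phi> (ennreal a) + conjugate \<phi> (ennreal w)"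
    unfolding \<phi>a gw using nn gnn aw by (simp add: ennreal_plus[symmetric] algebra_simps del: ennreal_plus)
qed

subsection \<open>Finite functions\<close>

definition rf :: "(ennreal \<Rightarrow> ennreal) \<Rightarrow> real \<Rightarrow> real" where
  "rf \<phi> u = enn2real (\<phi> (ennreal u))"

text \<open>For convex functions the quotients decrease with the increment, so the infimum is the right
  derivative.\<close>

definition rd :: "(ennreal \<Rightarrow> ennreal) \<Rightarrow> real \<Rightarrow> real" where
  "rd \<phi> u = (INF n::nat. (rf \<phi> (u + 1 / (n + 1)) - rf \<phi> u) * (n + 1))"

locale finite_young =
  fixes \<phi> :: "ennreal \<Rightarrow> ennreal"
  assumes young: "young \<phi>" and finite: "\<And>u. u < top \<Longrightarrow> \<phi> u < top"
begin

lemma eq_rf: "\<phi> (ennreal u) = ennreal (rf \<phi> u)"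
  using finite[of "ennreal u"] by (simp add: rf_def ennreal_enn2real)

lemma rf_nonneg [simp]: "0 \<le> rf \<phi> u"
  by (simp add: rf_def)

lemma rf_zero [simp]: "rf \<phi> 0 = 0"
  using young by (simp add: rf_def)

lemma rf_mono: "u \<le> v \<Longrightarrow> rf \<phi> u \<le> rf \<phi> v"
  unfolding rf_def by (rule enn2real_mono[OF young_mono[OF young ennreal_leI] finite]) auto

lemma rf_three:
  assumes "0 \<le> a" "a < b" "b < c"
  shows "(c - a) * rf \<phi> b \<le> (c - b) * rf \<phi> a + (b - a) * rf \<phi> c"
proof -
  define l where "l = (b - a) / (c - a)"
  have l: "0 \<le> l" "l \<le> 1" using assms by (auto simp: l_def)
  have b: "(1 - l) * a + l * c = b" using assms convex_coeff(1)[OF _ l_def] by simp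
  have "ennreal (rf \<phi> b) \<le> ennreal ((1 - l) * rf \<phi> a + l * rf \<phi> c)"
    using young_convex[OF young assms(1) _ l, of c] assms b l
    by (simp add: eq_rf ennreal_mult)
  then have "rf \<phi> b \<le> (1 - l) * rf \<phi> a + l * rf \<phi> c"
    using l by (subst (asm) ennreal_le_iff) auto
  then have "(c - a) * rf \<phi> b \<le> (c - a) * ((1 - l) * rf \<phi> a + l * rf \<phi> c)"
    using assms by (intro mult_left_mono) auto
  also have "\<dots> = (c - b) * rf \<phi> a + (b - a) * rf \<phi> c"
    using assms by (intro convex_coeff(2)[OF _ l_def]) simp
  finally show ?thesis .
qed

lemma rd_le_quotient: "rd \<phi> u \<le> (rf \<phi> (u + 1 / (real n + 1)) - rf \<phi> u) * (real n + 1)"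
  unfolding rd_def
  by (rule cINF_lower[OF bdd_belowI2[of _ 0]]) (auto intro!: rf_mono mult_nonneg_nonneg)

lemma rd_nonneg [simp]: "0 \<le> rd \<phi> u"
  unfolding rd_def by (rule cINF_greatest) (auto intro!: rf_mono mult_nonneg_nonneg)

text \<open>\<open>rd \<phi> u\<close> is a subgradient: chord slopes ending at \<open>u\<close>
  bound every right quotient from below, and some right quotient has a step shorter than
  \<open>s - u\<close>.\<close>

lemma rf_ge_tangent:
  assumes "0 \<le> u" "0 \<le> s"
  shows "rf \<phi> u + rd \<phi> u * (s - u) \<le> rf \<phi> s"
proof -
  consider "s = u" | "s < u" | "u < s" by linarith
  then show ?thesis
  proof cases
    case 2
    have "(rf \<phi> u - rf \<phi> s) / (u - s) \<le> rd \<phi> u"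
      unfolding rd_def
    proof (rule cINF_greatest)
      fix n :: nat
      define d where "d = 1 / (real n + 1)"
      have d: "0 < d" "real n + 1 = 1 / d" by (auto simp: d_def)
      have "(u + d - s) * rf \<phi> u \<le> (u + d - u) * rf \<phi> s + (u - s) * rf \<phi> (u + d)"
        using rf_three[of s u "u + d"] 2 d assms by auto
      then show "(rf \<phi> u - rf \<phi> s) / (u - s) \<le> (rf \<phi> (u + 1 / (real n + 1)) - rf \<phi> u) * (real n + 1)"
        unfolding d_def[symmetric] d(2) using 2 d(1) by (simp add: field_simps)
    qed simp
    then show ?thesis using 2 by (simp add: field_simps)
  next
    case 3
    then obtain n where n: "1 / (real n + 1) < s - u"
      using reals_Archimedean[of "s - u"] by (auto simp: inverse_eq_divide add.commute)
    define d where "d = 1 / (real n + 1)"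
    have d: "0 < d" "real n + 1 = 1 / d" by (auto simp: d_def)
    have "rd \<phi> u \<le> (rf \<phi> (u + d) - rf \<phi> u) / d"
      using rd_le_quotient[of u n] unfolding d_def[symmetric] d(2) by simp
    moreover have "(s - u) * rf \<phi> (u + d) \<le> (s - (u + d)) * rf \<phi> u + (u + d - u) * rf \<phi> s"
      using n d(1) assms(1) unfolding d_def[symmetric] by (intro rf_three) auto
    then have "(rf \<phi> (u + d) - rf \<phi> u) / d \<le> (rf \<phi> s - rf \<phi> u) / (s - u)"
      using 3 d(1) by (simp add: field_simps)
    ultimately have "rd \<phi> u \<le> (rf \<phi> s - rf \<phi> u) / (s - u)" by simp
    then show ?thesis using 3 by (simp add: field_simps)
  qed simp
qed

lemma rd_mono:
  assumes "0 \<le> u" "u \<le> s" shows "rd \<phi> u \<le> rd \<phi> s"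
proof (cases "u = s")
  case False
  have "rd \<phi> u * (s - u) \<le> rd \<phi> s * (s - u)"
    using rf_ge_tangent[of u s] rf_ge_tangent[of s u] assms by (simp add: algebra_simps)
  then show ?thesis using False assms by simp
qed simp

lemma rf_le_rd: "0 \<le> u \<Longrightarrow> rf \<phi> u \<le> u * rd \<phi> u"
  using rf_ge_tangent[of u 0] by (simp add: algebra_simps)

text \<open>Trading a derivative for a value at the doubled argument is how the doubling condition
  later supplies integrable majorants for expressions in \<open>rd\<close>.\<close>

lemma rd_le_rf: "0 \<le> u \<Longrightarrow> u * rd \<phi> u \<le> rf \<phi> (2 * u)"
proof -
  assume "0 \<le> u"
  then have "rf \<phi> u + rd \<phi> u * u \<le> rf \<phi> (2 * u)" using rf_ge_tangent[of u "2 * u"] by simp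
  then show ?thesis using rf_nonneg[of u] by (simp add: mult.commute del: rf_nonneg)
qed

text \<open>The quantity compared is the conjugate at \<open>rd \<phi> u\<close>, by equality in
  Young's inequality at a subgradient.\<close>

lemma conjugate_slope_mono:
  assumes "0 \<le> u" "u \<le> s"
  shows "u * rd \<phi> u - rf \<phi> u \<le> s * rd \<phi> s - rf \<phi> s"
proof -
  have "u * (rd \<phi> s - rd \<phi> u) \<ge> 0" using rd_mono[OF assms] assms by simp
  then show ?thesis using rf_ge_tangent[of s u] assms by (simp add: algebra_simps)
qed

lemma conjugate_tangent:
  assumes "0 \<le> u" "0 \<le> r" "\<And>s. 0 \<le> s \<Longrightarrow> rf \<phi> u + r * (s - u) \<le> rf \<phi> s"
  shows "conjugate \<phi> (ennreal r) = ennreal (u * r - rf \<phi> u)"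
proof (rule antisym)
  have nn: "0 \<le> u * r - rf \<phi> u" using assms(3)[of 0] by (simp add: algebra_simps)
  show "conjugate \<phi> (ennreal r) \<le> ennreal (u * r - rf \<phi> u)"
  proof (rule conjugate_le)
    fix s :: real assume s: "0 < s"
    have "ennreal (s * r) \<le> ennreal (rf \<phi> s + (u * r - rf \<phi> u))"
      using assms(3)[of s] s by (intro ennreal_leI) (simp add: algebra_simps)
    then show "ennreal s * ennreal r \<le> \<phi> (ennreal s) + ennreal (u * r - rf \<phi> u)"
      using s nn assms(2) by (simp add: eq_rf ennreal_mult)
  qed simp
  have "ennreal (u * r) \<le> ennreal (rf \<phi> u) + conjugate \<phi> (ennreal r)"
    using young_inequality[OF young, of "ennreal u" "ennreal r"] assms by (simp add: eq_rf ennreal_mult)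
  then have "ennreal (u * r) - ennreal (rf \<phi> u) \<le> conjugate \<phi> (ennreal r)"
    by (simp add: ennreal_minus_le_iff)
  then show "ennreal (u * r - rf \<phi> u) \<le> conjugate \<phi> (ennreal r)"
    by (simp add: ennreal_minus)
qed

lemma conjugate_rd:
  assumes "0 \<le> u"
  shows "conjugate \<phi> (ennreal (rd \<phi> u)) = ennreal (u * rd \<phi> u - rf \<phi> u)"
  using conjugate_tangent[OF assms rd_nonneg] rf_ge_tangent[OF assms] by blast

text \<open>If the values were bounded by \<open>N\<close>, the derivatives would be bounded; their
  supremum \<open>\<beta>\<close> would lie at or beyond the endpoint of the conjugate, and the
  conjugate at \<open>\<beta>\<close> would be at most \<open>N\<close>.\<close>

lemma conjugate_slope_unbounded:
  assumes inf: "conjugate \<phi> (Sup {v. conjugate \<phi> v < top}) = top"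
  obtains u where "0 \<le> u" "N < u * rd \<phi> u - rf \<phi> u"
proof (rule ccontr)
  note witness = that
  assume no: "\<not> thesis"
  have N: "u * rd \<phi> u - rf \<phi> u \<le> N" if "0 \<le> u" for u
    using no witness[OF that] by (meson not_le)
  have "0 \<le> N" using N[of 0] by simp
  have bd: "rd \<phi> u \<le> N + rf \<phi> 1" if "0 \<le> u" for u
    using rf_ge_tangent[of u 1] N[OF that] that by (simp add: algebra_simps)
  define \<beta> where "\<beta> = (SUP u\<in>{0..}. rd \<phi> u)"
  have bdd: "bdd_above (rd \<phi> ` {0..})" using bd by (auto intro!: bdd_aboveI2)
  have le\<beta>: "rd \<phi> u \<le> \<beta>" if "0 \<le> u" for u unfolding \<beta>_def using bdd that by (intro cSUP_upper) auto
  have \<beta>0: "0 \<le> \<beta>" using le\<beta>[of 0] rd_nonneg[of 0] by linarith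
  have le: "conjugate \<phi> (ennreal \<beta>) \<le> ennreal N"
  proof (rule conjugate_le)
    fix s :: real assume s: "0 < s"
    have "\<beta> \<le> (rf \<phi> s + N) / s" unfolding \<beta>_def
    proof (rule cSUP_least)
      fix u :: real assume u: "u \<in> {0..}"
      have "s * rd \<phi> u \<le> rf \<phi> s + N" using rf_ge_tangent[of u s] N[of u] u s by (simp add: algebra_simps)
      then show "rd \<phi> u \<le> (rf \<phi> s + N) / s" using s by (simp add: field_simps)
    qed simp
    then have "s * \<beta> \<le> rf \<phi> s + N" using s by (simp add: field_simps)
    then have "ennreal (s * \<beta>) \<le> ennreal (rf \<phi> s + N)" by (rule ennreal_leI)
    then show "ennreal s * ennreal \<beta> \<le> \<phi> (ennreal s) + ennreal N"
      using s \<beta>0 \<open>0 \<le> N\<close> by (simp add: eq_rf ennreal_mult)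
  qed simp
  have "Sup {v. conjugate \<phi> v < top} \<le> ennreal \<beta>"
  proof (rule Sup_least, rule ccontr)
    fix v assume v: "v \<in> {v. conjugate \<phi> v < top}" and "\<not> v \<le> ennreal \<beta>"
    then obtain i where "ennreal \<beta> < ennreal (qseq i)" "ennreal (qseq i) < v"
      using qseq_dense_ennreal by (metis not_le)
    then have q: "\<beta> < qseq i" and fin: "conjugate \<phi> (ennreal (qseq i)) < top"
      using v \<beta>0 conjugate_mono[of "ennreal (qseq i)" v \<phi>] le_less_trans by (fastforce simp: ennreal_less_iff)+
    obtain C where C: "conjugate \<phi> (ennreal (qseq i)) = ennreal C" "0 \<le> C"
      using fin by (metis ennreal_cases infinity_ennreal_def less_irrefl)
    \<comment> \<open>Finiteness at a slope \<open>qseq i > \<beta>\<close> would give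
      \<open>u * (qseq i - \<beta>) \<le> C\<close> for all \<open>u\<close>; this \<open>u\<close>
      makes the left side \<open>C + 1\<close>.\<close>
    define u where "u = (C + 1) / (qseq i - \<beta>)"
    have u: "0 < u" using C q by (simp add: u_def)
    have "ennreal (u * qseq i) \<le> ennreal (rf \<phi> u + C)"
      using young_inequality[OF young, of "ennreal u" "ennreal (qseq i)"] u C by (simp add: eq_rf ennreal_mult)
    then have "u * qseq i \<le> rf \<phi> u + C" using C by (subst (asm) ennreal_le_iff) auto
    also have "\<dots> \<le> u * rd \<phi> u + C" using rf_le_rd[of u] u by simp
    also have "\<dots> \<le> u * \<beta> + C" using le\<beta>[of u] u by simp
    finally have "u * (qseq i - \<beta>) \<le> C" by (simp add: algebra_simps)
    moreover have "u * (qseq i - \<beta>) = C + 1" using q by (simp add: u_def)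
    ultimately show False by simp
  qed
  then have "conjugate \<phi> (Sup {v. conjugate \<phi> v < top}) \<le> ennreal N"
    using le conjugate_mono order_trans by blast
  then show False using inf by (simp add: top_unique)
qed

lemma rd_eq_derivative:
  assumes "0 \<le> u" "(rf \<phi> has_real_derivative d) (at u within {0..})"
  shows "rd \<phi> u = d"
proof -
  have lim: "((\<lambda>y. (rf \<phi> y - rf \<phi> u) / (y - u)) \<longlongrightarrow> d) (at u within {0..})"
    using assms(2) by (simp add: has_field_derivative_iff)
  have "filterlim (\<lambda>n. u + 1 / (real n + 1)) (at u within {0..}) sequentially"
    unfolding filterlim_at
  proof
    have "(\<lambda>n. u + 1 / (real n + 1)) \<longlonglongrightarrow> u + 0"
      by (intro tendsto_intros) (use LIMSEQ_inverse_real_of_nat in \<open>simp add: inverse_eq_divide add.commute\<close>)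
    then show "(\<lambda>n. u + 1 / (real n + 1)) \<longlonglongrightarrow> u" by simp
  qed (use assms(1) in \<open>auto intro!: always_eventually\<close>)
  from filterlim_compose[OF lim this]
  have "(\<lambda>n. (rf \<phi> (u + 1 / (real n + 1)) - rf \<phi> u) * (real n + 1)) \<longlonglongrightarrow> d"
    by simp
  moreover have "rd \<phi> u \<le> (rf \<phi> (u + 1 / (real n + 1)) - rf \<phi> u) * (real n + 1)" for n
    by (rule rd_le_quotient)
  ultimately have 1: "rd \<phi> u \<le> d" by (meson LIMSEQ_le_const)
  have "d \<le> (rf \<phi> (u + 1 / (real n + 1)) - rf \<phi> u) * (real n + 1)" for n
  proof -
    define e where "e = 1 / (real n + 1)"
    have e: "0 < e" "real n + 1 = 1 / e" by (auto simp: e_def)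
    have "d \<le> (rf \<phi> (u + e) - rf \<phi> u) / e"
    proof (rule LIMSEQ_le_const2[OF \<open>(\<lambda>n. (rf \<phi> (u + 1 / (real n + 1)) - rf \<phi> u) * (real n + 1)) \<longlonglongrightarrow> d\<close>], intro exI allI impI)
      fix k assume k: "n + 1 \<le> k"
      define h where "h = 1 / (real k + 1)"
      have h: "0 < h" "real k + 1 = 1 / h" by (auto simp: h_def)
      have "h < e" using k by (simp add: h_def e_def frac_less2)
      then have "(u + e - u) * rf \<phi> (u + h) \<le> (u + e - (u + h)) * rf \<phi> u + (u + h - u) * rf \<phi> (u + e)"
        using rf_three[of u "u + h" "u + e"] h assms by auto
      then show "(rf \<phi> (u + 1 / (real k + 1)) - rf \<phi> u) * (real k + 1) \<le> (rf \<phi> (u + e) - rf \<phi> u) / e"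
        unfolding h_def[symmetric] h(2) using e(1) h(1) by (simp add: field_simps)
    qed
    then show ?thesis unfolding e_def[symmetric] e(2) by simp
  qed
  then have "d \<le> rd \<phi> u" unfolding rd_def by (intro cINF_greatest) auto
  with 1 show ?thesis by simp
qed

text \<open>If \<open>r\<close> bounds the left slopes at \<open>u\<close> and
  \<open>r < rd \<phi> u\<close>, every slope in between is a subgradient at \<open>u\<close>. There
  the conjugate is the affine function \<open>\<tau> \<mapsto> u \<tau> - rf \<phi> u\<close>, which
  two rationals detect through their midpoint.\<close>

lemma no_kink:
  assumes aff: "\<And>i j. qseq i < qseq j \<Longrightarrow> conjugate \<phi> (ennreal (qseq j)) < top \<Longrightarrow>
      conjugate \<phi> (ennreal (qseq i)) + conjugate \<phi> (ennreal (qseq j)) \<noteq> 2 * conjugate \<phi> (ennreal ((qseq i + qseq j) / 2))"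
    and u: "0 \<le> u" and r: "0 \<le> r" "\<And>s. 0 \<le> s \<Longrightarrow> s < u \<Longrightarrow> rf \<phi> u - rf \<phi> s \<le> r * (u - s)"
  shows "rd \<phi> u \<le> r"
proof (rule ccontr)
  assume "\<not> ?thesis"
  then obtain i where i: "r < qseq i" "qseq i < rd \<phi> u" using qseq_dense r(1) by (metis not_le)
  then obtain j where j: "qseq i < qseq j" "qseq j < rd \<phi> u" using qseq_dense[of "qseq i"] by auto
  have tan: "conjugate \<phi> (ennreal \<tau>) = ennreal (u * \<tau> - rf \<phi> u)" "rf \<phi> u \<le> u * \<tau>" if \<tau>: "r \<le> \<tau>" "\<tau> \<le> rd \<phi> u" for \<tau>
  proof -
    have *: "rf \<phi> u + \<tau> * (s - u) \<le> rf \<phi> s" if s: "0 \<le> s" for s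
    proof (cases "s < u")
      case True
      have "r * (u - s) \<le> \<tau> * (u - s)" using \<tau> True by (intro mult_right_mono) auto
      then show ?thesis using r(2)[OF s True] by (simp add: algebra_simps)
    next
      case False
      have "\<tau> * (s - u) \<le> rd \<phi> u * (s - u)" using \<tau> False by (intro mult_right_mono) auto
      then show ?thesis using rf_ge_tangent[OF u s] by (simp add: algebra_simps)
    qed
    show "conjugate \<phi> (ennreal \<tau>) = ennreal (u * \<tau> - rf \<phi> u)"
      using \<tau> r(1) u * by (intro conjugate_tangent) auto
    show "rf \<phi> u \<le> u * \<tau>" using *[of 0] by (simp add: algebra_simps)
  qed
  have "conjugate \<phi> (ennreal (qseq i)) + conjugate \<phi> (ennreal (qseq j))
      = ennreal ((u * qseq i - rf \<phi> u) + (u * qseq j - rf \<phi> u))"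
    using i j tan[of "qseq i"] tan[of "qseq j"] by (simp add: ennreal_plus[symmetric] del: ennreal_plus)
  also have "(u * qseq i - rf \<phi> u) + (u * qseq j - rf \<phi> u) = 2 * (u * ((qseq i + qseq j) / 2) - rf \<phi> u)"
    by (simp add: field_simps)
  also have "ennreal (2 * (u * ((qseq i + qseq j) / 2) - rf \<phi> u)) = 2 * conjugate \<phi> (ennreal ((qseq i + qseq j) / 2))"
    using i j tan[of "(qseq i + qseq j) / 2"] ennreal_mult[of 2 "u * ((qseq i + qseq j) / 2) - rf \<phi> u"] by simp
  finally show False using aff[of i j] i j tan[of "qseq j"] by simp
qed

text \<open>Without kinks the left chord slopes come arbitrarily close to
  \<open>rd \<phi> u\<close>, so the one-sided derivatives agree. Chords then also give continuity
  of the derivative.\<close>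

lemma no_kink_imp_smooth:
  assumes aff: "\<And>i j. qseq i < qseq j \<Longrightarrow> conjugate \<phi> (ennreal (qseq j)) < top \<Longrightarrow>
      conjugate \<phi> (ennreal (qseq i)) + conjugate \<phi> (ennreal (qseq j)) \<noteq> 2 * conjugate \<phi> (ennreal ((qseq i + qseq j) / 2))"
  shows "continuously_differentiable \<phi>" "has_right_derivative \<phi> 0 0"
proof -
  have left: "\<exists>s\<ge>0. s < u \<and> rd \<phi> u - e < (rf \<phi> u - rf \<phi> s) / (u - s)" if "0 < u" "0 < e" for u e
  proof (rule ccontr)
    assume "\<not> ?thesis"
    then have *: "(rf \<phi> u - rf \<phi> s) / (u - s) \<le> rd \<phi> u - e" if "0 \<le> s" "s < u" for s
      using that by (auto simp: not_less)
    have "0 \<le> (rf \<phi> u - rf \<phi> 0) / (u - 0)" using that(1) by simp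
    then have "0 \<le> rd \<phi> u - e" using *[of 0] that(1) by linarith
    then have "rd \<phi> u \<le> rd \<phi> u - e"
      using * that by (intro no_kink[OF aff]) (auto simp: field_simps)
    then show False using that by simp
  qed
  have right: "\<exists>s>u. (rf \<phi> s - rf \<phi> u) / (s - u) < rd \<phi> u + e" if "0 < e" for u e
  proof -
    have "(INF n::nat. (rf \<phi> (u + 1 / (n + 1)) - rf \<phi> u) * (n + 1)) < rd \<phi> u + e"
      using that unfolding rd_def by simp
    then obtain n :: nat where "(rf \<phi> (u + 1 / (n + 1)) - rf \<phi> u) * (n + 1) < rd \<phi> u + e"
      by (subst (asm) cINF_less_iff) (auto intro!: bdd_belowI2[of _ 0] rf_mono mult_nonneg_nonneg simp: add.commute)
    then show ?thesis by (intro exI[of _ "u + 1 / (n + 1)"]) auto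
  qed
  have rd0: "rd \<phi> 0 = 0"
  proof -
    \<comment> \<open>At \<open>u = 0\<close> there are no left slopes, so the hypothesis of
      \<open>no_kink\<close> on them is vacuous and \<open>r = 0\<close> is admissible.\<close>
    have "rd \<phi> 0 \<le> 0" by (rule no_kink[OF aff]) auto
    then show ?thesis using rd_nonneg[of 0] by linarith
  qed
  have der: "(rf \<phi> has_real_derivative rd \<phi> u) (at u within {0..})" if u: "0 \<le> u" for u
    unfolding has_field_derivative_iff tendsto_iff eventually_at_le dist_real_def
  proof (intro allI impI)
    fix e :: real assume e: "0 < e"
    obtain b where b: "u < b" "(rf \<phi> b - rf \<phi> u) / (b - u) < rd \<phi> u + e" using right[OF e] by blast
    obtain a where a: "a < u" "u = 0 \<or> 0 \<le> a \<and> rd \<phi> u - e < (rf \<phi> u - rf \<phi> a) / (u - a)"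
    proof (cases "u = 0")
      case True then show ?thesis using that[of "-1"] by simp
    next
      case False then show ?thesis using left[of u e] u e that by fastforce
    qed
    \<comment> \<open>The neighbourhood is closed, so half the distance to the nearer of
      \<open>a\<close> and \<open>b\<close> keeps \<open>x\<close> strictly between them. At
      \<open>u = 0\<close> the point \<open>a = -1\<close> only fills the formula.\<close>
    show "\<exists>d>0. \<forall>x\<in>{0..}. x \<noteq> u \<and> \<bar>x - u\<bar> \<le> d \<longrightarrow> \<bar>(rf \<phi> x - rf \<phi> u) / (x - u) - rd \<phi> u\<bar> < e"
    proof (intro exI[of _ "min (b - u) (u - a) / 2"] conjI ballI impI)
      show "0 < min (b - u) (u - a) / 2" using a b by simp
      fix x :: real assume x: "x \<in> {0..}" "x \<noteq> u \<and> \<bar>x - u\<bar> \<le> min (b - u) (u - a) / 2"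
      then have xab: "a < x" "x < b" using a b by (auto simp: abs_if min_def split: if_splits)
      show "\<bar>(rf \<phi> x - rf \<phi> u) / (x - u) - rd \<phi> u\<bar> < e"
      proof (cases "u < x")
        case True
        have "(b - u) * rf \<phi> x \<le> (b - x) * rf \<phi> u + (x - u) * rf \<phi> b" using rf_three[OF u True xab(2)] .
        then have "(rf \<phi> x - rf \<phi> u) / (x - u) \<le> (rf \<phi> b - rf \<phi> u) / (b - u)"
          using True b(1) by (simp add: field_simps)
        moreover have "rd \<phi> u \<le> (rf \<phi> x - rf \<phi> u) / (x - u)"
          using rf_ge_tangent[of u x] True u by (simp add: field_simps)
        ultimately show ?thesis using b(2) by simp
      next
        case False
        then have xu: "x < u" using x by auto
        then have a': "0 \<le> a" "rd \<phi> u - e < (rf \<phi> u - rf \<phi> a) / (u - a)" using a x by auto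
        have "(u - a) * rf \<phi> x \<le> (u - x) * rf \<phi> a + (x - a) * rf \<phi> u" using rf_three[OF a'(1) xab(1) xu] .
        then have "(rf \<phi> u - rf \<phi> a) / (u - a) \<le> (rf \<phi> u - rf \<phi> x) / (u - x)"
          using xu a(1) by (simp add: field_simps)
        moreover have "(rf \<phi> u - rf \<phi> x) / (u - x) \<le> rd \<phi> u"
          using rf_ge_tangent[of u x] xu u x by (simp add: field_simps)
        moreover have "(rf \<phi> x - rf \<phi> u) / (x - u) = (rf \<phi> u - rf \<phi> x) / (u - x)"
          by (metis minus_diff_eq minus_divide_divide)
        ultimately show ?thesis using a'(2) e by simp
      qed
    qed
  qed
  have contf: "continuous_on {0..} (rf \<phi>)"
    using der by (intro DERIV_continuous_on) auto
  \<comment> \<open>A chord slope with one fixed endpoint varies continuously with the other. Chords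
    to a fixed \<open>s\<close> on the left bound \<open>rd \<phi> x\<close> from below, those to a
    fixed \<open>s\<close> on the right bound it from above.\<close>
  have contd: "continuous_on {0..} (rd \<phi>)"
    unfolding continuous_on_eq_continuous_within continuous_within
  proof (intro ballI order_tendstoI)
    fix u y :: real assume u: "u \<in> {0..}" and y: "y < rd \<phi> u"
    have lim: "(rf \<phi> \<longlongrightarrow> rf \<phi> u) (at u within {0..})" using contf u by (auto simp: continuous_on)
    show "eventually (\<lambda>x. y < rd \<phi> x) (at u within {0..})"
    proof (cases "u = 0")
      case True
      then show ?thesis using y rd0 by (auto intro!: always_eventually intro: less_le_trans)
    next
      case False
      then obtain s where s: "0 \<le> s" "s < u" "y < (rf \<phi> u - rf \<phi> s) / (u - s)"
        using left[of u "rd \<phi> u - y"] u y by auto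
      have "((\<lambda>x. (rf \<phi> x - rf \<phi> s) / (x - s)) \<longlongrightarrow> (rf \<phi> u - rf \<phi> s) / (u - s)) (at u within {0..})"
        using s by (intro tendsto_intros lim) auto
      then have "eventually (\<lambda>x. y < (rf \<phi> x - rf \<phi> s) / (x - s)) (at u within {0..})"
        using s(3) by (rule order_tendstoD)
      moreover have "eventually (\<lambda>x. s < x) (at u within {0..})"
        using s(2) by (intro order_tendstoD(1)[OF tendsto_ident_at])
      ultimately show ?thesis
      proof eventually_elim
        case (elim x)
        then have "(rf \<phi> x - rf \<phi> s) / (x - s) \<le> rd \<phi> x"
          using rf_ge_tangent[of x s] s by (simp add: field_simps)
        then show ?case using elim by simp
      qed
    qed
  next
    fix u y :: real assume u: "u \<in> {0..}" and y: "rd \<phi> u < y"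
    have lim: "(rf \<phi> \<longlongrightarrow> rf \<phi> u) (at u within {0..})" using contf u by (auto simp: continuous_on)
    obtain s where s: "u < s" "(rf \<phi> s - rf \<phi> u) / (s - u) < y"
      using right[of "y - rd \<phi> u" u] y by auto
    have "((\<lambda>x. (rf \<phi> s - rf \<phi> x) / (s - x)) \<longlongrightarrow> (rf \<phi> s - rf \<phi> u) / (s - u)) (at u within {0..})"
      using s by (intro tendsto_intros lim) auto
    then have "eventually (\<lambda>x. (rf \<phi> s - rf \<phi> x) / (s - x) < y) (at u within {0..})"
      using s(2) by (rule order_tendstoD)
    moreover have "eventually (\<lambda>x. x < s) (at u within {0..})"
      using s(1) by (intro order_tendstoD(2)[OF tendsto_ident_at])
    moreover have "eventually (\<lambda>x. x \<in> {0..}) (at u within {0..})" by (simp add: eventually_at_filter)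
    ultimately show "eventually (\<lambda>x. rd \<phi> x < y) (at u within {0..})"
    proof eventually_elim
      case (elim x)
      then have "rd \<phi> x \<le> (rf \<phi> s - rf \<phi> x) / (s - x)"
        using rf_ge_tangent[of x s] s u by (simp add: field_simps)
      then show ?case using elim by simp
    qed
  qed
  show "continuously_differentiable \<phi>"
    unfolding continuously_differentiable_def
    using finite contd der by (auto simp: rf_def[symmetric] intro!: exI[of _ "rd \<phi>"])
  show "has_right_derivative \<phi> 0 0"
    unfolding has_right_derivative_def rf_def[symmetric]
    using DERIV_subset[OF der[of 0], of "{0<..}"] rd0 by (simp add: subset_eq)
qed

end

lemma rd_continuous:
  assumes "young \<phi>" "continuously_differentiable \<phi>" "has_right_derivative \<phi> 0 0"
  shows "finite_young \<phi>" "continuous_on {0..} (rf \<phi>)" "continuous_on {0..} (rd \<phi>)" "rd \<phi> 0 = 0"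
proof -
  show fy: "finite_young \<phi>"
    using assms by unfold_locales (auto simp: continuously_differentiable_def)
  interpret finite_young \<phi> by fact
  obtain D where D: "continuous_on {0..} D" "\<And>x. 0 \<le> x \<Longrightarrow> (rf \<phi> has_real_derivative D x) (at x within {0..})"
    using assms(2) unfolding continuously_differentiable_def rf_def[symmetric] by (auto simp: rf_def[abs_def])
  show "continuous_on {0..} (rf \<phi>)" using D(2) by (intro DERIV_continuous_on) auto
  have eq: "rd \<phi> x = D x" if "0 \<le> x" for x using rd_eq_derivative[OF that D(2)[OF that]] .
  show "continuous_on {0..} (rd \<phi>)"
    using D(1) by (rule continuous_on_cong[THEN iffD1, rotated -1]) (auto simp: eq)
  have "(rf \<phi> has_real_derivative D 0) (at_right 0)"
    by (rule DERIV_subset[OF D(2)]) auto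
  moreover have "(rf \<phi> has_real_derivative 0) (at_right 0)"
    using assms(3) by (simp add: has_right_derivative_def rf_def[abs_def])
  ultimately have "D 0 = 0" unfolding has_field_derivative_iff
    by (rule tendsto_unique[rotated]) simp
  then show "rd \<phi> 0 = 0" using eq[of 0] by simp
qed

subsection \<open>Non-atomic measures\<close>

text \<open>A proper part of positive measure or its complement has at most half the measure;
  iterating the halving beats any \<open>e\<close>.\<close>

lemma non_atomic_small_subset:
  assumes na: "non_atomic M" and A: "A \<in> sets M" "0 < emeasure M A" "emeasure M A < top" and "0 < e"
  obtains B where "B \<in> sets M" "B \<subseteq> A" "0 < emeasure M B" "emeasure M B < e"
proof -
  have half: "\<exists>C\<in>sets M. C \<subseteq> B \<and> 0 < emeasure M C \<and> 2 * emeasure M C \<le> emeasure M B"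
    if B: "B \<in> sets M" "B \<subseteq> A" "0 < emeasure M B" for B
  proof -
    obtain C where C: "C \<in> sets M" "C \<subseteq> B" "0 < emeasure M C" "emeasure M C < emeasure M B"
      using na B unfolding non_atomic_def by blast
    have fin: "emeasure M B < top" using emeasure_mono[OF B(2) A(1)] A(3) by (rule le_less_trans)
    have sum: "emeasure M C + emeasure M (B - C) = emeasure M B"
      using C B by (subst plus_emeasure) (auto intro!: arg_cong[where f = "emeasure M"])
    show ?thesis
    proof (cases "emeasure M C \<le> emeasure M (B - C)")
      case True
      then have "2 * emeasure M C \<le> emeasure M B" unfolding sum[symmetric] by (simp add: mult_2 add_left_mono)
      then show ?thesis using C by blast
    next
      case False
      then have "2 * emeasure M (B - C) \<le> emeasure M B" unfolding sum[symmetric] by (simp add: mult_2 add_right_mono)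
      moreover have "emeasure M (B - C) \<noteq> 0" using sum C(4) by auto
      ultimately show ?thesis using C B by (intro bexI[of _ "B - C"]) (auto simp: zero_less_iff_neq_zero)
    qed
  qed
  have ex: "\<exists>C\<in>sets M. C \<subseteq> A \<and> 0 < emeasure M C \<and> 2 ^ n * emeasure M C \<le> emeasure M A" for n :: nat
  proof (induction n)
    case 0
    then show ?case using A by (intro bexI[of _ A]) auto
  next
    case (Suc n)
    then obtain B where B: "B \<in> sets M" "B \<subseteq> A" "0 < emeasure M B" "2 ^ n * emeasure M B \<le> emeasure M A" by blast
    obtain C where C: "C \<in> sets M" "C \<subseteq> B" "0 < emeasure M C" "2 * emeasure M C \<le> emeasure M B" using half B by blast
    have "2 ^ Suc n * emeasure M C = 2 ^ n * (2 * emeasure M C)" by (simp add: ac_simps)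
    also have "\<dots> \<le> 2 ^ n * emeasure M B" using C(4) by (rule mult_left_mono) simp
    also have "\<dots> \<le> emeasure M A" by fact
    finally show ?case using C B by (intro bexI[of _ C]) auto
  qed
  obtain m where m: "emeasure M A = ennreal m" "0 < m" using A by (cases "emeasure M A") auto
  obtain e' where e': "0 < e'" "ennreal e' \<le> e" 
  proof (cases e)
    case (real r)
    then show ?thesis using that[of r] assms(5) by auto
  qed (use that[of 1] in auto)
  obtain n :: nat where n: "m / e' < 2 ^ n" using real_arch_pow[of 2 "m/e'"] by auto
  obtain C where C: "C \<in> sets M" "C \<subseteq> A" "0 < emeasure M C" "2 ^ n * emeasure M C \<le> emeasure M A" using ex by blast
  have "emeasure M C < e"
  proof (rule ccontr)
    assume "\<not> ?thesis"
    then have "ennreal e' \<le> emeasure M C" using e' by simp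
    then have "2 ^ n * ennreal e' \<le> ennreal m" using C(4) m(1) by (metis mult_left_mono order_trans zero_le)
    then have "ennreal (2 ^ n * e') \<le> ennreal m" using e' by (simp add: ennreal_mult ennreal_power[symmetric])
    then have "2 ^ n * e' \<le> m" using m by simp
    then show False using n e' by (simp add: field_simps)
  qed
  then show ?thesis using that C by blast
qed

text \<open>Sierpinski's theorem: the sets are chosen greedily, each at least half as large as possible.\<close>

lemma non_atomic_exact_subset:
  assumes na: "non_atomic M" and A: "A \<in> sets M" "emeasure M A < top" and c: "c \<le> emeasure M A"
  obtains B where "B \<in> sets M" "B \<subseteq> A" "emeasure M B = c"
proof -
  define ok where "ok = (\<lambda>B C. C \<in> sets M \<and> C \<subseteq> A - B \<and> emeasure M B + emeasure M C \<le> c)"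
  define s where "s = (\<lambda>B. SUP C\<in>{C. ok B C}. emeasure M C)"
  have ex: "\<exists>C. ok B C \<and> s B \<le> 2 * emeasure M C" if B: "B \<in> sets M" "B \<subseteq> A" "emeasure M B \<le> c" for B
  proof (cases "s B = 0")
    case True
    then show ?thesis using that by (intro exI[of _ "{}"]) (simp add: ok_def)
  next
    case False
    have "s B \<le> emeasure M A" unfolding s_def ok_def by (intro SUP_least) (auto intro: emeasure_mono A)
    then obtain r where r: "s B = ennreal r" "0 < r" using A(2) False by (cases "s B") (auto simp: top_unique)
    have "ennreal (r / 2) < s B" using r by (simp add: ennreal_less_iff)
    then obtain C where C: "ok B C" "ennreal (r / 2) < emeasure M C" unfolding s_def by (auto simp: less_SUP_iff)
    have "s B = 2 * ennreal (r / 2)" using r ennreal_mult[of 2 "r/2"] by simp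
    also have "\<dots> \<le> 2 * emeasure M C" using C(2) by (intro mult_left_mono) auto
    finally show ?thesis using C by blast
  qed
  define good where "good = (\<lambda>B. B \<in> sets M \<and> B \<subseteq> A \<and> emeasure M B \<le> c)"
  have "\<exists>B. \<forall>n. good (B n) \<and> (\<exists>C. ok (B n) C \<and> s (B n) \<le> 2 * emeasure M C \<and> B (Suc n) = B n \<union> C)"
  proof (rule dependent_nat_choice)
    show "\<exists>B. good B" by (rule exI[of _ "{}"]) (simp add: good_def)
    fix B assume "good B"
    then obtain C where C: "ok B C" "s B \<le> 2 * emeasure M C" using ex good_def by blast
    have "emeasure M (B \<union> C) = emeasure M B + emeasure M C"
      using C \<open>good B\<close> by (intro plus_emeasure[symmetric]) (auto simp: ok_def good_def)
    then have "good (B \<union> C)" using C \<open>good B\<close> by (auto simp: ok_def good_def)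
    then show "\<exists>D. good D \<and> (\<exists>C. ok B C \<and> s B \<le> 2 * emeasure M C \<and> D = B \<union> C)" using C by blast
  qed
  then obtain B where B: "\<And>n. good (B n)" "\<And>n. \<exists>C. ok (B n) C \<and> s (B n) \<le> 2 * emeasure M C \<and> B (Suc n) = B n \<union> C"
    by blast
  have inc: "incseq B" using B(2) by (intro incseq_SucI) auto
  have rng: "range B \<subseteq> sets M" using B(1) by (auto simp: good_def)
  define U where "U = (\<Union>n. B n)"
  have U: "U \<in> sets M" "U \<subseteq> A" using B(1) by (auto simp: U_def good_def)
  have Usup: "emeasure M U = (SUP n. emeasure M (B n))" unfolding U_def using SUP_emeasure_incseq[OF rng inc] by simp
  have Uc: "emeasure M U \<le> c" unfolding Usup using B(1) by (intro SUP_least) (auto simp: good_def)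
  have "emeasure M U = c"
  proof (rule ccontr)
    assume "emeasure M U \<noteq> c"
    then have lt: "emeasure M U < c" using Uc by simp
    have "emeasure M U + emeasure M (A - U) = emeasure M A"
      using U A by (subst plus_emeasure) (auto intro!: arg_cong[where f = "emeasure M"])
    then have pos: "0 < emeasure M (A - U)" using lt c by (metis add.right_neutral not_le zero_less_iff_neq_zero)
    have fin: "emeasure M (A - U) < top" using emeasure_mono[of "A - U" A M] A by (auto intro: le_less_trans)
    have "0 < c - emeasure M U" using lt by (simp add: diff_gr0_ennreal)
    then obtain D where D: "D \<in> sets M" "D \<subseteq> A - U" "0 < emeasure M D" "emeasure M D < c - emeasure M U"
      using non_atomic_small_subset[OF na _ pos fin] U A by blast
    \<comment> \<open>A small set \<open>D\<close> left over would be an admissible choice at every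
      stage. Each stage would then add at least half the measure of \<open>D\<close>, contradicting
      the finite measure of \<open>A\<close>.\<close>
    have okD: "ok (B n) D" for n
    proof -
      have "emeasure M (B n) \<le> emeasure M U" unfolding Usup by (rule SUP_upper) simp
      then have "emeasure M (B n) + emeasure M D \<le> emeasure M U + (c - emeasure M U)"
        using D(4) by (intro add_mono) auto
      also have "\<dots> = c" using Uc by (metis add_diff_inverse_ennreal)
      finally show ?thesis using D by (auto simp: ok_def U_def)
    qed
    obtain d where d: "emeasure M D = ennreal d" "0 < d"
      using D(3) fin emeasure_mono[OF D(2), of M] U A by (cases "emeasure M D") (auto simp: top_unique)
    have step: "emeasure M (B n) + ennreal (d / 2) \<le> emeasure M (B (Suc n))" for n
    proof -
      obtain C where C: "ok (B n) C" "s (B n) \<le> 2 * emeasure M C" "B (Suc n) = B n \<union> C" using B(2) by blast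
      have "emeasure M D \<le> s (B n)" unfolding s_def using okD by (intro SUP_upper) auto
      then have "2 * ennreal (d / 2) \<le> 2 * emeasure M C" using C(2) d ennreal_mult[of 2 "d/2"] by simp
      then have "ennreal (d / 2) \<le> emeasure M C" by (subst (asm) ennreal_mult_le_mult_iff) auto
      moreover have "emeasure M (B n \<union> C) = emeasure M (B n) + emeasure M C"
        using C B(1) by (intro plus_emeasure[symmetric]) (auto simp: ok_def good_def)
      ultimately show ?thesis using C(3) by (simp add: add_left_mono)
    qed
    have ge: "ennreal (real n * (d / 2)) \<le> emeasure M (B n)" for n
    proof (induction n)
      case (Suc n)
      have "ennreal (real (Suc n) * (d / 2)) = ennreal (real n * (d / 2)) + ennreal (d / 2)"
        using d by (simp add: ennreal_plus[symmetric] algebra_simps del: ennreal_plus)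
      also have "\<dots> \<le> emeasure M (B n) + ennreal (d / 2)" using Suc by (rule add_right_mono)
      finally show ?case using step[of n] by (rule order_trans)
    qed simp
    obtain m where m: "emeasure M A = ennreal m" "0 \<le> m" using A(2) by (cases "emeasure M A") auto
    obtain n where n: "m / (d / 2) < real n" using reals_Archimedean2 by blast
    have "emeasure M (B n) \<le> ennreal m" using B(1)[of n] c m by (auto simp: good_def)
    then have "ennreal (real n * (d / 2)) \<le> ennreal m" using ge order_trans by blast
    then have "real n * (d / 2) \<le> m" using m by simp
    then show False using n d by (simp add: field_simps)
  qed
  then show ?thesis using that U by blast
qed

text \<open>The exact-subset theorem applied to the measure with density \<open>R\<close>,
  restricted to a part \<open>G\<close> of \<open>A\<close> where the integral is finite but still
  at least \<open>c\<close>.\<close>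

lemma (in sigma_finite_measure) exact_integral:
  assumes na: "non_atomic M" and A: "A \<in> sets M"
    and R: "R \<in> borel_measurable M" "\<And>t. t \<in> A \<Longrightarrow> R t < top"
    and c: "c \<le> (\<integral>\<^sup>+t\<in>A. R t \<partial>M)" "c < top"
  obtains B where "B \<in> sets M" "B \<subseteq> A" "(\<integral>\<^sup>+t\<in>B. R t \<partial>M) = c"
proof (cases "c = 0")
  case True
  then show ?thesis using that[of "{}"] by simp
next
  case False
  note [measurable] = A R(1)
  obtain E :: "nat \<Rightarrow> 'a set" where E: "range E \<subseteq> sets M" "(\<Union>i. E i) = space M" "\<And>i. emeasure M (E i) \<noteq> top" "incseq E"
    using sigma_finite_incseq by (metis infinity_ennreal_def)
  have [measurable]: "E n \<in> sets M" for n using E(1) by auto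
  \<comment> \<open>On these sets both the measure and \<open>R\<close> are bounded, so the
    integrals are finite; they exhaust \<open>A\<close> because \<open>R\<close> is finite
    there.\<close>
  define F where "F = (\<lambda>n. {t \<in> space M. t \<in> A \<and> t \<in> E n \<and> R t \<le> of_nat n})"
  have [measurable]: "F n \<in> sets M" for n unfolding F_def by measurable
  have incF: "F m \<subseteq> F n" if "m \<le> n" for m n
    using that incseqD[OF E(4) that] by (auto simp: F_def intro: order_trans)
  have FA: "\<exists>n. t \<in> F n" if "t \<in> A" for t
  proof -
    have "t \<in> space M" using that sets.sets_into_space[OF A] by auto
    then obtain i where "t \<in> E i" using E(2) by auto
    obtain k :: nat where "R t < of_nat k" using R(2)[OF \<open>t \<in> A\<close>] ennreal_Ex_less_of_nat by auto
    have "(of_nat k :: ennreal) \<le> of_nat (max i k)" by (rule of_nat_mono) simp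
    with \<open>R t < of_nat k\<close> have "R t \<le> of_nat (max i k)" by (rule order_trans[OF less_imp_le])
    then show ?thesis using \<open>t \<in> space M\<close> \<open>t \<in> A\<close> \<open>t \<in> E i\<close> incseqD[OF E(4), of i "max i k"]
      by (intro exI[of _ "max i k"]) (auto simp: F_def)
  qed
  have Ffin: "(\<integral>\<^sup>+t\<in>F n. R t \<partial>M) < top" for n
  proof -
    have "(\<integral>\<^sup>+t\<in>F n. R t \<partial>M) \<le> (\<integral>\<^sup>+t. of_nat n * indicator (E n) t \<partial>M)"
      by (intro nn_integral_mono) (auto simp: F_def indicator_def)
    also have "\<dots> = of_nat n * emeasure M (E n)" by (simp add: nn_integral_cmult_indicator)
    also have "\<dots> < top" using E(3)[of n] by (simp add: ennreal_mult_less_top less_top of_nat_less_top)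
    finally show ?thesis .
  qed
  have sup: "(\<integral>\<^sup>+t\<in>A. R t \<partial>M) = (SUP n. \<integral>\<^sup>+t\<in>F n. R t \<partial>M)"
  proof (subst nn_integral_monotone_convergence_SUP[symmetric])
    show "incseq (\<lambda>n t. R t * indicator (F n) t)"
      using incF by (auto simp: incseq_def le_fun_def indicator_def)
    show "(\<integral>\<^sup>+t\<in>A. R t \<partial>M) = (\<integral>\<^sup>+ t. (SUP n. R t * indicator (F n) t) \<partial>M)"
    proof (intro nn_integral_cong antisym)
      fix t
      show "R t * indicator A t \<le> (SUP n. R t * indicator (F n) t)"
      proof (cases "t \<in> A")
        case True
        then obtain n where "t \<in> F n" using FA by blast
        then show ?thesis using True by (intro SUP_upper2[of n]) auto
      qed simp
      show "(SUP n. R t * indicator (F n) t) \<le> R t * indicator A t"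
        by (intro SUP_least) (auto simp: F_def indicator_def)
    qed
  qed measurable
  obtain G where G[measurable]: "G \<in> sets M" and GA: "G \<subseteq> A" and Gfin: "(\<integral>\<^sup>+t\<in>G. R t \<partial>M) < top" and Gc: "c \<le> (\<integral>\<^sup>+t\<in>G. R t \<partial>M)"
  proof (cases "(\<integral>\<^sup>+t\<in>A. R t \<partial>M) < top")
    case True
    then show ?thesis using that[of A] c A by auto
  next
    case False
    then have "c < (SUP n. \<integral>\<^sup>+t\<in>F n. R t \<partial>M)" using sup c by (simp add: less_top)
    then obtain n where "c < (\<integral>\<^sup>+t\<in>F n. R t \<partial>M)" by (auto simp: less_SUP_iff)
    moreover have "F n \<subseteq> A" by (auto simp: F_def)
    ultimately show ?thesis using that[OF \<open>F n \<in> sets M\<close> _ Ffin[of n]] by simp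
  qed
  define \<nu> where "\<nu> = density M (\<lambda>t. R t * indicator G t)"
  have \<nu>: "emeasure \<nu> B = (\<integral>\<^sup>+t\<in>B. (R t * indicator G t) \<partial>M)" if "B \<in> sets M" for B
    unfolding \<nu>_def using that by (intro emeasure_density) auto
  have \<nu>G: "emeasure \<nu> B = (\<integral>\<^sup>+t\<in>B. R t \<partial>M)" if "B \<in> sets M" "B \<subseteq> G" for B
    unfolding \<nu>[OF that(1)] using that(2) by (intro nn_integral_cong) (auto simp: indicator_def)
  have s\<nu>: "sets \<nu> = sets M" by (simp add: \<nu>_def)
  have na\<nu>: "non_atomic \<nu>"
    unfolding non_atomic_def s\<nu>
  proof (intro ballI impI)
    fix B assume B[measurable]: "B \<in> sets M" and pos: "0 < emeasure \<nu> B"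
    \<comment> \<open>Discarding the points where the density vanishes costs nothing for
      \<open>\<nu>\<close> and makes every non-null subset non-null for \<open>\<nu>\<close>, so a
      splitting for \<open>M\<close> is one for \<open>\<nu>\<close>.\<close>
    define B' where "B' = {t \<in> space M. t \<in> B \<and> t \<in> G \<and> 0 < R t}"
    have [measurable]: "B' \<in> sets M" unfolding B'_def by measurable
    have eq: "emeasure \<nu> B' = emeasure \<nu> B"
      unfolding \<nu>[OF B] \<nu>[OF \<open>B' \<in> sets M\<close>]
      by (intro nn_integral_cong) (auto simp: indicator_def B'_def zero_less_iff_neq_zero)
    have null: "emeasure \<nu> C \<noteq> 0" if C: "C \<in> sets M" "C \<subseteq> B'" "emeasure M C \<noteq> 0" for C
    proof
      assume "emeasure \<nu> C = 0"
      then have "(\<integral>\<^sup>+t\<in>C. (R t * indicator G t) \<partial>M) = 0" using \<nu> C by simp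
      then have "AE t in M. R t * indicator G t * indicator C t = 0"
        using C(1) by (subst (asm) nn_integral_0_iff_AE) auto
      then have "AE t in M. t \<notin> C"
      proof eventually_elim
        case (elim t)
        then show ?case using C(2) by (auto simp: B'_def indicator_def split: if_splits)
      qed
      then have "C \<in> null_sets M" using C(1) by (simp add: AE_iff_null_sets)
      then show False using C(3) by auto
    qed
    have "0 < emeasure M B'"
    proof (rule ccontr)
      assume "\<not> ?thesis"
      then have "B' \<in> null_sets M" by auto
      then have "emeasure \<nu> B' = 0" unfolding \<nu>[OF \<open>B' \<in> sets M\<close>]
        by (intro nn_integral_null_set)
      then show False using pos eq by simp
    qed
    then obtain C where C: "C \<in> sets M" "C \<subseteq> B'" "0 < emeasure M C" "emeasure M C < emeasure M B'"
      using na \<open>B' \<in> sets M\<close> unfolding non_atomic_def by blast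
    have sumM: "emeasure M C + emeasure M (B' - C) = emeasure M B'"
      using C by (subst plus_emeasure) (auto intro!: arg_cong[where f = "emeasure M"])
    have sum: "emeasure \<nu> C + emeasure \<nu> (B' - C) = emeasure \<nu> B'"
      using C s\<nu> by (subst plus_emeasure) (auto intro!: arg_cong[where f = "emeasure \<nu>"])
    have "emeasure M (B' - C) \<noteq> 0" using sumM C(4) by auto
    then have "emeasure \<nu> (B' - C) \<noteq> 0" using C by (intro null) auto
    moreover have "emeasure \<nu> C < top"
    proof -
      have CG: "C \<subseteq> G" using C by (auto simp: B'_def)
      have "emeasure \<nu> C \<le> emeasure \<nu> G" using CG s\<nu> by (intro emeasure_mono) auto
      then show ?thesis using \<nu>G[of G] Gfin by simp
    qed
    ultimately have "emeasure \<nu> C < emeasure \<nu> B'"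
      unfolding sum[symmetric] by (simp add: zero_less_iff_neq_zero)
    moreover have "0 < emeasure \<nu> C" using null[of C] C by (auto simp: zero_less_iff_neq_zero)
    ultimately show "\<exists>C\<in>sets M. C \<subseteq> B \<and> 0 < emeasure \<nu> C \<and> emeasure \<nu> C < emeasure \<nu> B"
      using C eq by (intro bexI[of _ C]) (auto simp: B'_def)
  qed
  have "G \<in> sets \<nu>" "emeasure \<nu> G < top" "c \<le> emeasure \<nu> G"
    using s\<nu> \<nu>G[of G] Gfin Gc by auto
  then obtain B where "B \<in> sets \<nu>" "B \<subseteq> G" "emeasure \<nu> B = c"
    using non_atomic_exact_subset[OF na\<nu>] by blast
  then show ?thesis using that[of B] s\<nu> \<nu>G GA by auto
qed

subsection \<open>Sublinear functionals\<close>

definition function_space :: "('a \<Rightarrow> real) set \<Rightarrow> bool" where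
  "function_space E \<longleftrightarrow> (\<lambda>t. 0) \<in> E \<and> (\<forall>u\<in>E. \<forall>v\<in>E. (\<lambda>t. u t + v t) \<in> E) \<and> (\<forall>c. \<forall>u\<in>E. (\<lambda>t. c * u t) \<in> E)"

text \<open>Only one inequality of positive homogeneity is demanded; the other follows by rescaling
  with \<open>1 / c\<close>. Functionals built as infima then need checking in one direction
  only.\<close>

definition sublinear_on :: "('a \<Rightarrow> real) set \<Rightarrow> (('a \<Rightarrow> real) \<Rightarrow> real) \<Rightarrow> bool" where
  "sublinear_on E p \<longleftrightarrow> p (\<lambda>t. 0) = 0 \<and> (\<forall>u\<in>E. \<forall>v\<in>E. p (\<lambda>t. u t + v t) \<le> p u + p v) \<and>
     (\<forall>c>0. \<forall>u\<in>E. c * p u \<le> p (\<lambda>t. c * u t))"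

lemma function_spaceD:
  assumes "function_space E"
  shows "(\<lambda>t. 0) \<in> E" "u \<in> E \<Longrightarrow> v \<in> E \<Longrightarrow> (\<lambda>t. u t + v t) \<in> E" "u \<in> E \<Longrightarrow> (\<lambda>t. c * u t) \<in> E"
    "u \<in> E \<Longrightarrow> (\<lambda>t. - u t) \<in> E"
proof -
  show "u \<in> E \<Longrightarrow> (\<lambda>t. - u t) \<in> E"
  proof -
    assume "u \<in> E"
    then have "(\<lambda>t. (- 1) * u t) \<in> E" using assms unfolding function_space_def by blast
    then show ?thesis by simp
  qed
qed (use assms in \<open>auto simp: function_space_def\<close>)

lemma sublinear_onD:
  assumes "sublinear_on E p" "function_space E" "u \<in> E"
  shows "p (\<lambda>t. 0) = 0" "v \<in> E \<Longrightarrow> p (\<lambda>t. u t + v t) \<le> p u + p v" "0 \<le> c \<Longrightarrow> p (\<lambda>t. c * u t) = c * p u"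
    "0 \<le> p u + p (\<lambda>t. - u t)"
proof -
  show 0: "p (\<lambda>t. 0) = 0" using assms by (simp add: sublinear_on_def)
  show sub: "v \<in> E \<Longrightarrow> p (\<lambda>t. u t + v t) \<le> p u + p v" for v using assms by (simp add: sublinear_on_def)
  have hom: "0 < c \<Longrightarrow> u \<in> E \<Longrightarrow> c * p u \<le> p (\<lambda>t. c * u t)" for c u using assms(1) unfolding sublinear_on_def by blast
  show "0 \<le> c \<Longrightarrow> p (\<lambda>t. c * u t) = c * p u"
  proof (cases "c = 0")
    case False
    assume "0 \<le> c"
    with False have c: "0 < c" by simp
    have "1 / c * p (\<lambda>t. c * u t) \<le> p (\<lambda>t. 1 / c * (c * u t))"
      using c assms by (intro hom[of "1 / c" "\<lambda>t. c * u t"] function_spaceD) auto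
    also have "(\<lambda>t. 1 / c * (c * u t)) = u" using c by auto
    finally show ?thesis using hom[OF c assms(3)] c by (simp add: field_simps)
  qed (simp add: 0)
  show "0 \<le> p u + p (\<lambda>t. - u t)"
    using sub[OF function_spaceD(4)[OF assms(2,3)]] 0 by simp
qed

text \<open>\<open>q u\<close> is the infimum of \<open>p (u + s y) - s p y\<close> over
  \<open>s \<ge> 0\<close>. The last property at \<open>u = - y\<close> gives
  \<open>q (- y) \<le> - p y\<close>; when \<open>p\<close> is minimal, \<open>q = p\<close> and the
  property becomes superadditivity in direction \<open>y\<close>.\<close>

lemma sublinear_on_shift:
  assumes E: "function_space E" and p: "sublinear_on E p" and y: "y \<in> E"
  obtains q where "sublinear_on E q" "\<And>u. u \<in> E \<Longrightarrow> q u \<le> p u" "\<And>u. u \<in> E \<Longrightarrow> q u \<le> p (\<lambda>t. u t + y t) - p y"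
proof
  define g where "g = (\<lambda>u s. p (\<lambda>t. u t + s * y t) - s * p y)"
  define q where "q = (\<lambda>u. INF s\<in>{0..}. g u s)"
  have lb: "- p (\<lambda>t. - u t) \<le> g u s" if "u \<in> E" "0 \<le> s" for u s
  proof -
    have "s * p y = p (\<lambda>t. s * y t)" using sublinear_onD(3)[OF p E y that(2)] by simp
    also have "(\<lambda>t. s * y t) = (\<lambda>t. (u t + s * y t) + - u t)" by simp
    also have "p \<dots> \<le> p (\<lambda>t. u t + s * y t) + p (\<lambda>t. - u t)"
      using function_spaceD[OF E] that y by (intro sublinear_onD(2)[OF p E]) auto
    finally show ?thesis by (simp add: g_def)
  qed
  have bdd: "bdd_below (g u ` {0..})" if "u \<in> E" for u using lb[OF that] by (intro bdd_belowI2) auto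
  have qle: "q u \<le> g u s" if "u \<in> E" "0 \<le> s" for u s
    unfolding q_def using bdd that by (intro cINF_lower) auto
  have qge: "c \<le> q u" if "\<And>s. 0 \<le> s \<Longrightarrow> c \<le> g u s" for c u
    unfolding q_def using that by (intro cINF_greatest) auto
  show "q u \<le> p u" if "u \<in> E" for u using qle[OF that, of 0] by (simp add: g_def)
  show "q u \<le> p (\<lambda>t. u t + y t) - p y" if "u \<in> E" for u using qle[OF that, of 1] by (simp add: g_def)
  show "sublinear_on E q"
    unfolding sublinear_on_def
  proof (intro conjI ballI allI impI)
    have z: "g (\<lambda>t. 0) s = 0" if "0 \<le> s" for s using sublinear_onD(3)[OF p E y that] by (simp add: g_def)
    show "q (\<lambda>t. 0) = 0" using qle[OF function_spaceD(1)[OF E], of 0] qge[of 0 "\<lambda>t. 0"] z by (intro antisym) auto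
    fix u assume u: "u \<in> E"
    show "q (\<lambda>t. u t + v t) \<le> q u + q v" if v: "v \<in> E" for v
    proof -
      have "q (\<lambda>t. u t + v t) \<le> g u s + g v r" if "0 \<le> s" "0 \<le> r" for s r
      proof -
        have "q (\<lambda>t. u t + v t) \<le> p (\<lambda>t. (u t + v t) + (s + r) * y t) - (s + r) * p y"
          using qle[of "\<lambda>t. u t + v t" "s + r"] that u v function_spaceD[OF E] by (simp add: g_def)
        also have "(\<lambda>t. (u t + v t) + (s + r) * y t) = (\<lambda>t. (u t + s * y t) + (v t + r * y t))"
          by (simp add: algebra_simps)
        also have "p \<dots> \<le> p (\<lambda>t. u t + s * y t) + p (\<lambda>t. v t + r * y t)"
          using u v y function_spaceD[OF E] by (intro sublinear_onD(2)[OF p E]) auto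
        finally show ?thesis by (simp add: g_def algebra_simps)
      qed
      then have "q (\<lambda>t. u t + v t) - g v r \<le> q u" if "0 \<le> r" for r
        using that by (intro qge) (simp add: algebra_simps)
      then have "q (\<lambda>t. u t + v t) - q u \<le> q v" by (intro qge) (simp add: algebra_simps)
      then show ?thesis by simp
    qed
    fix c :: real assume c: "0 < c"
    show "c * q u \<le> q (\<lambda>t. c * u t)"
    proof (rule qge)
      fix s :: real assume s: "0 \<le> s"
      have "c * q u \<le> c * g u (s / c)" using qle[OF u, of "s / c"] s c by simp
      also have "\<dots> = c * p (\<lambda>t. u t + s / c * y t) - s * p y" using c by (simp add: g_def algebra_simps)
      also have "c * p (\<lambda>t. u t + s / c * y t) = p (\<lambda>t. c * (u t + s / c * y t))"
        using c by (intro sublinear_onD(3)[OF p E, symmetric] function_spaceD(2)[OF E u] function_spaceD(3)[OF E y]) auto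
      also have "(\<lambda>t. c * (u t + s / c * y t)) = (\<lambda>t. c * u t + s * y t)" using c by (auto simp: algebra_simps)
      finally show "c * q u \<le> g (\<lambda>t. c * u t) s" by (simp add: g_def)
    qed
  qed
qed

text \<open>In the Hahn--Banach theorem below, linearity comes from minimality among sublinear functionals.\<close>

lemma minimal_sublinear:
  assumes E: "function_space E" and p: "sublinear_on E p"
  obtains q where "sublinear_on E q" "\<And>u. u \<in> E \<Longrightarrow> q u \<le> p u"
    "\<And>r u. sublinear_on E r \<Longrightarrow> (\<And>u. u \<in> E \<Longrightarrow> r u \<le> q u) \<Longrightarrow> u \<in> E \<Longrightarrow> r u = q u"
proof -
  \<comment> \<open>Fixing the values outside \<open>E\<close> to 0 makes the pointwise order
    antisymmetric. The order \<open>P\<close> is reversed, so maximal elements in Zorn's lemma are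
    minimal functionals.\<close>
  define S where "S = {q. sublinear_on E q \<and> (\<forall>u\<in>E. q u \<le> p u) \<and> (\<forall>u. u \<notin> E \<longrightarrow> q u = 0)}"
  define P where "P = (\<lambda>q r :: ('a \<Rightarrow> real) \<Rightarrow> real. \<forall>u. r u \<le> q u)"
  define cut where "cut = (\<lambda>q :: ('a \<Rightarrow> real) \<Rightarrow> real. \<lambda>u. if u \<in> E then q u else 0)"
  have cut: "sublinear_on E (cut q)" if "sublinear_on E q" for q
    using that function_spaceD[OF E] by (auto simp: sublinear_on_def cut_def)
  have "\<exists>m\<in>S. \<forall>a\<in>S. P m a \<longrightarrow> a = m"
  proof (rule predicate_Zorn)
    show "partial_order_on S (relation_of P S)"
      by (rule partial_order_on_relation_ofI) (auto simp: P_def fun_eq_iff intro: order_trans antisym)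
    fix C assume C: "C \<in> Chains (relation_of P S)"
    then have CS: "C \<subseteq> S" by (auto simp: Chains_def relation_of_def)
    have chain: "P q r \<or> P r q" if "q \<in> C" "r \<in> C" for q r
      using C that by (auto simp: Chains_def relation_of_def)
    show "\<exists>u\<in>S. \<forall>a\<in>C. P a u"
    proof (cases "C = {}")
      case True
      have "cut p \<in> S" using cut[OF p] by (auto simp: S_def cut_def)
      then show ?thesis using True by blast
    next
      case False
      define r where "r = cut (\<lambda>u. INF q\<in>C. q u)"
      have sub: "sublinear_on E q" if "q \<in> C" for q using CS that by (auto simp: S_def)
      have lb: "- p (\<lambda>t. - u t) \<le> q u" if "q \<in> C" "u \<in> E" for q u
      proof -
        have "q (\<lambda>t. - u t) \<le> p (\<lambda>t. - u t)" using CS that function_spaceD[OF E] by (auto simp: S_def)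
        then show ?thesis using sublinear_onD(4)[OF sub[OF that(1)] E that(2)] by linarith
      qed
      have rle: "r u \<le> q u" if "q \<in> C" "u \<in> E" for q u
        unfolding r_def cut_def using that lb by (auto intro!: cINF_lower bdd_belowI2)
      have rge: "c \<le> r u" if "u \<in> E" "\<And>q. q \<in> C \<Longrightarrow> c \<le> q u" for c u
        unfolding r_def cut_def using that False by (auto intro!: cINF_greatest)
      have "sublinear_on E r"
        unfolding sublinear_on_def
      proof (intro conjI ballI allI impI)
        have z: "q (\<lambda>t. 0) = 0" if "q \<in> C" for q using sub[OF that] by (simp add: sublinear_on_def)
        show "r (\<lambda>t. 0) = 0"
          using False z rle[OF _ function_spaceD(1)[OF E]] rge[OF function_spaceD(1)[OF E], of 0]
          by (metis antisym ex_in_conv order_refl)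
        fix u assume u: "u \<in> E"
        show "r (\<lambda>t. u t + v t) \<le> r u + r v" if v: "v \<in> E" for v
        proof -
          have uv: "(\<lambda>t. u t + v t) \<in> E" using u v function_spaceD[OF E] by auto
          have le: "r (\<lambda>t. u t + v t) \<le> q1 u + q2 v" if qs: "q1 \<in> C" "q2 \<in> C" for q1 q2
          proof -
            \<comment> \<open>Subadditivity of the infimum uses the chain condition: the smaller of
              \<open>q1\<close> and \<open>q2\<close> serves both arguments.\<close>
            obtain m where m: "m \<in> C" "m u \<le> q1 u" "m v \<le> q2 v"
              using chain[OF qs] qs unfolding P_def by (metis order_refl)
            have "r (\<lambda>t. u t + v t) \<le> m (\<lambda>t. u t + v t)" using rle[OF m(1) uv] .
            also have "\<dots> \<le> m u + m v" using sublinear_onD(2)[OF sub[OF m(1)] E u v] .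
            finally show ?thesis using m by linarith
          qed
          have "r (\<lambda>t. u t + v t) - q2 v \<le> r u" if "q2 \<in> C" for q2
            using le that u by (intro rge) (auto simp: algebra_simps)
          then have "r (\<lambda>t. u t + v t) - r u \<le> r v" using v by (intro rge) (auto simp: algebra_simps)
          then show ?thesis by simp
        qed
        fix c :: real assume c: "0 < c"
        show "c * r u \<le> r (\<lambda>t. c * u t)"
        proof (rule rge)
          show "(\<lambda>t. c * u t) \<in> E" using u function_spaceD[OF E] by auto
          fix q assume q: "q \<in> C"
          show "c * r u \<le> q (\<lambda>t. c * u t)"
            using rle[OF q u] sublinear_onD(3)[OF sub[OF q] E u, of c] c by simp
        qed
      qed
      moreover have "r u \<le> p u" if "u \<in> E" for u
      proof -
        obtain q where q: "q \<in> C" using False by auto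
        then have "q u \<le> p u" using CS that by (auto simp: S_def)
        then show ?thesis using rle[OF q that] by linarith
      qed
      ultimately have "r \<in> S" by (auto simp: S_def r_def cut_def)
      moreover have "P q r" if "q \<in> C" for q
      proof -
        have "q u = 0" if "u \<notin> E" for u using CS \<open>q \<in> C\<close> that by (auto simp: S_def)
        then show ?thesis using rle[OF that] by (auto simp: P_def r_def cut_def) 
      qed
      ultimately show ?thesis by blast
    qed
  qed
  then obtain m where m: "m \<in> S" "\<And>a. a \<in> S \<Longrightarrow> P m a \<Longrightarrow> a = m" by blast
  show ?thesis
  proof (rule that)
    show "sublinear_on E m" "\<And>u. u \<in> E \<Longrightarrow> m u \<le> p u" using m by (auto simp: S_def)
    fix r u assume r: "sublinear_on E r" "\<And>u. u \<in> E \<Longrightarrow> r u \<le> m u" and u: "u \<in> E"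
    have "cut r \<in> S" using cut[OF r(1)] r(2) m(1) by (auto simp: S_def cut_def intro: order_trans)
    moreover have "P m (cut r)" using r(2) m(1) by (auto simp: S_def P_def cut_def)
    ultimately have "cut r = m" by (rule m(2))
    then show "r u = m u" using u by (auto simp: cut_def)
  qed
qed

text \<open>Instead of extending a functional from a line, \<open>p\<close> is first shifted in
  direction \<open>h\<close>, which makes every functional below it take the value
  \<open>p h\<close> at \<open>h\<close>. Shifting a minimal functional in an arbitrary direction
  then shows that it is additive.\<close>

lemma hahn_banach:
  assumes E: "function_space E" and p: "sublinear_on E p" and h: "h \<in> E"
  obtains F where "\<And>u v. u \<in> E \<Longrightarrow> v \<in> E \<Longrightarrow> F (\<lambda>t. u t + v t) = F u + F v"
    "\<And>c u. u \<in> E \<Longrightarrow> F (\<lambda>t. c * u t) = c * F u" "\<And>u. u \<in> E \<Longrightarrow> F u \<le> p u" "F h = p h"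
proof -
  obtain p1 where p1: "sublinear_on E p1" "\<And>u. u \<in> E \<Longrightarrow> p1 u \<le> p u" "\<And>u. u \<in> E \<Longrightarrow> p1 u \<le> p (\<lambda>t. u t + h t) - p h"
    using sublinear_on_shift[OF E p h] by blast
  obtain F where F: "sublinear_on E F" "\<And>u. u \<in> E \<Longrightarrow> F u \<le> p1 u"
    "\<And>r u. sublinear_on E r \<Longrightarrow> (\<And>u. u \<in> E \<Longrightarrow> r u \<le> F u) \<Longrightarrow> u \<in> E \<Longrightarrow> r u = F u"
    using minimal_sublinear[OF E p1(1)] by blast
  have add: "F (\<lambda>t. u t + v t) = F u + F v" if uv: "u \<in> E" "v \<in> E" for u v
  proof -
    obtain q where q: "sublinear_on E q" "\<And>u. u \<in> E \<Longrightarrow> q u \<le> F u" "\<And>u. u \<in> E \<Longrightarrow> q u \<le> F (\<lambda>t. u t + v t) - F v"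
      using sublinear_on_shift[OF E F(1) uv(2)] by blast
    have "F u \<le> F (\<lambda>t. u t + v t) - F v" using F(3)[OF q(1,2) uv(1)] q(3)[OF uv(1)] by simp
    then show ?thesis using sublinear_onD(2)[OF F(1) E uv] by linarith
  qed
  have neg: "F (\<lambda>t. - u t) = - F u" if "u \<in> E" for u
    using add[OF that function_spaceD(4)[OF E that]] sublinear_onD(1)[OF F(1) E that] by simp
  have "F (\<lambda>t. c * u t) = c * F u" if "u \<in> E" for c u
  proof (cases "0 \<le> c")
    case True
    then show ?thesis using sublinear_onD(3)[OF F(1) E that] by blast
  next
    case False
    then have "F (\<lambda>t. - c * u t) = - c * F u" using sublinear_onD(3)[OF F(1) E that, of "- c"] by simp
    moreover have "F (\<lambda>t. - (c * u t)) = - F (\<lambda>t. c * u t)" using neg function_spaceD[OF E] that by blast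
    ultimately show ?thesis by simp
  qed
  moreover have "F h = p h"
  proof -
    have "F (\<lambda>t. - h t) \<le> p (\<lambda>t. - h t + h t) - p h"
      using F(2) p1(3) function_spaceD(4)[OF E h] order_trans by blast
    then have "p h \<le> F h" using neg[OF h] sublinear_onD(1)[OF p E h] by simp
    then show ?thesis using F(2)[OF h] p1(2)[OF h] by simp
  qed
  moreover have "F u \<le> p u" if "u \<in> E" for u using F(2)[OF that] p1(2)[OF that] by linarith
  ultimately show ?thesis using add by (intro that[of F]) auto
qed

subsection \<open>The Orlicz norm\<close>

lemma nn_integral_exhaust_le:
  assumes f[measurable]: "f \<in> borel_measurable M" and S[measurable]: "\<And>m. S m \<in> sets M" and inc: "incseq S"
    and cover: "\<And>t. t \<in> space M \<Longrightarrow> 0 < f t \<Longrightarrow> \<exists>m. t \<in> S m"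
    and le: "\<And>m::nat. (\<integral>\<^sup>+t\<in>S m. f t \<partial>M) \<le> R"
  shows "(\<integral>\<^sup>+t. f t \<partial>M) \<le> R"
proof -
  have "(\<integral>\<^sup>+t. f t \<partial>M) = (\<integral>\<^sup>+t. (SUP m. f t * indicator (S m) t) \<partial>M)"
  proof (intro nn_integral_cong antisym)
    fix t assume t: "t \<in> space M"
    show "f t \<le> (SUP m. f t * indicator (S m) t)"
    proof (cases "f t = 0")
      case False
      then obtain m where "t \<in> S m" using cover[OF t] by (auto simp: zero_less_iff_neq_zero)
      then show ?thesis by (intro SUP_upper2[of m]) auto
    qed simp
    show "(SUP m. f t * indicator (S m) t) \<le> f t" by (intro SUP_least) (auto simp: indicator_def)
  qed
  also have "\<dots> = (SUP m. \<integral>\<^sup>+t\<in>S m. f t \<partial>M)"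
    using incseqD[OF inc] by (intro nn_integral_monotone_convergence_SUP) (auto simp: incseq_def le_fun_def indicator_def)
  also have "\<dots> \<le> R" by (rule SUP_least) (rule le)
  finally show ?thesis .
qed

text \<open>The pointwise conditions are assumed at every \<open>t\<close>; the case where they hold
  only almost everywhere is reduced to this one by changing \<open>\<Phi>\<close> on a null
  set.\<close>

locale young_family = sigma_finite_measure M for M :: "'a measure" +
  fixes \<Phi> :: "'a \<Rightarrow> ennreal \<Rightarrow> ennreal"
  assumes young: "\<And>t. young (\<Phi> t)" and measurable_const: "\<And>u. (\<lambda>t. \<Phi> t u) \<in> borel_measurable M"
begin

abbreviation "\<Psi> t \<equiv> conjugate (\<Phi> t)"
abbreviation "E \<equiv> mo_space M \<Phi>"
abbreviation "N \<equiv> orlicz_norm M \<Phi>"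
abbreviation "I \<equiv> modular M \<Phi>"

definition "J v = (\<integral>\<^sup>+t. \<Psi> t (ennreal \<bar>v t\<bar>) \<partial>M)"

lemma J_eq: "modular M (complementary \<Phi>) v = J v"
  by (simp add: modular_def J_def complementary_eq_conjugate)

definition "V = {v \<in> borel_measurable M. J v \<le> 1}"

lemma N_eq: "N u = (SUP v\<in>V. \<bar>\<integral>t. u t * v t \<partial>M\<bar>)"
proof -
  have "{v \<in> mo_class M (complementary \<Phi>). modular M (complementary \<Phi>) v \<le> 1} = V"
    by (auto simp: mo_class_def V_def J_eq intro: le_less_trans[OF _ ennreal_one_less_top])
  then show ?thesis by (simp add: orlicz_norm_def)
qed

lemma measurable_\<Phi>[measurable]:
  assumes [measurable]: "w \<in> borel_measurable M"
  shows "(\<lambda>t. \<Phi> t (w t)) \<in> borel_measurable M"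
proof -
  note measurable_const[measurable]
  show ?thesis unfolding young_eq_SUP[OF young, of _ "w _"] by measurable
qed

lemma measurable_\<Psi>[measurable]:
  assumes [measurable]: "w \<in> borel_measurable M"
  shows "(\<lambda>t. \<Psi> t (w t)) \<in> borel_measurable M"
proof -
  note measurable_const[measurable]
  show ?thesis unfolding conjugate_eq_SUP[OF young, of _ "w _"] by measurable
qed

lemma I_mono:
  assumes "\<And>t. t \<in> space M \<Longrightarrow> \<bar>u t\<bar> \<le> \<bar>v t\<bar>"
  shows "I u \<le> I v"
  unfolding modular_def by (intro nn_integral_mono young_mono[OF young] ennreal_leI assms)

lemma J_mono:
  assumes "\<And>t. t \<in> space M \<Longrightarrow> \<bar>u t\<bar> \<le> \<bar>v t\<bar>"
  shows "J u \<le> J v"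
  unfolding J_def by (intro nn_integral_mono conjugate_mono ennreal_leI assms)

lemma measurable_E[measurable_dest]: "u \<in> E \<Longrightarrow> u \<in> borel_measurable M"
  by (simp add: mo_space_def)

lemma E_I:
  assumes "u \<in> borel_measurable M" "0 < l" "I (\<lambda>t. l * u t) < top"
  shows "u \<in> E"
  using assms by (auto simp: mo_space_def)

lemma E_E:
  assumes "u \<in> E" obtains l where "0 < l" "I (\<lambda>t. l * u t) < top"
  using assms by (auto simp: mo_space_def)

lemma E_abs_le:
  assumes "v \<in> E" and [measurable]: "u \<in> borel_measurable M" and "\<And>t. t \<in> space M \<Longrightarrow> \<bar>u t\<bar> \<le> \<bar>v t\<bar>"
  shows "u \<in> E"
proof -
  obtain l where l: "0 < l" "I (\<lambda>t. l * v t) < top" using E_E assms(1) by blast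
  have "I (\<lambda>t. l * u t) \<le> I (\<lambda>t. l * v t)"
    using l assms(3) by (intro I_mono) (auto simp: abs_mult)
  then show ?thesis using l by (intro E_I) (auto intro: le_less_trans)
qed

lemma function_space_E: "function_space E"
  unfolding function_space_def
proof (intro conjI ballI allI)
  have "I (\<lambda>t. 1 * 0) = 0" using young by (simp add: modular_def)
  then show "(\<lambda>t. 0) \<in> E" by (intro E_I[of _ 1]) auto
  fix u assume u: "u \<in> E"
  then obtain l where l: "0 < l" "I (\<lambda>t. l * u t) < top" using E_E by blast
  note [measurable] = measurable_E[OF u]
  show "(\<lambda>t. c * u t) \<in> E" for c
  proof (rule E_I)
    show "0 < l / (\<bar>c\<bar> + 1)" using l by simp
    have "I (\<lambda>t. l / (\<bar>c\<bar> + 1) * (c * u t)) \<le> I (\<lambda>t. l * u t)"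
    proof (rule I_mono)
      fix t
      have "\<bar>l / (\<bar>c\<bar> + 1) * (c * u t)\<bar> = \<bar>l * u t\<bar> * (\<bar>c\<bar> / (\<bar>c\<bar> + 1))"
        by (simp add: abs_mult field_simps)
      also have "\<dots> \<le> \<bar>l * u t\<bar> * 1" by (intro mult_left_mono) auto
      finally show "\<bar>l / (\<bar>c\<bar> + 1) * (c * u t)\<bar> \<le> \<bar>l * u t\<bar>" by simp
    qed
    then show "I (\<lambda>t. l / (\<bar>c\<bar> + 1) * (c * u t)) < top" using l(2) by (rule le_less_trans)
  qed measurable
  fix v assume v: "v \<in> E"
  then obtain r where r: "0 < r" "I (\<lambda>t. r * v t) < top" using E_E by blast
  note [measurable] = measurable_E[OF v]
  define s where "s = min l r / 2"
  have s: "0 < s" "2 * s \<le> l" "2 * s \<le> r" using l r by (auto simp: s_def)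
  have "I (\<lambda>t. s * (u t + v t)) \<le> (\<integral>\<^sup>+t. \<Phi> t (ennreal \<bar>l * u t\<bar>) + \<Phi> t (ennreal \<bar>r * v t\<bar>) \<partial>M)"
    unfolding modular_def
  proof (rule nn_integral_mono)
    fix t
    define a where "a = max \<bar>l * u t\<bar> \<bar>r * v t\<bar>"
    have "2 * s * \<bar>u t\<bar> \<le> l * \<bar>u t\<bar>" "2 * s * \<bar>v t\<bar> \<le> r * \<bar>v t\<bar>" using s by (intro mult_right_mono; simp)+
    moreover have "\<bar>s * (u t + v t)\<bar> \<le> s * \<bar>u t\<bar> + s * \<bar>v t\<bar>"
      using s abs_triangle_ineq[of "s * u t" "s * v t"] by (simp add: abs_mult distrib_left)
    ultimately have "\<bar>s * (u t + v t)\<bar> \<le> a" using l r by (auto simp: a_def abs_mult max_def)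
    then have "\<Phi> t (ennreal \<bar>s * (u t + v t)\<bar>) \<le> \<Phi> t (ennreal a)" by (intro young_mono[OF young] ennreal_leI)
    also have "\<dots> \<le> \<Phi> t (ennreal \<bar>l * u t\<bar>) + \<Phi> t (ennreal \<bar>r * v t\<bar>)"
      by (auto simp: a_def max_def add_increasing add_increasing2)
    finally show "\<Phi> t (ennreal \<bar>s * (u t + v t)\<bar>) \<le> \<Phi> t (ennreal \<bar>l * u t\<bar>) + \<Phi> t (ennreal \<bar>r * v t\<bar>)" .
  qed
  also have "\<dots> = I (\<lambda>t. l * u t) + I (\<lambda>t. r * v t)"
    unfolding modular_def by (rule nn_integral_add) measurable
  also have "\<dots> < top" using l r by simp
  finally show "(\<lambda>t. u t + v t) \<in> E" using s(1) by (intro E_I) auto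
qed

lemmas E_zero = function_spaceD(1)[OF function_space_E]
  and E_add = function_spaceD(2)[OF function_space_E]
  and E_scale = function_spaceD(3)[OF function_space_E]
  and E_uminus = function_spaceD(4)[OF function_space_E]

lemma E_abs: "u \<in> E \<Longrightarrow> (\<lambda>t. \<bar>u t\<bar>) \<in> E"
  by (rule E_abs_le[of u]) auto

lemma young_nn:
  assumes "0 \<le> a" "0 \<le> b"
  shows "ennreal (a * b) \<le> \<Phi> t (ennreal a) + \<Psi> t (ennreal b)"
  using young_inequality[OF young, of "ennreal a" "ennreal b"] assms by (simp add: ennreal_mult)

lemma nn_pairing_le:
  assumes [measurable]: "u \<in> borel_measurable M" "v \<in> borel_measurable M"
  shows "(\<integral>\<^sup>+t. ennreal \<bar>u t * v t\<bar> \<partial>M) \<le> I u + J v"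
proof -
  have "(\<integral>\<^sup>+t. ennreal \<bar>u t * v t\<bar> \<partial>M) \<le> (\<integral>\<^sup>+t. \<Phi> t (ennreal \<bar>u t\<bar>) + \<Psi> t (ennreal \<bar>v t\<bar>) \<partial>M)"
    by (intro nn_integral_mono) (simp add: abs_mult young_nn)
  also have "\<dots> = I u + J v" unfolding modular_def J_def by (rule nn_integral_add) measurable
  finally show ?thesis .
qed

lemma integrable_pairing:
  assumes u: "u \<in> E" and v[measurable]: "v \<in> borel_measurable M" and J: "J v < top"
  shows "integrable M (\<lambda>t. u t * v t)"
proof -
  note [measurable] = measurable_E[OF u]
  obtain l where l: "0 < l" "I (\<lambda>t. l * u t) < top" using E_E u by blast
  have "integrable M (\<lambda>t. l * u t * v t)"
  proof (rule integrableI_bounded)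
    have "(\<integral>\<^sup>+t. ennreal (norm (l * u t * v t)) \<partial>M) \<le> I (\<lambda>t. l * u t) + J v"
      using nn_pairing_le[of "\<lambda>t. l * u t" v] by simp
    then show "(\<integral>\<^sup>+t. ennreal (norm (l * u t * v t)) \<partial>M) < \<infinity>" using l J by (auto intro: le_less_trans)
  qed measurable
  then have "integrable M (\<lambda>t. (1 / l) * (l * u t * v t))" by (rule integrable_mult_right)
  then show ?thesis using l by simp
qed

lemma V_D: "v \<in> V \<Longrightarrow> v \<in> borel_measurable M" "v \<in> V \<Longrightarrow> J v \<le> 1" "v \<in> V \<Longrightarrow> J v < top"
  by (auto simp: V_def intro: le_less_trans[OF _ ennreal_one_less_top])

lemma J_zero [simp]: "J (\<lambda>t. 0) = 0"
  by (simp add: J_def)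

lemma V_zero: "(\<lambda>t. 0) \<in> V"
  by (simp add: V_def)

text \<open>Young's inequality applied to \<open>k u\<close> and \<open>v\<close>: the easy half of
  the Amemiya formula.\<close>

lemma pairing_le:
  assumes u: "u \<in> E" and v: "v \<in> V" and k: "0 < k" and c: "1 + I (\<lambda>t. k * u t) \<le> ennreal (k * c)"
  shows "\<bar>\<integral>t. u t * v t \<partial>M\<bar> \<le> c"
proof -
  note [measurable] = measurable_E[OF u] V_D(1)[OF v]
  have int: "integrable M (\<lambda>t. u t * v t)" by (rule integrable_pairing[OF u V_D(1,3)[OF v]])
  have "ennreal (k * \<bar>\<integral>t. u t * v t \<partial>M\<bar>) = ennreal (norm (\<integral>t. k * u t * v t \<partial>M))"
    using k by (simp add: abs_mult mult.assoc)
  also have "\<dots> \<le> (\<integral>\<^sup>+t. ennreal \<bar>k * u t * v t\<bar> \<partial>M)"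
    using integral_norm_bound_ennreal[of M "\<lambda>t. k * u t * v t"] int by (simp add: mult.assoc)
  also have "\<dots> \<le> I (\<lambda>t. k * u t) + J v" by (rule nn_pairing_le) auto
  also have "\<dots> \<le> I (\<lambda>t. k * u t) + 1" using V_D(2)[OF v] by (rule add_left_mono)
  also have "\<dots> \<le> ennreal (k * c)" using c by (simp add: add.commute)
  finally have *: "ennreal (k * \<bar>\<integral>t. u t * v t \<partial>M\<bar>) \<le> ennreal (k * c)" .
  \<comment> \<open>\<open>ennreal\<close> sends negative reals to 0, so the sign of
    \<open>k * c\<close> must be known before the estimate returns to the reals; the summand 1 in
    the hypothesis provides it.\<close>
  have "0 < ennreal (k * c)" using c by (metis add_increasing2 less_le_trans zero_le zero_less_one order_refl)
  then have "0 \<le> k * c" by simp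
  then have "k * \<bar>\<integral>t. u t * v t \<partial>M\<bar> \<le> k * c" using * by simp
  then show ?thesis using k by simp
qed

lemma bdd_N:
  assumes "u \<in> E"
  shows "bdd_above ((\<lambda>v. \<bar>\<integral>t. u t * v t \<partial>M\<bar>) ` V)"
proof -
  obtain l where l: "0 < l" "I (\<lambda>t. l * u t) < top" using E_E assms by blast
  then obtain r where r: "I (\<lambda>t. l * u t) = ennreal r" "0 \<le> r" by (auto simp: less_top_ennreal)
  have "1 + I (\<lambda>t. l * u t) \<le> ennreal (l * ((1 + r) / l))"
    using r l by (simp add: ennreal_plus[symmetric] ennreal_1[symmetric] del: ennreal_plus ennreal_1)
  then show ?thesis using pairing_le[OF assms _ l(1)] by (intro bdd_aboveI2) blast
qed

lemma pairing_le_N: "u \<in> E \<Longrightarrow> v \<in> V \<Longrightarrow> \<bar>\<integral>t. u t * v t \<partial>M\<bar> \<le> N u"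
  unfolding N_eq by (rule cSUP_upper[OF _ bdd_N])

lemma N_le: "(\<And>v. v \<in> V \<Longrightarrow> \<bar>\<integral>t. u t * v t \<partial>M\<bar> \<le> c) \<Longrightarrow> N u \<le> c"
  unfolding N_eq using V_zero by (intro cSUP_least) auto

lemma N_le_modular:
  assumes "u \<in> E" "0 < k" "1 + I (\<lambda>t. k * u t) \<le> ennreal (k * c)"
  shows "N u \<le> c"
  using pairing_le[OF assms(1) _ assms(2,3)] by (intro N_le)

lemma N_nonneg: "u \<in> E \<Longrightarrow> 0 \<le> N u"
  using pairing_le_N[OF _ V_zero, of u] by simp

lemma N_scale:
  assumes "u \<in> E" shows "N (\<lambda>t. c * u t) \<le> \<bar>c\<bar> * N u"
proof (rule N_le)
  fix v assume v: "v \<in> V"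
  have "\<bar>\<integral>t. c * u t * v t \<partial>M\<bar> = \<bar>c\<bar> * \<bar>\<integral>t. u t * v t \<partial>M\<bar>"
    by (simp add: mult.assoc abs_mult)
  also have "\<dots> \<le> \<bar>c\<bar> * N u" using pairing_le_N[OF assms v] by (intro mult_left_mono) auto
  finally show "\<bar>\<integral>t. c * u t * v t \<partial>M\<bar> \<le> \<bar>c\<bar> * N u" .
qed

lemma N_add:
  assumes "u \<in> E" "w \<in> E" shows "N (\<lambda>t. u t + w t) \<le> N u + N w"
proof (rule N_le)
  fix v assume v: "v \<in> V"
  have "\<bar>\<integral>t. (u t + w t) * v t \<partial>M\<bar> = \<bar>(\<integral>t. u t * v t \<partial>M) + (\<integral>t. w t * v t \<partial>M)\<bar>"
    using integrable_pairing[OF assms(1) V_D(1,3)[OF v]] integrable_pairing[OF assms(2) V_D(1,3)[OF v]]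
    by (simp add: distrib_right)
  also have "\<dots> \<le> N u + N w" using pairing_le_N[OF assms(1) v] pairing_le_N[OF assms(2) v] by linarith
  finally show "\<bar>\<integral>t. (u t + w t) * v t \<partial>M\<bar> \<le> N u + N w" .
qed

lemma N_zero [simp]: "N (\<lambda>t. 0) = 0"
  using N_scale[OF E_zero, of 0] N_nonneg[OF E_zero] by simp

lemma N_AE:
  assumes "u \<in> E" "AE t in M. u t = 0"
  shows "N u \<le> 0"
proof (rule N_le)
  fix v assume "v \<in> V"
  have "(\<integral>t. u t * v t \<partial>M) = (\<integral>t. 0 \<partial>M)"
    using assms measurable_E[OF assms(1)] V_D(1)[OF \<open>v \<in> V\<close>] by (intro integral_cong_AE) auto
  then show "\<bar>\<integral>t. u t * v t \<partial>M\<bar> \<le> 0" by simp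
qed

lemma sublinear_N: "sublinear_on E N"
  unfolding sublinear_on_def
proof (intro conjI ballI allI impI)
  fix c :: real and u assume c: "0 < c" and u: "u \<in> E"
  have "N (\<lambda>t. (1 / c) * (c * u t)) \<le> \<bar>1 / c\<bar> * N (\<lambda>t. c * u t)"
    by (rule N_scale[OF E_scale[OF u]])
  then show "c * N u \<le> N (\<lambda>t. c * u t)" using c by (simp add: field_simps)
qed (auto intro: N_add)

lemma N_homogeneous: "u \<in> E \<Longrightarrow> 0 \<le> c \<Longrightarrow> N (\<lambda>t. c * u t) = c * N u"
  by (rule sublinear_onD(3)[OF sublinear_N function_space_E])

text \<open>A linear functional with the one-sided bound \<open>F \<le> N\<close> also satisfies the
  absolute one, by \<open>u \<mapsto> - u\<close>. Independence of the representative follows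
  because \<open>N\<close> vanishes on null functions.\<close>

lemma support_functionalI:
  assumes x: "x \<in> E" and Nx: "0 < N x"
    and add: "\<And>u v. u \<in> E \<Longrightarrow> v \<in> E \<Longrightarrow> F (\<lambda>t. u t + v t) = F u + F v"
    and scale: "\<And>c u. u \<in> E \<Longrightarrow> F (\<lambda>t. c * u t) = c * F u"
    and le: "\<And>u. u \<in> E \<Longrightarrow> F u \<le> N u" and Fx: "N x \<le> F x"
  shows "support_functional M E N x (restrict F E)"
proof -
  have neg: "F (\<lambda>t. - u t) = - F u" if "u \<in> E" for u using scale[OF that, of "- 1"] by simp
  have Nneg: "N (\<lambda>t. - u t) \<le> N u" if "u \<in> E" for u using N_scale[OF that, of "- 1"] by simp
  have abs: "\<bar>F u\<bar> \<le> N u" if u: "u \<in> E" for u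
    using le[OF u] le[OF E_uminus[OF u]] neg[OF u] Nneg[OF u] by linarith
  have AE: "F u \<le> F v" if "u \<in> E" "v \<in> E" "AE t in M. u t = v t" for u v
  proof -
    have "F u - F v = F (\<lambda>t. u t + - v t)" using add[OF that(1) E_uminus[OF that(2)]] neg[OF that(2)] by simp
    also have "\<dots> \<le> N (\<lambda>t. u t + - v t)" by (intro le E_add that E_uminus)
    also have "\<dots> \<le> 0" using that by (intro N_AE E_add E_uminus) auto
    finally show ?thesis by simp
  qed
  have dual: "restrict F E \<in> dual_space M E N"
    unfolding dual_space_def
  proof (intro CollectI conjI ballI allI impI)
    fix u v assume uv: "u \<in> E" "v \<in> E"
    show "restrict F E u = restrict F E v" if "AE t in M. u t = v t"
    proof -
      have "AE t in M. v t = u t" using that by eventually_elim simp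
      then show ?thesis using AE[OF uv that] AE[OF uv(2,1)] uv by simp
    qed
    show "restrict F E (\<lambda>t. u t + v t) = restrict F E u + restrict F E v"
      using uv E_add[OF uv] add by simp
  next
    fix c u assume "u \<in> E"
    then show "restrict F E (\<lambda>t. c * u t) = c * restrict F E u" using E_scale scale by simp
  next
    show "\<exists>C. \<forall>u\<in>E. \<bar>restrict F E u\<bar> \<le> C * N u" using abs by (intro exI[of _ 1]) auto
  qed simp
  have "dual_norm E N (restrict F E) = 1"
    unfolding dual_norm_def
  proof (rule antisym)
    show "(SUP u\<in>{u \<in> E. N u \<le> 1}. \<bar>restrict F E u\<bar>) \<le> 1"
      using E_zero abs by (intro cSUP_least) (auto intro: order_trans)
    define y where "y = (\<lambda>t. (1 / N x) * x t)"
    have y: "y \<in> E" unfolding y_def by (rule E_scale[OF x])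
    have "N y = 1 / N x * N x" unfolding y_def using Nx by (intro N_homogeneous[OF x]) simp
    then have Ny: "N y = 1" using Nx by simp
    have "F y = F x / N x" unfolding y_def using scale[OF x, of "1 / N x"] by simp
    then have "1 \<le> F y" using Fx Nx by simp
    also have "F y \<le> \<bar>restrict F E y\<bar>" using y by simp
    also have "\<dots> \<le> (SUP u\<in>{u \<in> E. N u \<le> 1}. \<bar>restrict F E u\<bar>)"
      using y Ny abs by (intro cSUP_upper bdd_aboveI2[of _ _ 1]) (auto intro: order_trans)
    finally show "1 \<le> (SUP u\<in>{u \<in> E. N u \<le> 1}. \<bar>restrict F E u\<bar>)" .
  qed
  moreover have "restrict F E x = N x" using x le[OF x] Fx by simp
  ultimately show ?thesis using dual by (simp add: support_functional_def)
qed

lemma support_functionalD: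
  assumes "support_functional M E N x F" "x \<in> E" "u \<in> E"
  shows "F u \<le> N u" "F x = N x" "v \<in> E \<Longrightarrow> F (\<lambda>t. u t + v t) = F u + F v" "F (\<lambda>t. c * u t) = c * F u"
    "F \<in> extensional E"
proof -
  have F: "F \<in> dual_space M E N" and n1: "dual_norm E N F = 1" using assms(1) by (auto simp: support_functional_def)
  show "F x = N x" using assms(1) by (simp add: support_functional_def)
  show "F \<in> extensional E" using F unfolding dual_space_def by blast
  show "v \<in> E \<Longrightarrow> F (\<lambda>t. u t + v t) = F u + F v" using F assms(3) unfolding dual_space_def by blast
  have scale: "F (\<lambda>t. c * u t) = c * F u" for c
    using F assms(3) unfolding dual_space_def by blast
  then show "F (\<lambda>t. c * u t) = c * F u" .
  obtain C where C: "\<And>u. u \<in> E \<Longrightarrow> \<bar>F u\<bar> \<le> C * N u" using F unfolding dual_space_def by blast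
  \<comment> \<open>The real supremum in \<open>dual_norm\<close> bounds its members only if the set
    is bounded above, which membership in \<open>dual_space\<close> ensures.\<close>
  have bdd: "bdd_above ((\<lambda>u. \<bar>F u\<bar>) ` {u \<in> E. N u \<le> 1})"
  proof (rule bdd_aboveI2)
    fix w assume w: "w \<in> {u \<in> E. N u \<le> 1}"
    then have "\<bar>F w\<bar> \<le> C * N w" using C by auto
    also have "\<dots> \<le> \<bar>C\<bar> * 1" using w N_nonneg[of w] by (intro mult_mono) auto
    finally show "\<bar>F w\<bar> \<le> \<bar>C\<bar>" by simp
  qed
  show "F u \<le> N u"
  proof (cases "N u = 0")
    case True
    then show ?thesis using C[OF assms(3)] by simp
  next
    case False
    then have pos: "0 < N u" using N_nonneg[OF assms(3)] by simp
    define y where "y = (\<lambda>t. (1 / N u) * u t)"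
    have y: "y \<in> E" unfolding y_def by (rule E_scale[OF assms(3)])
    have "N y = 1 / N u * N u" unfolding y_def using pos by (intro N_homogeneous[OF assms(3)]) simp
    then have "N y \<le> 1" using pos by simp
    then have "\<bar>F y\<bar> \<le> dual_norm E N F" unfolding dual_norm_def using y bdd by (intro cSUP_upper) auto
    then have "F y \<le> 1" using n1 by simp
    then have "1 / N u * F u \<le> 1" using scale[of "1 / N u"] unfolding y_def by linarith
    then show ?thesis using pos by (simp add: field_simps)
  qed
qed

lemma support_functional_pairing:
  assumes x: "x \<in> E" and w: "w \<in> V" and pos: "0 < N x" and eq: "N x \<le> (\<integral>t. x t * w t \<partial>M)"
  shows "support_functional M E N x (\<lambda>u\<in>E. \<integral>t. u t * w t \<partial>M)"
proof (rule support_functionalI[OF x pos, where F = "\<lambda>u. \<integral>t. u t * w t \<partial>M", OF _ _ _ eq])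
  fix u v c assume u: "u \<in> E"
  show "(\<integral>t. (u t + v t) * w t \<partial>M) = (\<integral>t. u t * w t \<partial>M) + (\<integral>t. v t * w t \<partial>M)" if v: "v \<in> E"
    using integrable_pairing[OF u V_D(1,3)[OF w]] integrable_pairing[OF v V_D(1,3)[OF w]] by (simp add: distrib_right)
  show "(\<integral>t. c * u t * w t \<partial>M) = c * (\<integral>t. u t * w t \<partial>M)" by (simp add: mult.assoc)
  show "(\<integral>t. u t * w t \<partial>M) \<le> N u" using pairing_le_N[OF u w] by simp
qed

lemma N_pos_not_null:
  assumes "x \<in> E" "0 < N x" shows "\<not> (AE t in M. x t = 0)"
  using N_AE[OF assms(1)] assms(2) by auto

text \<open>The rate at which \<open>\<Phi> t\<close> tends to 0 at 0 depends on \<open>t\<close>.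
  Collecting the points where \<open>\<Phi> t (1 / (n + 1)) \<le> n\<close> inside sets of finite
  measure still exhausts the space and provides enough test functions.\<close>

lemma indicator_in_E:
  obtains S :: "nat \<Rightarrow> 'a set" where "\<And>n. S n \<in> sets M" "incseq S" "(\<Union>n. S n) = space M"
    "\<And>n. emeasure M (S n) < top" "\<And>n. indicator (S n) \<in> E"
proof -
  obtain X :: "nat \<Rightarrow> 'a set" where X: "range X \<subseteq> sets M" "(\<Union>i. X i) = space M" "\<And>i. emeasure M (X i) \<noteq> top" "incseq X"
    using sigma_finite_incseq by (metis infinity_ennreal_def)
  have [measurable]: "X n \<in> sets M" for n using X(1) by auto
  define S where "S = (\<lambda>n. {t \<in> space M. t \<in> X n \<and> \<Phi> t (ennreal (1 / (real n + 1))) \<le> of_nat n})"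
  show ?thesis
  proof (rule that)
    show [measurable]: "S n \<in> sets M" for n unfolding S_def by measurable
    show "incseq S"
    proof (rule incseq_SucI, rule subsetI)
      fix n t assume t: "t \<in> S n"
      have "\<Phi> t (ennreal (1 / (real (Suc n) + 1))) \<le> \<Phi> t (ennreal (1 / (real n + 1)))"
        by (intro young_mono[OF young] ennreal_leI) (simp add: frac_le)
      also have "\<dots> \<le> of_nat n" using t by (simp add: S_def)
      also have "\<dots> \<le> of_nat (Suc n)" by (intro of_nat_mono) simp
      finally show "t \<in> S (Suc n)" using t incseqD[OF X(4), of n "Suc n"] by (auto simp: S_def)
    qed
    show fin: "emeasure M (S n) < top" for n
    proof -
      have "emeasure M (S n) \<le> emeasure M (X n)" by (intro emeasure_mono) (auto simp: S_def)
      then show ?thesis using X(3)[of n] by (auto simp: less_top intro: le_less_trans)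
    qed
    show "(\<Union>n. S n) = space M"
    proof (intro antisym subsetI)
      fix t assume t: "t \<in> space M"
      then obtain i where i: "t \<in> X i" using X(2) by auto
      obtain d where d: "0 < d" "\<Phi> t (ennreal d) < 1" using young_small[OF young, of 1] by auto
      obtain j :: nat where j: "1 / d < real j" using reals_Archimedean2 by blast
      define n where "n = max (max i j) 1"
      have nj: "real j \<le> real n" by (simp add: n_def)
      have "1 < real j * d" using j d by (simp add: field_simps)
      also have "\<dots> \<le> (real n + 1) * d" using nj d by (intro mult_right_mono) auto
      finally have "1 / (real n + 1) \<le> d" by (simp add: pos_divide_le_eq mult.commute)
      then have "\<Phi> t (ennreal (1 / (real n + 1))) \<le> \<Phi> t (ennreal d)" by (intro young_mono[OF young] ennreal_leI)
      also have "\<dots> \<le> 1" using d by simp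
      also have "(1::ennreal) \<le> of_nat n" using of_nat_mono[of 1 n, where 'a = ennreal] by (simp add: n_def)
      finally have "\<Phi> t (ennreal (1 / (real n + 1))) \<le> of_nat n" .
      moreover have "i \<le> n" by (simp add: n_def)
      then have "t \<in> X n" using i incseqD[OF X(4)] by blast
      ultimately show "t \<in> (\<Union>n. S n)" using t by (auto simp: S_def)
    qed (auto simp: S_def)
    show "indicator (S n) \<in> E" for n
    proof (rule E_I)
      show "0 < 1 / (real n + 1)" by simp
      have "I (\<lambda>t. 1 / (real n + 1) * indicator (S n) t) \<le> (\<integral>\<^sup>+t. of_nat n * indicator (S n) t \<partial>M)"
        unfolding modular_def
        by (intro nn_integral_mono) (auto simp: indicator_def S_def young_zero[OF young])
      also have "\<dots> < top" using fin[of n] by (simp add: nn_integral_cmult_indicator ennreal_mult_less_top of_nat_less_top)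
      finally show "I (\<lambda>t. 1 / (real n + 1) * indicator (S n) t) < top" .
    qed measurable
  qed
qed

text \<open>Testing the two integral functionals on \<open>sgn (w1 - w2)\<close> over each
  \<open>S n\<close> turns their equality into the vanishing of the integral of
  \<open>\<bar>w1 - w2\<bar>\<close> there.\<close>

lemma not_smooth_if_two:
  assumes x: "x \<in> E" and w: "w1 \<in> V" "w2 \<in> V" and pos: "0 < N x"
    and eq: "N x \<le> (\<integral>t. x t * w1 t \<partial>M)" "N x \<le> (\<integral>t. x t * w2 t \<partial>M)"
    and ne: "\<not> (AE t in M. w1 t = w2 t)"
  shows "\<not> smooth_space M E N"
proof
  assume "smooth_space M E N"
  then have "\<exists>!F. support_functional M E N x F"
    using x N_pos_not_null[OF x pos] by (auto simp: smooth_space_def smooth_point_def)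
  then have F: "(\<lambda>u\<in>E. \<integral>t. u t * w1 t \<partial>M) = (\<lambda>u\<in>E. \<integral>t. u t * w2 t \<partial>M)"
    using support_functional_pairing[OF x w(1) pos eq(1)] support_functional_pairing[OF x w(2) pos eq(2)] by blast
  note [measurable] = V_D(1)[OF w(1)] V_D(1)[OF w(2)]
  obtain S :: "nat \<Rightarrow> 'a set" where S: "\<And>n. S n \<in> sets M" "(\<Union>n. S n) = space M" "\<And>n. indicator (S n) \<in> E"
    using indicator_in_E by metis
  note [measurable] = S(1)
  have "AE t in M. t \<in> S n \<longrightarrow> w1 t = w2 t" for n
  proof -
    define h where "h = (\<lambda>t. sgn (w1 t - w2 t) * indicator (S n) t)"
    have h: "h \<in> E" unfolding h_def by (rule E_abs_le[OF S(3)[of n]]) (auto simp: indicator_def sgn_if)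
    have "(\<integral>t. h t * w1 t \<partial>M) = (\<integral>t. h t * w2 t \<partial>M)" using fun_cong[OF F, of h] h by simp
    then have "(\<integral>t. h t * w1 t - h t * w2 t \<partial>M) = 0"
      using integrable_pairing[OF h V_D(1,3)[OF w(1)]] integrable_pairing[OF h V_D(1,3)[OF w(2)]] by simp
    moreover have "h t * w1 t - h t * w2 t = \<bar>w1 t - w2 t\<bar> * indicator (S n) t" for t
      by (auto simp: h_def sgn_if indicator_def)
    ultimately have "(\<integral>t. \<bar>w1 t - w2 t\<bar> * indicator (S n) t \<partial>M) = 0" by simp
    moreover have "integrable M (\<lambda>t. \<bar>w1 t - w2 t\<bar> * indicator (S n) t)"
      using integrable_pairing[OF h V_D(1,3)[OF w(1)]] integrable_pairing[OF h V_D(1,3)[OF w(2)]]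
        \<open>\<And>t. h t * w1 t - h t * w2 t = \<bar>w1 t - w2 t\<bar> * indicator (S n) t\<close>
      by (metis (no_types, lifting) Bochner_Integration.integrable_cong Bochner_Integration.integrable_diff)
    ultimately have "AE t in M. \<bar>w1 t - w2 t\<bar> * indicator (S n) t = 0"
      by (subst (asm) integral_nonneg_eq_0_iff_AE) auto
    then show ?thesis by eventually_elim (auto simp: indicator_def)
  qed
  then have "AE t in M. \<forall>n. t \<in> S n \<longrightarrow> w1 t = w2 t" unfolding AE_all_countable by blast
  then have "AE t in M. w1 t = w2 t" using AE_space by eventually_elim (use S(2) in auto)
  then show False using ne by simp
qed

subsection \<open>The Amemiya formula\<close>

text \<open>By biconjugation the integrand of \<open>I (k y)\<close> is the supremum of \<open>g t (vn n t)\<close>, where \<open>vn n t\<close>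
  is the best among the first \<open>n\<close> rational arguments.\<close>

lemma modular_le_dual:
  assumes y: "y \<in> E" and k: "0 \<le> k"
    and le: "\<And>v. v \<in> borel_measurable M \<Longrightarrow> (\<And>t. 0 \<le> v t) \<Longrightarrow> J v < top \<Longrightarrow>
       ennreal (k * (\<integral>t. \<bar>y t\<bar> * v t \<partial>M)) \<le> R + J v"
  shows "I (\<lambda>t. k * y t) \<le> R"
proof -
  note [measurable] = measurable_E[OF y]
  define g where "g = (\<lambda>t v. ennreal (k * \<bar>y t\<bar> * v) - \<Psi> t (ennreal v))"
  \<comment> \<open>A running choice: the rational \<open>qseq n\<close> replaces the current
    argument only if it strictly increases \<open>g\<close>. Starting from 0, every choice is
    measurable and has finite conjugate.\<close>
  define vn where "vn = rec_nat (\<lambda>t. 0) (\<lambda>n v t. if g t (v t) < g t (qseq n) then qseq n else v t)"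
  have vn0: "vn 0 = (\<lambda>t. 0)" and vnS: "vn (Suc n) = (\<lambda>t. if g t (vn n t) < g t (qseq n) then qseq n else vn n t)" for n
    unfolding vn_def by simp_all
  have gm[measurable]: "(\<lambda>t. g t (v t)) \<in> borel_measurable M" if [measurable]: "v \<in> borel_measurable M" for v
    unfolding g_def by measurable
  have vm[measurable]: "vn n \<in> borel_measurable M" for n by (induction n) (simp_all add: vn0 vnS)
  have vnn: "0 \<le> vn n t" for n t by (induction n) (simp_all add: vn0 vnS)
  have inc: "g t (vn n t) \<le> g t (vn (Suc n) t)" for n t by (auto simp: vnS)
  have ge: "g t (qseq n) \<le> g t (vn (Suc n) t)" for n t by (auto simp: vnS)
  have fin: "\<Psi> t (ennreal (vn n t)) < top" for n t
  proof (induction n)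
    case (Suc n)
    have "\<Psi> t (ennreal (qseq n)) < top" if "g t (vn n t) < g t (qseq n)"
    proof (rule ccontr)
      assume "\<not> ?thesis"
      then have "g t (qseq n) = 0" by (simp add: g_def less_top[symmetric])
      then show False using that by simp
    qed
    then show ?case using Suc by (simp add: vnS)
  qed (simp add: vn0)
  have sup: "\<Phi> t (ennreal \<bar>k * y t\<bar>) = (SUP n. g t (vn n t))" for t
  proof -
    have "\<Phi> t (ennreal \<bar>k * y t\<bar>) = (SUP i. g t (qseq i))"
      using young_biconjugate[OF young, of "\<bar>k * y t\<bar>" t] k by (simp add: g_def abs_mult)
    also have "\<dots> = (SUP n. g t (vn n t))"
    proof (rule antisym)
      show "(SUP i. g t (qseq i)) \<le> (SUP n. g t (vn n t))"
        using ge by (intro SUP_least) (meson SUP_upper2 UNIV_I)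
      have "\<exists>i. g t (vn n t) \<le> g t (qseq i)" for n
      proof (induction n)
        case 0
        show ?case by (simp add: vn0 g_def)
      next
        case (Suc n)
        then show ?case by (auto simp: vnS)
      qed
      then show "(SUP n. g t (vn n t)) \<le> (SUP i. g t (qseq i))"
        by (intro SUP_least) (meson SUP_upper2 UNIV_I)
    qed
    finally show ?thesis .
  qed
  obtain X :: "nat \<Rightarrow> 'a set" where X: "range X \<subseteq> sets M" "(\<Union>i. X i) = space M" "\<And>i. emeasure M (X i) \<noteq> top" "incseq X"
    using sigma_finite_incseq by (metis infinity_ennreal_def)
  have [measurable]: "X n \<in> sets M" for n using X(1) by auto
  have part: "(\<integral>\<^sup>+t. g t (vn n t) \<partial>M) \<le> R" for n
  proof -
    \<comment> \<open>On \<open>S m\<close> the conjugate is bounded and the measure finite, so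
      \<open>J v\<close> is finite and can be cancelled. Positivity of \<open>g\<close> excludes
      truncation in the difference, which makes Young's estimate below an equality.\<close>
    define S where "S = (\<lambda>m. {t \<in> space M. t \<in> X m \<and> 0 < g t (vn n t) \<and> \<Psi> t (ennreal (vn n t)) \<le> of_nat m})"
    have Sm[measurable]: "S m \<in> sets M" for m unfolding S_def by measurable
    show ?thesis
    proof (rule nn_integral_exhaust_le[where S = S])
      show "incseq S"
      proof (rule incseq_SucI, rule subsetI)
        fix m t assume t: "t \<in> S m"
        have "(of_nat m :: ennreal) \<le> of_nat (Suc m)" by (intro of_nat_mono) simp
        then show "t \<in> S (Suc m)" using t incseqD[OF X(4), of m "Suc m"] by (auto simp: S_def intro: order_trans)
      qed
      show "\<exists>m. t \<in> S m" if t: "t \<in> space M" "0 < g t (vn n t)" for t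
      proof -
        obtain i where i: "t \<in> X i" using X(2) t by auto
        obtain j :: nat where j: "\<Psi> t (ennreal (vn n t)) < of_nat j" using ennreal_Ex_less_of_nat[OF fin] by auto
        have "(of_nat j :: ennreal) \<le> of_nat (max i j)" by (intro of_nat_mono) simp
        then have "\<Psi> t (ennreal (vn n t)) \<le> of_nat (max i j)" using j by (rule order_trans[OF less_imp_le, rotated])
        then show ?thesis using t i incseqD[OF X(4), of i "max i j"] by (intro exI[of _ "max i j"]) (auto simp: S_def)
      qed
      fix m
      define v where "v = (\<lambda>t. vn n t * indicator (S m) t)"
      have v[measurable]: "v \<in> borel_measurable M" unfolding v_def by measurable
      have vn: "0 \<le> v t" for t using vnn[of n t] by (simp add: v_def)
      have "J v \<le> (\<integral>\<^sup>+t. of_nat m * indicator (X m) t \<partial>M)"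
        unfolding J_def using vnn by (intro nn_integral_mono) (auto simp: v_def indicator_def S_def)
      also have "\<dots> < top" using X(3)[of m] by (simp add: nn_integral_cmult_indicator ennreal_mult_less_top of_nat_less_top less_top)
      finally have J: "J v < top" .
      have eq: "ennreal (k * (\<bar>y t\<bar> * v t)) = g t (vn n t) * indicator (S m) t + \<Psi> t (ennreal \<bar>v t\<bar>)" for t
      proof (cases "t \<in> S m")
        case True
        then have "0 < ennreal (k * \<bar>y t\<bar> * vn n t) - \<Psi> t (ennreal (vn n t))" by (simp add: S_def g_def)
        then have "\<Psi> t (ennreal (vn n t)) \<le> ennreal (k * \<bar>y t\<bar> * vn n t)"
          by (simp add: diff_gt_0_iff_gt_ennreal)
        then have "ennreal (k * \<bar>y t\<bar> * vn n t) = g t (vn n t) + \<Psi> t (ennreal (vn n t))"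
          unfolding g_def by (metis add.commute add_diff_inverse_ennreal)
        then show ?thesis using True vnn by (simp add: v_def mult.assoc)
      qed (simp add: v_def)
      have int: "integrable M (\<lambda>t. \<bar>y t\<bar> * v t)" by (rule integrable_pairing[OF E_abs[OF y] v J])
      have "(\<integral>\<^sup>+t\<in>S m. g t (vn n t) \<partial>M) + J v = (\<integral>\<^sup>+t. g t (vn n t) * indicator (S m) t + \<Psi> t (ennreal \<bar>v t\<bar>) \<partial>M)"
        unfolding J_def by (rule nn_integral_add[symmetric]) measurable
      also have "\<dots> = (\<integral>\<^sup>+t. ennreal (k * (\<bar>y t\<bar> * v t)) \<partial>M)" by (simp add: eq)
      also have "\<dots> = ennreal (\<integral>t. k * (\<bar>y t\<bar> * v t) \<partial>M)"
        using int k vn by (intro nn_integral_eq_integral) auto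
      also have "\<dots> = ennreal (k * (\<integral>t. \<bar>y t\<bar> * v t \<partial>M))" by simp
      also have "\<dots> \<le> R + J v" by (rule le[OF v vn J])
      finally have "J v + (\<integral>\<^sup>+t\<in>S m. g t (vn n t) \<partial>M) \<le> J v + R" by (simp only: add.commute)
      then show "(\<integral>\<^sup>+t\<in>S m. g t (vn n t) \<partial>M) \<le> R" using J by (auto simp: ennreal_add_left_cancel_le)
    qed measurable
  qed
  have "I (\<lambda>t. k * y t) = (\<integral>\<^sup>+t. (SUP n. g t (vn n t)) \<partial>M)" by (simp add: modular_def sup)
  also have "\<dots> = (SUP n. \<integral>\<^sup>+t. g t (vn n t) \<partial>M)"
    using inc by (intro nn_integral_monotone_convergence_SUP incseq_SucI) (auto simp: le_fun_def)
  also have "\<dots> \<le> R" by (rule SUP_least) (rule part)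
  finally show ?thesis .
qed

text \<open>The value \<open>sup {\<integral>\<bar>y\<bar>v | J v \<le> s}\<close> is concave in \<open>s\<close>; the multiplier \<open>l\<close> below is a
  supergradient of it at \<open>s = 1\<close>.\<close>

lemma amemiya:
  assumes y: "y \<in> E" and c: "\<And>k. 0 < k \<Longrightarrow> ennreal (k * c) \<le> 1 + I (\<lambda>t. k * y t)"
  shows "c \<le> N y"
proof -
  note [measurable] = measurable_E[OF y]
  define L where "L = N y"
  define W where "W = {v \<in> borel_measurable M. (\<forall>t. 0 \<le> v t) \<and> J v < top}"
  define a where "a = (\<lambda>v. \<integral>t. \<bar>y t\<bar> * v t \<partial>M)"
  define j where "j = (\<lambda>v. enn2real (J v))"
  have Jj: "J v = ennreal (j v)" if "v \<in> W" for v using that by (simp add: W_def j_def ennreal_enn2real)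
  have jnn: "0 \<le> j v" for v by (simp add: j_def)
  have L0: "0 \<le> L" unfolding L_def by (rule N_nonneg[OF y])
  have int: "integrable M (\<lambda>t. \<bar>y t\<bar> * v t)" if "v \<in> W" for v
    using that by (intro integrable_pairing E_abs y) (auto simp: W_def)
  have ball: "a v \<le> L" if v: "v \<in> W" "j v \<le> 1" for v
  proof -
    have [measurable]: "v \<in> borel_measurable M" using v by (simp add: W_def)
    have "J (\<lambda>t. sgn (y t) * v t) \<le> J v" by (rule J_mono) (auto simp: sgn_if)
    also have "\<dots> \<le> 1" using v Jj by (simp add: ennreal_le_1)
    finally have "(\<lambda>t. sgn (y t) * v t) \<in> V" by (simp add: V_def)
    then have "\<bar>\<integral>t. y t * (sgn (y t) * v t) \<partial>M\<bar> \<le> L" unfolding L_def by (rule pairing_le_N[OF y])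
    moreover have "(\<lambda>t. y t * (sgn (y t) * v t)) = (\<lambda>t. \<bar>y t\<bar> * v t)" by (auto simp: fun_eq_iff sgn_if)
    ultimately show ?thesis by (simp add: a_def)
  qed
  \<comment> \<open>Concavity across the level 1: the weight \<open>\<alpha>\<close> is chosen so
    that the convex combination of \<open>v2\<close> (inside) and \<open>v1\<close> (outside) has
    \<open>j\<close> at most exactly 1, where \<open>ball\<close> applies.\<close>
  have key: "(1 - j v2) * (a v1 - L) \<le> (j v1 - 1) * (L - a v2)"
    if v: "v1 \<in> W" "v2 \<in> W" "1 < j v1" "j v2 < 1" for v1 v2
  proof -
    define \<alpha> where "\<alpha> = (1 - j v2) / (j v1 - j v2)"
    have \<alpha>: "0 \<le> \<alpha>" "\<alpha> \<le> 1" "\<alpha> * (j v1 - j v2) = 1 - j v2" using v by (auto simp: \<alpha>_def)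
    define w where "w = (\<lambda>t. (1 - \<alpha>) * v2 t + \<alpha> * v1 t)"
    have [measurable]: "v1 \<in> borel_measurable M" "v2 \<in> borel_measurable M" using v by (auto simp: W_def)
    have nn: "0 \<le> v1 t" "0 \<le> v2 t" for t using v by (auto simp: W_def)
    have wnn: "0 \<le> w t" for t using nn[of t] \<alpha> by (simp add: w_def)
    have "J w \<le> (\<integral>\<^sup>+t. ennreal (1 - \<alpha>) * \<Psi> t (ennreal \<bar>v2 t\<bar>) + ennreal \<alpha> * \<Psi> t (ennreal \<bar>v1 t\<bar>) \<partial>M)"
      unfolding J_def using conjugate_convex[OF young nn(2) nn(1) \<alpha>(1,2)] nn wnn
      by (intro nn_integral_mono) (simp add: w_def)
    also have "\<dots> = ennreal (1 - \<alpha>) * J v2 + ennreal \<alpha> * J v1"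
      unfolding J_def by (subst nn_integral_add) (auto simp: nn_integral_cmult)
    also have "\<dots> = ennreal ((1 - \<alpha>) * j v2 + \<alpha> * j v1)"
      using Jj[OF v(1)] Jj[OF v(2)] \<alpha> jnn by (simp add: ennreal_mult)
    also have "(1 - \<alpha>) * j v2 + \<alpha> * j v1 = 1" using \<alpha>(3) by (simp add: algebra_simps)
    finally have "J w \<le> 1" by simp
    then have w: "w \<in> W" using wnn by (auto simp: W_def w_def intro: le_less_trans[OF _ ennreal_one_less_top])
    have "a w \<le> L" using w \<open>J w \<le> 1\<close> by (intro ball) (auto simp: j_def intro: enn2real_leI)
    moreover have "a w = (1 - \<alpha>) * a v2 + \<alpha> * a v1"
    proof -
      have "a w = (\<integral>t. (1 - \<alpha>) * (\<bar>y t\<bar> * v2 t) + \<alpha> * (\<bar>y t\<bar> * v1 t) \<partial>M)"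
        by (simp add: a_def w_def algebra_simps)
      then show ?thesis using int[OF v(1)] int[OF v(2)] by (simp add: a_def)
    qed
    ultimately have "\<alpha> * (a v1 - a v2) \<le> L - a v2" by (simp add: algebra_simps)
    then have "(j v1 - j v2) * (\<alpha> * (a v1 - a v2)) \<le> (j v1 - j v2) * (L - a v2)"
      using v by (intro mult_left_mono) auto
    moreover have "(j v1 - j v2) * (\<alpha> * (a v1 - a v2)) = (1 - j v2) * (a v1 - a v2)"
      using \<alpha>(3) by (metis mult.assoc mult.commute)
    ultimately show ?thesis by (simp add: algebra_simps)
  qed
  have W0: "(\<lambda>t. 0) \<in> W" by (simp add: W_def)
  have j0: "j (\<lambda>t. 0) = 0" and a0: "a (\<lambda>t. 0) = 0" by (simp_all add: j_def a_def)
  \<comment> \<open>The element 0 makes \<open>l\<close> nonnegative and the supremum meaningful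
    when no \<open>v\<close> has \<open>j v > 1\<close>.\<close>
  define Q where "Q = insert 0 ((\<lambda>v. (a v - L) / (j v - 1)) ` {v \<in> W. 1 < j v})"
  define l where "l = Sup Q"
  have "bdd_above Q"
  proof (rule bdd_aboveI)
    fix q assume "q \<in> Q"
    then consider "q = 0" | v where "v \<in> W" "1 < j v" "q = (a v - L) / (j v - 1)" by (auto simp: Q_def)
    then show "q \<le> L"
    proof cases
      case 2
      have "a v - L \<le> L * (j v - 1)" using key[OF 2(1) W0 2(2)] j0 a0 by (simp add: mult.commute)
      then show ?thesis using 2 by (simp add: pos_divide_le_eq)
    qed (simp add: L0)
  qed
  then have lge: "q \<le> l" if "q \<in> Q" for q unfolding l_def using that by (intro cSup_upper)
  have l0: "0 \<le> l" by (rule lge) (simp add: Q_def)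
  have main: "a v \<le> L + l * (j v - 1)" if v: "v \<in> W" for v
  proof -
    consider "1 < j v" | "j v = 1" | "j v < 1" by linarith
    then show ?thesis
    proof cases
      case 1
      have "(a v - L) / (j v - 1) \<le> l" using v 1 by (intro lge) (auto simp: Q_def)
      then show ?thesis using 1 by (simp add: field_simps)
    next
      case 2
      then show ?thesis using ball[OF v] by simp
    next
      case 3
      have "l \<le> (L - a v) / (1 - j v)"
        unfolding l_def
      proof (rule cSup_least)
        fix q assume "q \<in> Q"
        then consider "q = 0" | w where "w \<in> W" "1 < j w" "q = (a w - L) / (j w - 1)" by (auto simp: Q_def)
        then show "q \<le> (L - a v) / (1 - j v)"
        proof cases
          case 1
          then show ?thesis using ball[OF v] 3 by simp
        next
          case 2
          have "(a w - L) * (1 - j v) / (j w - 1) \<le> L - a v"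
            using key[OF 2(1) v 2(2) 3] 2(2) by (simp add: pos_divide_le_eq mult.commute)
          then have "q * (1 - j v) \<le> L - a v" by (simp add: 2(3))
          then show ?thesis using 3 by (simp add: pos_le_divide_eq)
        qed
      qed (simp add: Q_def)
      then show ?thesis using 3 by (simp add: field_simps)
    qed
  qed
  show ?thesis
  proof (cases "l = 0")
    case False
    \<comment> \<open>Dividing the supergradient inequality by \<open>l\<close> bounds
      \<open>k a v - j v\<close> by \<open>k L - 1\<close>, so this \<open>k\<close> attains the
      infimum in the formula.\<close>
    define k where "k = 1 / l"
    have k: "0 < k" "k * l = 1" using False l0 by (auto simp: k_def)
    have le: "k * a v \<le> (k * L - 1) + j v" if "v \<in> W" for v
    proof -
      have "k * a v \<le> k * (L + l * (j v - 1))" using main[OF that] k by (intro mult_left_mono) auto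
      also have "\<dots> = k * L + (k * l) * (j v - 1)" by (simp add: algebra_simps)
      finally show ?thesis using k by simp
    qed
    have R0: "0 \<le> k * L - 1" using le[OF W0] j0 a0 by simp
    have "I (\<lambda>t. k * y t) \<le> ennreal (k * L - 1)"
    proof (rule modular_le_dual[OF y])
      fix v assume "v \<in> borel_measurable M" "\<And>t. 0 \<le> v t" "J v < top"
      then have v: "v \<in> W" by (simp add: W_def)
      have "ennreal (k * a v) \<le> ennreal ((k * L - 1) + j v)" by (rule ennreal_leI[OF le[OF v]])
      then show "ennreal (k * (\<integral>t. \<bar>y t\<bar> * v t \<partial>M)) \<le> ennreal (k * L - 1) + J v"
        using R0 jnn Jj[OF v] by (simp add: a_def)
    qed (use k in simp)
    then have "ennreal (k * c) \<le> 1 + ennreal (k * L - 1)" using c[OF k(1)] add_left_mono order_trans by blast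
    also have "\<dots> = ennreal (k * L)" using R0 by (simp add: ennreal_plus[symmetric] ennreal_1[symmetric] del: ennreal_plus ennreal_1)
    finally have "k * c \<le> k * L" using R0 by simp
    then show ?thesis using k by (simp add: L_def)
  next
    case True
    \<comment> \<open>With multiplier 0 the bound \<open>a v \<le> L\<close> holds without any
      constraint on \<open>j v\<close>; the infimum is then approached as \<open>k\<close> tends to
      infinity, with error \<open>1 / k\<close>.\<close>
    have "k * c \<le> 1 + k * L" if k: "0 < k" for k
    proof -
      have "I (\<lambda>t. k * y t) \<le> ennreal (k * L)"
      proof (rule modular_le_dual[OF y])
        fix v assume "v \<in> borel_measurable M" "\<And>t. 0 \<le> v t" "J v < top"
        then have v: "v \<in> W" by (simp add: W_def)
        have "k * a v \<le> k * L + j v" using main[OF v] True k jnn[of v] by (simp add: add_increasing2)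
        then have "ennreal (k * a v) \<le> ennreal (k * L + j v)" by (rule ennreal_leI)
        then show "ennreal (k * (\<integral>t. \<bar>y t\<bar> * v t \<partial>M)) \<le> ennreal (k * L) + J v"
          using L0 k jnn Jj[OF v] by (simp add: a_def)
      qed (use k in simp)
      then have "ennreal (k * c) \<le> 1 + ennreal (k * L)" using c[OF k] add_left_mono order_trans by blast
      also have "\<dots> = ennreal (1 + k * L)" using L0 k by (simp add: ennreal_plus[symmetric] ennreal_1[symmetric] del: ennreal_plus ennreal_1)
      finally show ?thesis using L0 k by (subst (asm) ennreal_le_iff) auto
    qed
    then have "c \<le> L + e" if "0 < e" for e
      using that by (auto simp: field_simps dest: spec[of _ "1 / e"] meta_spec[of _ "1 / e"])
    then have "c \<le> L" by (rule field_le_epsilon)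
    then show ?thesis by (simp add: L_def)
  qed
qed

end

subsection \<open>The conjugate at its endpoint\<close>

lemma non_atomic_split:
  assumes "non_atomic M" "A \<in> sets M" "0 < emeasure M A"
  obtains B where "B \<in> sets M" "B \<subseteq> A" "0 < emeasure M B" "0 < emeasure M (A - B)"
proof -
  obtain B where B: "B \<in> sets M" "B \<subseteq> A" "0 < emeasure M B" "emeasure M B < emeasure M A"
    using assms unfolding non_atomic_def by blast
  have "emeasure M B + emeasure M (A - B) = emeasure M A"
    using B assms by (subst plus_emeasure) (auto intro!: arg_cong[where f = "emeasure M"])
  then have "emeasure M (A - B) \<noteq> 0" using B(4) by auto
  then show ?thesis using that B by (auto simp: zero_less_iff_neq_zero)
qed

lemma incseq_positive_measure:
  assumes "A \<in> sets M" "0 < emeasure M A" "\<And>n::nat. S n \<in> sets M" "A \<subseteq> (\<Union>n. S n)"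
  obtains n where "0 < emeasure M (A \<inter> S n)"
proof (rule ccontr)
  note witness = that
  assume no: "\<not> thesis"
  have "A \<inter> S n \<in> null_sets M" for n
  proof -
    have "\<not> 0 < emeasure M (A \<inter> S n)" using no witness by blast
    then show ?thesis using assms by auto
  qed
  then have "(\<Union>n. A \<inter> S n) \<in> null_sets M" by (rule null_sets_UN)
  also have "(\<Union>n. A \<inter> S n) = A" using assms(4) by auto
  finally show False using assms(2) by auto
qed

context young_family
begin

lemma not_AE_positive:
  assumes [measurable]: "Measurable.pred M P" and "\<not> (AE t in M. P t)"
  shows "0 < emeasure M {t \<in> space M. \<not> P t}"
proof -
  have "emeasure M {t \<in> space M. \<not> P t} \<noteq> 0"
    using assms(2) by (subst (asm) AE_iff_measurable[OF _ refl]) auto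
  then show ?thesis by (simp add: zero_less_iff_neq_zero)
qed

definition "b t = Sup {v. \<Psi> t v < top}"

lemma b_eq: "b t = (SUP i. if \<Psi> t (ennreal (qseq i)) < top then ennreal (qseq i) else 0)"
proof (rule antisym)
  show "b t \<le> (SUP i. if \<Psi> t (ennreal (qseq i)) < top then ennreal (qseq i) else 0)"
    unfolding b_def
  proof (rule Sup_least, rule dense_le)
    fix v c assume v: "v \<in> {v. \<Psi> t v < top}" and "c < v"
    then obtain i where i: "c < ennreal (qseq i)" "ennreal (qseq i) < v" using qseq_dense_ennreal by blast
    then have "\<Psi> t (ennreal (qseq i)) < top" using v le_less_trans[OF conjugate_mono[of "ennreal (qseq i)" v "\<Phi> t"]] by auto
    then show "c \<le> (SUP i. if \<Psi> t (ennreal (qseq i)) < top then ennreal (qseq i) else 0)"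
      using i by (intro SUP_upper2[of i]) auto
  qed
  show "(SUP i. if \<Psi> t (ennreal (qseq i)) < top then ennreal (qseq i) else 0) \<le> b t"
    unfolding b_def by (intro SUP_least) (auto intro: Sup_upper)
qed

lemma measurable_b[measurable]: "b \<in> borel_measurable M"
  unfolding b_eq[abs_def] by measurable

lemma le_b: "\<Psi> t v < top \<Longrightarrow> v \<le> b t"
  unfolding b_def by (auto intro: Sup_upper)

lemma b_pos: "0 < b t"
proof -
  obtain d where "0 < d" "\<Psi> t (ennreal d) < top" using conjugate_finite[OF young] by blast
  then have "0 < ennreal d" "ennreal d \<le> b t" using le_b by auto
  then show ?thesis by (rule less_le_trans)
qed

lemma smooth_imp_conjugate_infinite:
  assumes na: "non_atomic M" and smooth: "smooth_space M E N"
  shows "AE t in M. \<Psi> t (b t) = top"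
proof (rule ccontr)
  assume "\<not> (AE t in M. \<Psi> t (b t) = top)"
  then have pos: "0 < emeasure M {t \<in> space M. \<not> \<Psi> t (b t) = top}"
    by (intro not_AE_positive) auto
  define A where "A = {t \<in> space M. \<not> \<Psi> t (b t) = top}"
  have [measurable]: "A \<in> sets M" unfolding A_def by measurable
  obtain S :: "nat \<Rightarrow> 'a set" where S: "\<And>n. S n \<in> sets M" "(\<Union>n. S n) = space M" "\<And>n. indicator (S n) \<in> E"
    using indicator_in_E by metis
  note [measurable] = S(1)
  obtain n where n: "0 < emeasure M (A \<inter> S n)"
    using incseq_positive_measure[of A M S] pos S by (auto simp: A_def)
  define D where "D = A \<inter> S n"
  have [measurable]: "D \<in> sets M" unfolding D_def by measurable
  have fin: "\<Psi> t (b t) < top" "b t < top" if "t \<in> D" for t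
  proof -
    show 1: "\<Psi> t (b t) < top" using that by (auto simp: D_def A_def less_top)
    show "b t < top"
    proof (rule ccontr)
      assume "\<not> ?thesis"
      then have "b t = top" by (simp add: less_top[symmetric])
      then show False using 1 conjugate_top[OF young] by simp
    qed
  qed
  \<comment> \<open>The summand 1 in the integrand makes its integral over \<open>D\<close> at least
    the measure of \<open>D\<close>, so the positive value \<open>c\<close> is available and the
    chosen \<open>B\<close> is not null. The bound \<open>c \<le> 1\<close> puts \<open>w C\<close>
    into \<open>V\<close>.\<close>
  define c where "c = min 1 (emeasure M D)"
  have c: "0 < c" "c \<le> 1" using n by (auto simp: c_def D_def)
  have "c \<le> (\<integral>\<^sup>+t. indicator D t \<partial>M)" by (simp add: c_def)
  also have "\<dots> \<le> (\<integral>\<^sup>+t\<in>D. (\<Psi> t (b t) + 1) \<partial>M)" by (intro nn_integral_mono) (auto simp: indicator_def)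
  finally have cD: "c \<le> (\<integral>\<^sup>+t\<in>D. (\<Psi> t (b t) + 1) \<partial>M)" .
  have ctop: "c < top" using c(2) ennreal_one_less_top by (rule le_less_trans)
  obtain B where B[measurable]: "B \<in> sets M" and BD: "B \<subseteq> D" and Bc: "(\<integral>\<^sup>+t\<in>B. (\<Psi> t (b t) + 1) \<partial>M) = c"
    using fin by (rule_tac exact_integral[OF na \<open>D \<in> sets M\<close> _ _ cD ctop]) auto
  have "emeasure M B \<noteq> 0"
  proof
    assume "emeasure M B = 0"
    then have "B \<in> null_sets M" by auto
    then have "(\<integral>\<^sup>+t\<in>B. (\<Psi> t (b t) + 1) \<partial>M) = 0" by (rule nn_integral_null_set)
    then show False using Bc c by simp
  qed
  then obtain B0 where B0[measurable]: "B0 \<in> sets M" and B0B: "B0 \<subseteq> B" and B0p: "0 < emeasure M B0" and B1p: "0 < emeasure M (B - B0)"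
    using non_atomic_split[OF na B] by (auto simp: zero_less_iff_neq_zero)
  define w where "w = (\<lambda>C t. enn2real (b t) * indicator C t :: real)"
  have [measurable]: "w C \<in> borel_measurable M" if [measurable]: "C \<in> sets M" for C unfolding w_def by measurable
  have wV: "w C \<in> V" if [measurable]: "C \<in> sets M" and "C \<subseteq> B" for C
  proof -
    have "J (w C) \<le> (\<integral>\<^sup>+t\<in>B. (\<Psi> t (b t) + 1) \<partial>M)"
      unfolding J_def
    proof (rule nn_integral_mono)
      fix t
      show "\<Psi> t (ennreal \<bar>w C t\<bar>) \<le> (\<Psi> t (b t) + 1) * indicator B t"
        using fin[of t] BD that(2) by (auto simp: w_def indicator_def ennreal_enn2real subset_eq)
    qed
    then show ?thesis using Bc c that by (simp add: V_def)
  qed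
  \<comment> \<open>Since \<open>x\<close> lives on \<open>B0\<close>, it cannot distinguish
    \<open>w B0\<close> from \<open>w B\<close>, which differ on the non-null set
    \<open>B - B0\<close>.\<close>
  define x where "x = (indicator B0 :: 'a \<Rightarrow> real)"
  have x: "x \<in> E"
    by (rule E_abs_le[OF S(3)[of n]]) (use B0B BD in \<open>auto simp: x_def indicator_def D_def\<close>)
  have xw: "x t * w B t = x t * w B0 t" for t using B0B by (auto simp: x_def w_def indicator_def)
  have bpos: "0 < enn2real (b t)" if "t \<in> B" for t
    using fin(2)[of t] b_pos[of t] BD that by (simp add: enn2real_positive_iff subset_eq)
  have int: "integrable M (\<lambda>t. x t * w B0 t)" using wV[OF B0 B0B] x V_D by (intro integrable_pairing) auto
  have Nle: "N x \<le> (\<integral>t. x t * w B0 t \<partial>M)"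
  proof (rule N_le)
    fix v assume v: "v \<in> V"
    note [measurable] = V_D(1)[OF v]
    \<comment> \<open>Finiteness of the conjugate modular alone forces
      \<open>\<bar>v t\<bar> \<le> b t\<close>, so \<open>b\<close> is the best competitor on
      \<open>B0\<close>.\<close>
    have "AE t in M. \<Psi> t (ennreal \<bar>v t\<bar>) \<noteq> \<infinity>"
      using V_D(3)[OF v] unfolding J_def by (intro nn_integral_PInf_AE) auto
    then have AE: "AE t in M. \<bar>x t * v t\<bar> \<le> x t * w B0 t"
    proof eventually_elim
      case (elim t)
      then have "ennreal \<bar>v t\<bar> \<le> b t" by (intro le_b) (simp add: less_top)
      then have "\<bar>v t\<bar> \<le> enn2real (b t)" if "t \<in> B0"
        using fin(2)[of t] that B0B BD by (metis abs_ge_zero enn2real_ennreal enn2real_mono subsetD)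
      then show ?case by (auto simp: x_def w_def indicator_def)
    qed
    have "\<bar>\<integral>t. x t * v t \<partial>M\<bar> \<le> (\<integral>t. \<bar>x t * v t\<bar> \<partial>M)" by (rule integral_abs_bound)
    also have "\<dots> \<le> (\<integral>t. x t * w B0 t \<partial>M)"
      using integrable_pairing[OF x V_D(1,3)[OF v]] int AE by (intro integral_mono_AE) auto
    finally show "\<bar>\<integral>t. x t * v t \<partial>M\<bar> \<le> (\<integral>t. x t * w B0 t \<partial>M)" .
  qed
  have nonneg: "0 \<le> x t * w B0 t" for t by (simp add: x_def w_def)
  have "(\<integral>t. x t * w B0 t \<partial>M) \<noteq> 0"
  proof
    assume "(\<integral>t. x t * w B0 t \<partial>M) = 0"
    then have "AE t in M. x t * w B0 t = 0" using int nonneg by (subst (asm) integral_nonneg_eq_0_iff_AE) auto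
    then have "AE t in M. t \<notin> B0"
    proof eventually_elim
      case (elim t)
      then show ?case using bpos[of t] B0B by (auto simp: x_def w_def)
    qed
    then show False using B0p by (auto simp: AE_iff_null_sets[OF B0, symmetric])
  qed
  moreover have "0 \<le> (\<integral>t. x t * w B0 t \<partial>M)" using nonneg by simp
  ultimately have "0 < (\<integral>t. x t * w B0 t \<partial>M)" by simp
  also have "\<dots> \<le> N x" using pairing_le_N[OF x wV[OF B0 B0B]] by simp
  finally have Npos: "0 < N x" .
  have "\<not> (AE t in M. w B0 t = w B t)"
  proof
    assume "AE t in M. w B0 t = w B t"
    then have "AE t in M. t \<notin> B - B0"
    proof eventually_elim
      case (elim t)
      then show ?case using bpos[of t] by (auto simp: w_def indicator_def split: if_splits)
    qed
    then have "B - B0 \<in> null_sets M" by (subst AE_iff_null_sets) auto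
    then show False using B1p by auto
  qed
  then have "\<not> smooth_space M E N"
    using not_smooth_if_two[OF x wV[OF B0 B0B] wV[OF B order_refl] Npos Nle] Nle xw by simp
  then show False using smooth by simp
qed

end

subsection \<open>One-sided derivatives of the norm\<close>

text \<open>\<open>d\<close> is the right derivative of \<open>p\<close> at \<open>x\<close>, an
  infimum of quotients that increase with \<open>s\<close>; hence steps \<open>s \<le> 1\<close>
  suffice for lower bounds. Linear functionals below \<open>d\<close> are below \<open>p\<close>
  and, by \<open>d (- x) \<le> - p x\<close>, reach \<open>p x\<close> at \<open>x\<close>.\<close>

lemma directional_derivative:
  assumes E: "function_space E" and p: "sublinear_on E p" and x: "x \<in> E"
  obtains d where "sublinear_on E d" "\<And>u. u \<in> E \<Longrightarrow> d u \<le> p u" "d (\<lambda>t. - x t) \<le> - p x"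
    "\<And>u c. u \<in> E \<Longrightarrow> (\<And>s. 0 < s \<Longrightarrow> s \<le> 1 \<Longrightarrow> c \<le> (p (\<lambda>t. x t + s * u t) - p x) / s) \<Longrightarrow> c \<le> d u"
proof
  define g where "g = (\<lambda>u s. (p (\<lambda>t. x t + s * u t) - p x) / s)"
  define d where "d = (\<lambda>u. INF s\<in>{0<..}. g u s)"
  note ED = function_spaceD[OF E]
  have hom: "p (\<lambda>t. c * u t) = c * p u" if "0 \<le> c" "u \<in> E" for c u
    using sublinear_onD(3)[OF p E that(2,1)] .
  have sub: "p (\<lambda>t. u t + v t) \<le> p u + p v" if "u \<in> E" "v \<in> E" for u v
    using sublinear_onD(2)[OF p E that] .
  have lb: "- p (\<lambda>t. - u t) \<le> g u s" if "u \<in> E" "0 < s" for u s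
  proof -
    have "p x = p (\<lambda>t. (x t + s * u t) + s * - u t)" by simp
    also have "\<dots> \<le> p (\<lambda>t. x t + s * u t) + p (\<lambda>t. s * - u t)"
      by (intro sub ED(2) ED(3) ED(4) x that)
    also have "p (\<lambda>t. s * - u t) = s * p (\<lambda>t. - u t)" using that by (intro hom ED) auto
    finally show ?thesis using that by (simp add: g_def field_simps)
  qed
  have bdd: "bdd_below (g u ` {0<..})" if "u \<in> E" for u using lb[OF that] by (intro bdd_belowI2) auto
  have dle: "d u \<le> g u s" if "u \<in> E" "0 < s" for u s
    unfolding d_def using bdd that by (intro cINF_lower) auto
  have dge: "c \<le> d u" if "\<And>s. 0 < s \<Longrightarrow> c \<le> g u s" for c u
    unfolding d_def using that by (intro cINF_greatest) auto
  have mono: "g u s \<le> g u r" if "u \<in> E" "0 < s" "s \<le> r" for u s r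
  proof -
    define l where "l = s / r"
    have l: "0 \<le> l" "l \<le> 1" "l * r = s" using that by (auto simp: l_def)
    have eq: "(\<lambda>t. x t + s * u t) = (\<lambda>t. (1 - l) * x t + l * (x t + r * u t))"
      using l by (simp add: fun_eq_iff algebra_simps)
    have "p (\<lambda>t. x t + s * u t) \<le> p (\<lambda>t. (1 - l) * x t) + p (\<lambda>t. l * (x t + r * u t))"
      unfolding eq by (intro sub ED(2) ED(3) x that)
    also have "\<dots> = (1 - l) * p x + l * p (\<lambda>t. x t + r * u t)"
      using l by (subst (1 2) hom) (auto intro!: ED x that)
    finally have "p (\<lambda>t. x t + s * u t) - p x \<le> l * (p (\<lambda>t. x t + r * u t) - p x)" by (simp add: algebra_simps)
    also have "\<dots> = s * g u r" using that by (simp add: g_def l_def)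
    finally have "(p (\<lambda>t. x t + s * u t) - p x) / s \<le> g u r" using that by (simp add: pos_divide_le_eq mult.commute)
    then show ?thesis by (simp add: g_def)
  qed
  show "d u \<le> p u" if "u \<in> E" for u
    using dle[OF that, of 1] sub[OF x that] by (simp add: g_def)
  show "d (\<lambda>t. - x t) \<le> - p x"
    using dle[OF ED(4)[OF x], of 1] sublinear_onD(1)[OF p E x] by (simp add: g_def)
  show "c \<le> d u" if u: "u \<in> E" and c: "\<And>s. 0 < s \<Longrightarrow> s \<le> 1 \<Longrightarrow> c \<le> (p (\<lambda>t. x t + s * u t) - p x) / s" for u c
  proof (rule dge)
    fix s :: real assume s: "0 < s"
    have "c \<le> g u (min s 1)" unfolding g_def using s by (intro c) auto
    also have "\<dots> \<le> g u s" using s by (intro mono u) auto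
    finally show "c \<le> g u s" .
  qed
  show "sublinear_on E d"
    unfolding sublinear_on_def
  proof (intro conjI ballI allI impI)
    have "g (\<lambda>t. 0) s = 0" for s by (simp add: g_def)
    then show "d (\<lambda>t. 0) = 0" using dle[OF ED(1), of 1] dge[of 0 "\<lambda>t. 0"] by (intro antisym) auto
    fix u assume u: "u \<in> E"
    show "d (\<lambda>t. u t + v t) \<le> d u + d v" if v: "v \<in> E" for v
    proof -
      have *: "d (\<lambda>t. u t + v t) \<le> g u s + g v r" if "0 < s" "0 < r" for s r
      proof -
        define m where "m = min s r"
        have m: "0 < m" "m \<le> s" "m \<le> r" using that by (auto simp: m_def)
        \<comment> \<open>The step is halved because \<open>x + m/2 (u + v)\<close> is the midpoint
          of \<open>x + m u\<close> and \<open>x + m v\<close>.\<close>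
        have "d (\<lambda>t. u t + v t) \<le> g (\<lambda>t. u t + v t) (m / 2)" using m by (intro dle ED u v) auto
        also have "\<dots> \<le> g u m + g v m"
        proof -
          have eq: "(\<lambda>t. x t + m / 2 * (u t + v t)) = (\<lambda>t. 1 / 2 * (x t + m * u t) + 1 / 2 * (x t + m * v t))"
            by (simp add: fun_eq_iff field_simps)
          have "p (\<lambda>t. x t + m / 2 * (u t + v t)) \<le> p (\<lambda>t. 1 / 2 * (x t + m * u t)) + p (\<lambda>t. 1 / 2 * (x t + m * v t))"
            unfolding eq by (intro sub ED(2) ED(3) x u v)
          also have "\<dots> = 1 / 2 * p (\<lambda>t. x t + m * u t) + 1 / 2 * p (\<lambda>t. x t + m * v t)"
            by (subst (1 2) hom) (auto intro!: ED x u v)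
          finally have "p (\<lambda>t. x t + m / 2 * (u t + v t)) - p x
              \<le> (p (\<lambda>t. x t + m * u t) - p x + (p (\<lambda>t. x t + m * v t) - p x)) / 2" by (simp add: field_simps)
          then have "(p (\<lambda>t. x t + m / 2 * (u t + v t)) - p x) / (m / 2)
              \<le> (p (\<lambda>t. x t + m * u t) - p x + (p (\<lambda>t. x t + m * v t) - p x)) / 2 / (m / 2)"
            using m by (intro divide_right_mono) auto
          also have "\<dots> = g u m + g v m" using m(1) by (simp add: g_def field_simps)
          finally show ?thesis by (simp add: g_def)
        qed
        also have "\<dots> \<le> g u s + g v r" using m by (intro add_mono mono u v) auto
        finally show ?thesis .
      qed
      have "d (\<lambda>t. u t + v t) - g v r \<le> d u" if "0 < r" for r
        using *[OF _ that] by (intro dge) (simp add: algebra_simps)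
      then have "d (\<lambda>t. u t + v t) - d u \<le> d v" by (intro dge) (simp add: algebra_simps)
      then show ?thesis by simp
    qed
    fix c :: real assume c: "0 < c"
    show "c * d u \<le> d (\<lambda>t. c * u t)"
    proof (rule dge)
      fix s :: real assume s: "0 < s"
      have "c * d u \<le> c * g u (s * c)" using dle[OF u, of "s * c"] s c by simp
      also have "\<dots> = g (\<lambda>t. c * u t) s" using c s by (simp add: g_def mult.assoc)
      finally show "c * d u \<le> g (\<lambda>t. c * u t) s" .
    qed
  qed
qed

text \<open>Convexity bounds the increase up to \<open>(1 - 2 \<delta>) y\<close> by a chord ending
  at \<open>(1 - \<delta>) y\<close>. The chord is longer than \<open>\<delta> y\<close>, up to
  equality, whence the factor \<open>1 / \<delta>\<close>.\<close>

lemma young_increment: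
  assumes "young \<phi>" "0 \<le> y" "0 \<le> \<alpha>" "\<alpha> \<le> \<beta>" "\<beta> \<le> 1" "0 < \<delta>" "2 * \<delta> < 1"
  shows "\<phi> (ennreal (\<beta> * ((1 - 2 * \<delta>) * y)))
     \<le> \<phi> (ennreal (\<alpha> * ((1 - 2 * \<delta>) * y))) + ennreal (\<beta> - \<alpha>) * (ennreal (1 / \<delta>) * \<phi> (ennreal ((1 - \<delta>) * y)))"
proof -
  define \<kappa> where "\<kappa> = 1 - 2 * \<delta>"
  define D where "D = (1 - \<delta>) - \<alpha> * \<kappa>"
  have \<kappa>: "0 < \<kappa>" "\<kappa> \<le> 1" using assms by (auto simp: \<kappa>_def)
  have "\<alpha> * \<kappa> \<le> 1 * \<kappa>" using assms \<kappa> by (intro mult_right_mono) auto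
  then have D: "\<delta> \<le> D" by (simp add: D_def \<kappa>_def)
  define l where "l = (\<beta> - \<alpha>) * \<kappa> / D"
  have lD: "l * D = (\<beta> - \<alpha>) * \<kappa>" using D assms by (simp add: l_def)
  have "\<beta> * \<kappa> \<le> 1 * \<kappa>" using assms \<kappa> by (intro mult_right_mono) auto
  then have "(\<beta> - \<alpha>) * \<kappa> \<le> D" using assms by (simp add: D_def \<kappa>_def algebra_simps)
  then have l: "0 \<le> l" "l \<le> 1" using assms \<kappa> D by (auto simp: l_def)
  have l2: "l \<le> (\<beta> - \<alpha>) * (1 / \<delta>)"
    unfolding l_def using assms \<kappa> D mult_left_mono[of \<kappa> 1 "\<beta> - \<alpha>"] by (simp, intro frac_le) auto
  have eq: "(1 - l) * (\<alpha> * (\<kappa> * y)) + l * ((1 - \<delta>) * y) = \<beta> * (\<kappa> * y)"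
  proof -
    have "(1 - l) * (\<alpha> * (\<kappa> * y)) + l * ((1 - \<delta>) * y) = \<alpha> * (\<kappa> * y) + (l * D) * y"
      by (simp add: D_def algebra_simps)
    also have "\<dots> = \<beta> * (\<kappa> * y)" unfolding lD by (simp add: algebra_simps)
    finally show ?thesis .
  qed
  have "\<phi> (ennreal (\<beta> * (\<kappa> * y))) \<le> ennreal (1 - l) * \<phi> (ennreal (\<alpha> * (\<kappa> * y))) + ennreal l * \<phi> (ennreal ((1 - \<delta>) * y))"
    unfolding eq[symmetric] using assms \<kappa> l by (intro young_convex) auto
  also have "\<dots> \<le> 1 * \<phi> (ennreal (\<alpha> * (\<kappa> * y))) + ennreal ((\<beta> - \<alpha>) * (1 / \<delta>)) * \<phi> (ennreal ((1 - \<delta>) * y))"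
    using l l2 by (intro add_mono mult_right_mono ennreal_leI) (auto simp: ennreal_le_1)
  also have "ennreal ((\<beta> - \<alpha>) * (1 / \<delta>)) = ennreal (\<beta> - \<alpha>) * ennreal (1 / \<delta>)"
    using assms by (intro ennreal_mult) auto
  finally show ?thesis unfolding \<kappa>_def[symmetric] by (simp add: mult.assoc)
qed

lemma suminf_eventually_ge_one:
  fixes a :: "nat \<Rightarrow> ennreal"
  assumes "\<And>n. n0 \<le> n \<Longrightarrow> 1 \<le> a n"
  shows "(\<Sum>n. a n) = top"
proof (rule ccontr)
  assume "(\<Sum>n. a n) \<noteq> top"
  then obtain k :: nat where k: "(\<Sum>n. a n) < of_nat k" using ennreal_Ex_less_of_nat by (auto simp: less_top)
  have "(of_nat k :: ennreal) = (\<Sum>n\<in>{n0..<n0 + k}. 1)" by simp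
  also have "\<dots> \<le> (\<Sum>n\<in>{n0..<n0 + k}. a n)" using assms by (intro sum_mono) auto
  also have "\<dots> \<le> (\<Sum>n. a n)" by (intro sum_le_suminf) auto
  finally show False using k by simp
qed

context young_family
begin

text \<open>Scaling \<open>x\<close> down changes the modular at rate at most \<open>1/4\<close>,
  while scaling up makes it infinite on either half, so \<open>k = 1\<close> is optimal and
  \<open>N x = 1 + I x\<close>. Enlarging \<open>x\<close> on \<open>B\<close> then forces
  \<open>k\<close> down and raises the norm at rate at least \<open>3/4\<close>, but shrinking
  \<open>x\<close> on \<open>B\<close> lowers it at rate at most \<open>1/4\<close>.\<close>

lemma not_smooth_if_singular:
  assumes [measurable]: "x \<in> borel_measurable M" "\<sigma> \<in> borel_measurable M" "B \<in> sets M" and xnn: "\<And>t. 0 \<le> x t"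
    and \<sigma>: "(\<integral>\<^sup>+t. \<sigma> t \<partial>M) \<le> ennreal (1 / 4)"
    and incr: "\<And>t \<alpha> \<beta>. 0 \<le> \<alpha> \<Longrightarrow> \<alpha> \<le> \<beta> \<Longrightarrow> \<beta> \<le> 1 \<Longrightarrow>
        \<Phi> t (ennreal (\<beta> * x t)) \<le> \<Phi> t (ennreal (\<alpha> * x t)) + ennreal (\<beta> - \<alpha>) * \<sigma> t"
    and inf1: "\<And>l. 1 < l \<Longrightarrow> (\<integral>\<^sup>+t\<in>B. \<Phi> t (ennreal (l * x t)) \<partial>M) = top"
    and inf2: "\<And>l. 1 < l \<Longrightarrow> (\<integral>\<^sup>+t\<in>space M - B. \<Phi> t (ennreal (l * x t)) \<partial>M) = top"
  shows "\<not> smooth_space M E N"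
proof
  assume smooth: "smooth_space M E N"
  \<comment> \<open>The scaling factor may depend on \<open>t\<close>; only its distance from 1
    enters.\<close>
  have incrI: "I x \<le> I u + ennreal c * ennreal (1 / 4)"
    if [measurable]: "u \<in> borel_measurable M" and c: "0 \<le> c"
      and u: "\<And>t. t \<in> space M \<Longrightarrow> \<exists>\<alpha>\<ge>0. \<alpha> \<le> 1 \<and> 1 - \<alpha> \<le> c \<and> \<alpha> * x t \<le> \<bar>u t\<bar>" for u c
  proof -
    have "I x \<le> (\<integral>\<^sup>+t. \<Phi> t (ennreal \<bar>u t\<bar>) + ennreal c * \<sigma> t \<partial>M)"
      unfolding modular_def
    proof (rule nn_integral_mono)
      fix t assume "t \<in> space M"
      then obtain \<alpha> where \<alpha>: "0 \<le> \<alpha>" "\<alpha> \<le> 1" "1 - \<alpha> \<le> c" "\<alpha> * x t \<le> \<bar>u t\<bar>" using u by blast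
      have "\<Phi> t (ennreal \<bar>x t\<bar>) \<le> \<Phi> t (ennreal (\<alpha> * x t)) + ennreal (1 - \<alpha>) * \<sigma> t"
        using incr[of \<alpha> 1 t] \<alpha> xnn by simp
      also have "\<dots> \<le> \<Phi> t (ennreal \<bar>u t\<bar>) + ennreal c * \<sigma> t"
        using \<alpha> by (intro add_mono young_mono[OF young] ennreal_leI mult_right_mono) auto
      finally show "\<Phi> t (ennreal \<bar>x t\<bar>) \<le> \<Phi> t (ennreal \<bar>u t\<bar>) + ennreal c * \<sigma> t" .
    qed
    also have "\<dots> = I u + ennreal c * (\<integral>\<^sup>+t. \<sigma> t \<partial>M)"
      unfolding modular_def by (subst nn_integral_add) (auto simp: nn_integral_cmult)
    also have "\<dots> \<le> I u + ennreal c * ennreal (1 / 4)" using \<sigma> by (intro add_mono mult_left_mono) auto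
    finally show ?thesis .
  qed
  have "I x \<le> I (\<lambda>t. 0) + ennreal 1 * ennreal (1 / 4)"
    by (rule incrI) (auto intro: exI[of _ 0])
  also have "I (\<lambda>t. 0) = 0" using young by (simp add: modular_def)
  finally have Ix: "I x \<le> ennreal (1 / 4)" by simp
  then obtain r where r: "I x = ennreal r" "0 \<le> r"
    using le_less_trans[OF Ix ennreal_less_top] by (auto simp: less_top_ennreal)
  have x: "x \<in> E" using Ix by (intro E_I[of x 1]) (auto intro: le_less_trans)
  have Nx: "N x \<le> 1 + r"
    using r by (intro N_le_modular[OF x, of 1]) (auto simp: ennreal_plus[symmetric] ennreal_1[symmetric] simp del: ennreal_plus ennreal_1)
  have step: "ennreal (k * c) \<le> 1 + I u"
    if [measurable]: "u \<in> borel_measurable M" and a: "0 \<le> a" and kc: "k * c \<le> 1 + r - a / 4"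
      and u: "\<And>t. t \<in> space M \<Longrightarrow> \<exists>\<alpha>\<ge>0. \<alpha> \<le> 1 \<and> 1 - \<alpha> \<le> a \<and> \<alpha> * x t \<le> \<bar>u t\<bar>" for k c a u
  proof (cases "I u = top")
    case False
    then obtain i where i: "I u = ennreal i" "0 \<le> i" by (metis less_top less_top_ennreal)
    have "ennreal r \<le> ennreal (i + a * (1 / 4))"
      using incrI[OF that(1) a u] i a unfolding r(1) by (simp add: ennreal_mult[symmetric] ennreal_plus[symmetric] del: ennreal_plus)
    then have "r \<le> i + a / 4" using i a by (subst (asm) ennreal_le_iff) auto
    then have "k * c \<le> 1 + i" using kc by simp
    then have "ennreal (k * c) \<le> ennreal (1 + i)" by (rule ennreal_leI)
    then show ?thesis using i by (simp add: ennreal_plus[symmetric] ennreal_1[symmetric] del: ennreal_plus ennreal_1)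
  qed simp
  define h where "h = (\<lambda>t. x t * indicator B t)"
  have h: "h \<in> E" unfolding h_def by (rule E_abs_le[OF x]) (auto simp: indicator_def)
  have hm[measurable]: "h \<in> borel_measurable M" by (rule measurable_E[OF h])
  \<comment> \<open>If \<open>k (1 + s) > 1\<close>, the modular is infinite on \<open>B\<close>.
    Otherwise \<open>k \<le> 1\<close>, the modular loses at most \<open>(1 - k) / 4\<close>, and
    \<open>k (1 + s) \<le> 1\<close> multiplied by \<open>3/4 + r\<close> gives the bound.\<close>
  have plus: "1 + r + s * (3 / 4) \<le> N (\<lambda>t. x t + s * h t)" if s: "0 \<le> s" for s
  proof (rule amemiya)
    show "(\<lambda>t. x t + s * h t) \<in> E" by (intro E_add E_scale x h)
    fix k :: real assume k: "0 < k"
    show "ennreal (k * (1 + r + s * (3 / 4))) \<le> 1 + I (\<lambda>t. k * (x t + s * h t))"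
    proof (cases "1 < k * (1 + s)")
      case True
      have "top = (\<integral>\<^sup>+t\<in>B. \<Phi> t (ennreal (k * (1 + s) * x t)) \<partial>M)" using inf1[OF True] by simp
      also have "\<dots> \<le> I (\<lambda>t. k * (x t + s * h t))"
        unfolding modular_def using k s xnn
        by (intro nn_integral_mono) (auto simp: indicator_def h_def algebra_simps)
      finally show ?thesis by (simp add: top_unique)
    next
      case False
      have "k \<le> k * (1 + s)" using k s by simp
      then have k1: "k \<le> 1" using False by simp
      have "(3 / 4 + r) * (k * (1 + s)) \<le> (3 / 4 + r) * 1" using False r by (intro mult_left_mono) auto
      moreover have "0 \<le> r * (k * s)" using r k s by simp
      ultimately have "k * (1 + r + s * (3 / 4)) \<le> 1 + r - (1 - k) / 4" by (simp add: field_simps)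
      then show ?thesis
      proof (rule step[rotated 2])
        fix t
        have "k * x t \<le> \<bar>k * (x t + s * h t)\<bar>" using k s xnn[of t] by (simp add: h_def indicator_def)
        then show "\<exists>\<alpha>\<ge>0. \<alpha> \<le> 1 \<and> 1 - \<alpha> \<le> 1 - k \<and> \<alpha> * x t \<le> \<bar>k * (x t + s * h t)\<bar>"
          using k k1 by (intro exI[of _ k]) auto
      qed (use k1 in auto)
    qed
  qed
  \<comment> \<open>Off \<open>B\<close> the perturbation vanishes, so \<open>k > 1\<close> again
    gives an infinite modular. For \<open>k \<le> 1\<close> the factor is \<open>k\<close> off
    \<open>B\<close> and \<open>k - k s\<close> on \<open>B\<close>.\<close>
  have minus: "1 + r - s / 4 \<le> N (\<lambda>t. x t + s * - h t)" if s: "0 \<le> s" "s \<le> 1" for s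
  proof (rule amemiya)
    show "(\<lambda>t. x t + s * - h t) \<in> E" by (intro E_add E_scale E_uminus x h)
    fix k :: real assume k: "0 < k"
    show "ennreal (k * (1 + r - s / 4)) \<le> 1 + I (\<lambda>t. k * (x t + s * - h t))"
    proof (cases "1 < k")
      case True
      have "top = (\<integral>\<^sup>+t\<in>space M - B. \<Phi> t (ennreal (k * x t)) \<partial>M)" using inf2[OF True] by simp
      also have "\<dots> \<le> I (\<lambda>t. k * (x t + s * - h t))"
        unfolding modular_def using k s xnn
        by (intro nn_integral_mono) (auto simp: indicator_def h_def)
      finally show ?thesis by (simp add: top_unique)
    next
      case False
      have ks: "0 \<le> k * s" "k * s \<le> k" using k s by auto
      have "(3 / 4 + r) * k \<le> (3 / 4 + r) * 1" using False r by (intro mult_left_mono) auto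
      then have "k * (1 + r - s / 4) \<le> 1 + r - (1 - k + k * s) / 4" by (simp add: field_simps)
      then show ?thesis
      proof (rule step[rotated 2])
        fix t
        show "\<exists>\<alpha>\<ge>0. \<alpha> \<le> 1 \<and> 1 - \<alpha> \<le> 1 - k + k * s \<and> \<alpha> * x t \<le> \<bar>k * (x t + s * - h t)\<bar>"
        proof (cases "t \<in> B")
          case True
          then show ?thesis using k ks False xnn[of t]
            by (intro exI[of _ "k - k * s"]) (auto simp: h_def algebra_simps)
        next
          case outside: False
          then show ?thesis using k ks False xnn[of t] by (intro exI[of _ k]) (auto simp: h_def)
        qed
      qed (use ks False in auto)
    qed
  qed
  have Nx': "1 + r \<le> N x" using minus[of 0] by simp
  obtain d where d: "sublinear_on E d" "\<And>u. u \<in> E \<Longrightarrow> d u \<le> N u" "d (\<lambda>t. - x t) \<le> - N x"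
    "\<And>u c. u \<in> E \<Longrightarrow> (\<And>s. 0 < s \<Longrightarrow> s \<le> 1 \<Longrightarrow> c \<le> (N (\<lambda>t. x t + s * u t) - N x) / s) \<Longrightarrow> c \<le> d u"
    using directional_derivative[OF function_space_E sublinear_N x] by blast
  have dh: "3 / 4 \<le> d h" 
  proof (rule d(4)[OF h])
    fix s :: real assume s: "0 < s" "s \<le> 1"
    have "s * (3 / 4) \<le> N (\<lambda>t. x t + s * h t) - N x" using plus[of s] s Nx by linarith
    then show "3 / 4 \<le> (N (\<lambda>t. x t + s * h t) - N x) / s" using s by (simp add: pos_le_divide_eq)
  qed
  have dh': "- 1 / 4 \<le> d (\<lambda>t. - h t)" 
  proof (rule d(4)[OF E_uminus[OF h]])
    fix s :: real assume s: "0 < s" "s \<le> 1"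
    have "- s / 4 \<le> N (\<lambda>t. x t + s * - h t) - N x" using minus[of s] s Nx by linarith
    then show "- 1 / 4 \<le> (N (\<lambda>t. x t + s * - h t) - N x) / s" using s by (simp add: pos_le_divide_eq)
  qed
  have supp: "support_functional M E N x (restrict F E)"
    if F: "\<And>u v. u \<in> E \<Longrightarrow> v \<in> E \<Longrightarrow> F (\<lambda>t. u t + v t) = F u + F v"
      "\<And>c u. u \<in> E \<Longrightarrow> F (\<lambda>t. c * u t) = c * F u" "\<And>u. u \<in> E \<Longrightarrow> F u \<le> d u" for F
  proof (rule support_functionalI[OF x _ F(1,2)])
    show "0 < N x" using Nx' r by simp
    show "F u \<le> N u" if "u \<in> E" for u using F(3)[OF that] d(2)[OF that] by simp
    have "F (\<lambda>t. - x t) = - F x" using F(2)[OF x, of "- 1"] by simp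
    then show "N x \<le> F x" using F(3)[OF E_uminus[OF x]] d(3) by simp
  qed
  \<comment> \<open>\<open>F\<close> attains the derivative in direction \<open>h\<close>,
    \<open>G\<close> the one in direction \<open>- h\<close>: \<open>F h \<ge> 3/4\<close> but
    \<open>G h \<le> 1/4\<close>.\<close>
  obtain F where F: "\<And>u v. u \<in> E \<Longrightarrow> v \<in> E \<Longrightarrow> F (\<lambda>t. u t + v t) = F u + F v"
      "\<And>c u. u \<in> E \<Longrightarrow> F (\<lambda>t. c * u t) = c * F u" "\<And>u. u \<in> E \<Longrightarrow> F u \<le> d u" "F h = d h"
    using hahn_banach[OF function_space_E d(1) h] by blast
  obtain G where G: "\<And>u v. u \<in> E \<Longrightarrow> v \<in> E \<Longrightarrow> G (\<lambda>t. u t + v t) = G u + G v"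
      "\<And>c u. u \<in> E \<Longrightarrow> G (\<lambda>t. c * u t) = c * G u" "\<And>u. u \<in> E \<Longrightarrow> G u \<le> d u" "G (\<lambda>t. - h t) = d (\<lambda>t. - h t)"
    using hahn_banach[OF function_space_E d(1) E_uminus[OF h]] by blast
  have "G h \<le> 1 / 4" using G(2)[OF h, of "- 1"] G(4) dh' by simp
  moreover have "restrict F E = restrict G E"
  proof -
    have "\<exists>!F. support_functional M E N x F"
      using smooth x N_pos_not_null[OF x] Nx' r by (auto simp: smooth_space_def smooth_point_def)
    then show ?thesis using supp[OF F(1-3)] supp[OF G(1-3)] by blast
  qed
  then have "F h = G h" using h by (metis restrict_apply)
  ultimately show False using F(4) dh by simp
qed

end

text \<open>The integrand may be infinite, so it is truncated at a level where its integral over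
  \<open>A\<close> still exceeds 2; a part with truncated integral exactly 1 then leaves more than 1
  for the rest.\<close>

lemma (in sigma_finite_measure) infinite_integral_split:
  assumes na: "non_atomic M" and A: "A \<in> sets M" and f[measurable]: "f \<in> borel_measurable M"
    and inf: "(\<integral>\<^sup>+t\<in>A. f t \<partial>M) = top"
  obtains B where "B \<in> sets M" "B \<subseteq> A" "1 \<le> (\<integral>\<^sup>+t\<in>B. f t \<partial>M)" "1 \<le> (\<integral>\<^sup>+t\<in>A - B. f t \<partial>M)"
proof -
  note [measurable] = A
  have "(\<integral>\<^sup>+t\<in>A. f t \<partial>M) = (\<integral>\<^sup>+t. (SUP m::nat. min (f t) (of_nat m) * indicator A t) \<partial>M)"
  proof (intro nn_integral_cong)
    fix t
    have "(SUP m::nat. min (f t) (of_nat m)) = f t"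
    proof (rule antisym[OF SUP_least])
      show "f t \<le> (SUP m::nat. min (f t) (of_nat m))"
      proof (rule dense_le)
        fix c assume c: "c < f t"
        then obtain m :: nat where "c < of_nat m" using ennreal_Ex_less_of_nat[of c] by (metis le_less_trans less_top not_less_iff_gr_or_eq top_greatest order_less_le)
        then show "c \<le> (SUP m::nat. min (f t) (of_nat m))" using c by (intro SUP_upper2[of m]) auto
      qed
    qed auto
    then show "f t * indicator A t = (SUP m::nat. min (f t) (of_nat m) * indicator A t)"
      by (cases "t \<in> A") auto
  qed
  also have "\<dots> = (SUP m::nat. \<integral>\<^sup>+t\<in>A. min (f t) (of_nat m) \<partial>M)"
  proof (rule nn_integral_monotone_convergence_SUP)
    have "min (f t) (of_nat m) \<le> min (f t) (of_nat n)" if "m \<le> n" for t and m n :: nat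
      using of_nat_mono[OF that, where 'a = ennreal] by (simp add: min_le_iff_disj min.coboundedI2)
    then show "incseq (\<lambda>m t. min (f t) (of_nat m) * indicator A t)"
      by (auto simp: incseq_def le_fun_def intro: mult_right_mono)
  qed measurable
  finally have "2 < (SUP m::nat. \<integral>\<^sup>+t\<in>A. min (f t) (of_nat m) \<partial>M)" using inf by simp
  then obtain m :: nat where m: "2 < (\<integral>\<^sup>+t\<in>A. min (f t) (of_nat m) \<partial>M)" by (auto simp: less_SUP_iff)
  define g where "g = (\<lambda>t. min (f t) (of_nat m))"
  have [measurable]: "g \<in> borel_measurable M" unfolding g_def by measurable
  have gfin: "g t < top" for t unfolding g_def by (auto simp: min_less_iff_disj of_nat_less_top)
  have "(1::ennreal) \<le> 2" by simp
  then have "1 \<le> (\<integral>\<^sup>+t\<in>A. g t \<partial>M)" using m unfolding g_def by (meson less_imp_le order_trans)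
  then obtain B where B[measurable]: "B \<in> sets M" and BA: "B \<subseteq> A" and Bg: "(\<integral>\<^sup>+t\<in>B. g t \<partial>M) = 1"
    using gfin by (rule_tac exact_integral[OF na A, of g 1]) auto
  have gf: "(\<integral>\<^sup>+t\<in>C. g t \<partial>M) \<le> (\<integral>\<^sup>+t\<in>C. f t \<partial>M)" for C
    by (intro nn_integral_mono mult_right_mono) (auto simp: g_def)
  have "(\<integral>\<^sup>+t\<in>A. g t \<partial>M) = (\<integral>\<^sup>+t\<in>B. g t \<partial>M) + (\<integral>\<^sup>+t\<in>A - B. g t \<partial>M)"
    using BA by (subst nn_integral_add[symmetric]) (auto intro!: nn_integral_cong simp: indicator_def)
  then have "1 + 1 < 1 + (\<integral>\<^sup>+t\<in>A - B. g t \<partial>M)" using m Bg by (simp add: g_def)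
  then have "1 \<le> (\<integral>\<^sup>+t\<in>A - B. g t \<partial>M)"
    by (metis add_left_mono leI less_imp_le linorder_not_less)
  then show ?thesis using that[OF B BA] Bg gf[of B] gf[of "A - B"] by simp
qed

context young_family
begin

lemma smooth_imp_doubling:
  assumes na: "non_atomic M" and smooth: "smooth_space M E N"
    and u[measurable]: "u \<in> borel_measurable M" and unn: "\<And>t. 0 \<le> u t" and fin: "I u < top"
  shows "I (\<lambda>t. 2 * u t) < top"
proof (rule ccontr)
  assume no: "\<not> ?thesis"
  \<comment> \<open>At the critical multiple \<open>k0\<close> the modular of \<open>k z\<close> is
    finite for \<open>0 \<le> k < 1\<close> and infinite for \<open>k > 1\<close>; its value at
    \<open>k = 1\<close> remains open, which is why \<open>x\<close> is later kept strictly below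
    \<open>z\<close>.\<close>
  define K where "K = {k. 0 \<le> k \<and> I (\<lambda>t. k * u t) < top}"
  define k0 where "k0 = Sup K"
  have Kmono: "I (\<lambda>t. k * u t) \<le> I (\<lambda>t. l * u t)" if "0 \<le> k" "k \<le> l" for k l
    using that unn by (intro I_mono) (auto simp: abs_mult intro!: mult_right_mono)
  have K2: "k \<le> 2" if "k \<in> K" for k
  proof (rule ccontr)
    assume "\<not> ?thesis"
    then have "I (\<lambda>t. 2 * u t) \<le> I (\<lambda>t. k * u t)" by (intro Kmono) auto
    then show False using no that by (auto simp: K_def)
  qed
  have bddK: "bdd_above K" using K2 by (rule bdd_aboveI)
  have 1: "1 \<in> K" using fin by (simp add: K_def)
  have k01: "1 \<le> k0" unfolding k0_def using 1 bddK by (rule cSup_upper)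
  define z where "z = (\<lambda>t. k0 * u t)"
  have z[measurable]: "z \<in> borel_measurable M" unfolding z_def by measurable
  have znn: "0 \<le> z t" for t using unn k01 by (simp add: z_def)
  define T where "T = (\<lambda>A k. \<integral>\<^sup>+t\<in>A. \<Phi> t (ennreal (k * z t)) \<partial>M)"
  have Tsp: "T (space M) k = I (\<lambda>t. (k * k0) * u t)" if "0 \<le> k" for k
    using that znn k01 unn unfolding T_def modular_def
    by (intro nn_integral_cong) (auto simp: z_def abs_mult mult.assoc)
  have Tlt: "T (space M) k < top" if k: "0 \<le> k" "k < 1" for k
  proof -
    have "k * k0 < k0" using k k01 by simp
    then obtain l where l: "l \<in> K" "k * k0 < l" unfolding k0_def using 1 by (metis less_cSupE empty_iff)
    have "I (\<lambda>t. (k * k0) * u t) \<le> I (\<lambda>t. l * u t)" using l k k01 by (intro Kmono) auto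
    then show ?thesis using l Tsp[OF k(1)] by (auto simp: K_def)
  qed
  have Ttop: "T (space M) k = top" if k: "1 < k" for k
  proof (rule ccontr)
    assume "\<not> ?thesis"
    then have "k * k0 \<in> K" using Tsp[of k] k k01 by (auto simp: K_def less_top)
    then have "k * k0 \<le> k0" unfolding k0_def using bddK by (rule cSup_upper)
    then show False using k k01 by simp
  qed
  have Tk: "T A k \<le> T A l" if "k \<le> l" for A k l
    unfolding T_def using that znn
    by (intro nn_integral_mono mult_right_mono young_mono[OF young] ennreal_leI) auto
  have Tadd: "T A k = T B k + T (A - B) k" if [measurable]: "A \<in> sets M" "B \<in> sets M" and "B \<subseteq> A" for A B k
    unfolding T_def using that(3)
    by (subst nn_integral_add[symmetric]) (auto intro!: nn_integral_cong simp: indicator_def)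
  \<comment> \<open>A bad set carries the blow-up for every \<open>k > 1\<close> at once. The levels
    \<open>lam n\<close> decrease to 1, so pieces split off late have modular at least 1 at levels
    close to 1.\<close>
  define bad where "bad = (\<lambda>A. A \<in> sets M \<and> (\<forall>k>1. T A k = top))"
  define lam where "lam = (\<lambda>n::nat. 1 + 1 / (real n + 1))"
  have lam1: "1 < lam n" for n by (simp add: lam_def)
  have "\<exists>A. \<forall>n. bad (A n) \<and> (A (Suc n) \<subseteq> A n \<and> 1 \<le> T (A n - A (Suc n)) (lam n))"
  proof (rule dependent_nat_choice)
    show "\<exists>A. bad A" using Ttop by (intro exI[of _ "space M"]) (auto simp: bad_def)
    fix A n assume A: "bad A"
    then have [measurable]: "A \<in> sets M" by (simp add: bad_def)
    have "T A (lam n) = top" using A lam1 by (simp add: bad_def)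
    then obtain B where B: "B \<in> sets M" "B \<subseteq> A" "1 \<le> T B (lam n)" "1 \<le> T (A - B) (lam n)"
      unfolding T_def by (rule_tac infinite_integral_split[OF na \<open>A \<in> sets M\<close>, of "\<lambda>t. \<Phi> t (ennreal (lam n * z t))"]) auto
    \<comment> \<open>If \<open>B\<close> were good at \<open>k\<close> and the rest at
      \<open>l\<close>, their union would be good at \<open>min k l\<close>.\<close>
    have "bad B \<or> bad (A - B)"
    proof (rule ccontr)
      assume "\<not> ?thesis"
      then obtain k l where kl: "1 < k" "T B k \<noteq> top" "1 < l" "T (A - B) l \<noteq> top"
        using B by (auto simp: bad_def)
      define m where "m = min k l"
      have "T A m = T B m + T (A - B) m" by (rule Tadd) (use B in auto)
      also have "\<dots> \<le> T B k + T (A - B) l" by (intro add_mono Tk) (auto simp: m_def)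
      also have "\<dots> < top" using kl by (simp add: less_top)
      finally show False using A kl by (auto simp: bad_def m_def)
    qed
    moreover have "A - (A - B) = B" using B by auto
    ultimately show "\<exists>A'. bad A' \<and> (A' \<subseteq> A \<and> 1 \<le> T (A - A') (lam n))"
      using B by (metis Diff_subset)
  qed
  then obtain A where A: "\<And>n. bad (A n)" "\<And>n. A (Suc n) \<subseteq> A n" "\<And>n. 1 \<le> T (A n - A (Suc n)) (lam n)"
    by blast
  have Am[measurable]: "A n \<in> sets M" for n using A(1) by (simp add: bad_def)
  define C where "C = (\<lambda>n. A n - A (Suc n))"
  have Cm[measurable]: "C n \<in> sets M" for n unfolding C_def by measurable
  have decA: "A n \<subseteq> A m" if "m \<le> n" for m n using A(2) that by (rule lift_Suc_antimono_le)
  have disjC: "C m \<inter> C n = {}" if "m < n" for m n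
    using decA[of "Suc m" n] that by (auto simp: C_def)
  have C1: "1 \<le> T (C n) (lam n)" for n using A(3) by (simp add: C_def)
  \<comment> \<open>For \<open>k < 1\<close> the modulars of the disjoint pieces form a convergent
    series, so they tend to 0.\<close>
  have small: "\<exists>n0. \<forall>n\<ge>n0. T (C n) k \<le> e" if k: "0 \<le> k" "k < 1" and e: "0 < e" for k and e :: real
  proof -
    have "(\<Sum>n. T (C n) k) = (\<integral>\<^sup>+t. (\<Sum>n. \<Phi> t (ennreal (k * z t)) * indicator (C n) t) \<partial>M)"
      unfolding T_def by (rule nn_integral_suminf[symmetric]) measurable
    also have "\<dots> \<le> T (space M) k"
      unfolding T_def
    proof (rule nn_integral_mono)
      fix t assume t: "t \<in> space M"
      have "disjoint_family C" unfolding disjoint_family_on_def using disjC by (metis Int_commute linorder_neqE_nat)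
      then have "(\<Sum>n. indicator (C n) t :: ennreal) = indicator (\<Union>n. C n) t" by (rule suminf_indicator)
      then show "(\<Sum>n. \<Phi> t (ennreal (k * z t)) * indicator (C n) t) \<le> \<Phi> t (ennreal (k * z t)) * indicator (space M) t"
        using t by (simp add: ennreal_suminf_cmult indicator_def)
    qed
    finally have lt: "(\<Sum>n. T (C n) k) < top" using Tlt[OF k] by (rule le_less_trans)
    have Tfin: "T (C n) k = ennreal (enn2real (T (C n) k))" for n
    proof -
      have "T (C n) k \<le> (\<Sum>n. T (C n) k)" using sum_le_suminf[of "\<lambda>n. T (C n) k" "{n}"] by simp
      then show ?thesis using lt by (intro ennreal_enn2real[symmetric]) (rule le_less_trans)
    qed
    have "summable (\<lambda>n. enn2real (T (C n) k))"
      using lt Tfin by (intro summable_suminf_not_top) (auto simp: less_top[symmetric])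
    then have "(\<lambda>n. enn2real (T (C n) k)) \<longlonglongrightarrow> 0" by (rule summable_LIMSEQ_zero)
    then have "eventually (\<lambda>n. enn2real (T (C n) k) < e) sequentially" using e by (rule order_tendstoD)
    then obtain n0 where "\<And>n. n0 \<le> n \<Longrightarrow> enn2real (T (C n) k) < e" by (auto simp: eventually_sequentially)
    then show ?thesis using Tfin e by (intro exI[of _ n0]) (metis ennreal_leI less_imp_le)
  qed
  \<comment> \<open>The shift by 3 secures \<open>2 \<delta> < 1\<close> from \<open>n = 0\<close>
    on. Passing to late pieces makes the costs \<open>1 / \<delta>\<close> from
    \<open>young_increment\<close> sum to at most \<open>1/4\<close>, the bound on
    \<open>\<sigma>\<close>.\<close>
  define \<delta> where "\<delta> = (\<lambda>n::nat. 1 / (real n + 3))"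
  have \<delta>: "0 < \<delta> n" "2 * \<delta> n < 1" for n by (auto simp: \<delta>_def field_simps)
  have "\<exists>j. \<forall>n. ennreal (1 / \<delta> n) * T (C (j n)) (1 - \<delta> n) \<le> ennreal (1 / 4 * (1 / 2) ^ Suc n) \<and> j n < j (Suc n)"
  proof (rule dependent_nat_choice)
    have ex: "\<exists>j'>j. ennreal (1 / \<delta> n) * T (C j') (1 - \<delta> n) \<le> ennreal (1 / 4 * (1 / 2) ^ Suc n)" for j n
    proof -
      define e where "e = \<delta> n * (1 / 4 * (1 / 2) ^ Suc n)"
      have "0 < e" using \<delta> by (simp add: e_def)
      then obtain n0 where n0: "\<And>m. n0 \<le> m \<Longrightarrow> T (C m) (1 - \<delta> n) \<le> e"
        using small[of "1 - \<delta> n" e] \<delta>[of n] by auto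
      have "ennreal (1 / \<delta> n) * T (C (max n0 (Suc j))) (1 - \<delta> n) \<le> ennreal (1 / \<delta> n) * ennreal e"
        by (intro mult_left_mono n0) auto
      also have "\<dots> = ennreal (1 / 4 * (1 / 2) ^ Suc n)"
        using \<delta>[of n] \<open>0 < e\<close> by (subst ennreal_mult[symmetric]) (auto simp: e_def)
      finally show ?thesis by (intro exI[of _ "max n0 (Suc j)"]) auto
    qed
    show "\<exists>j. ennreal (1 / \<delta> 0) * T (C j) (1 - \<delta> 0) \<le> ennreal (1 / 4 * (1 / 2) ^ Suc 0)" using ex[of 0 0] by blast
    show "\<exists>j'. ennreal (1 / \<delta> (Suc n)) * T (C j') (1 - \<delta> (Suc n)) \<le> ennreal (1 / 4 * (1 / 2) ^ Suc (Suc n)) \<and> j < j'" for j n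
      using ex[of j "Suc n"] by blast
  qed
  then obtain j where j: "\<And>n. ennreal (1 / \<delta> n) * T (C (j n)) (1 - \<delta> n) \<le> ennreal (1 / 4 * (1 / 2) ^ Suc n)"
    "\<And>n. j n < j (Suc n)" by blast
  have jmono: "strict_mono j" using j(2) by (rule strict_mono_Suc_iff[THEN iffD2, rule_format])
  have jge: "n \<le> j n" for n using jmono by (rule strict_mono_imp_increasing)
  define D where "D = (\<lambda>n. C (j n))"
  have Dm[measurable]: "D n \<in> sets M" for n unfolding D_def by measurable
  have disjD: "m = n" if "t \<in> D m" "t \<in> D n" for m n t
  proof (rule ccontr)
    assume "m \<noteq> n"
    then have "j m < j n \<or> j n < j m" using jmono by (metis linorder_neqE_nat strict_mono_less)
    then show False using disjC that unfolding D_def by blast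
  qed
  \<comment> \<open>The index of the piece containing \<open>t\<close> allows a single measurable
    formula for \<open>x\<close>, whose damping factor varies from piece to piece.\<close>
  define idx where "idx = (\<lambda>t. LEAST n. t \<in> D n)"
  have idx: "idx t = n" if "t \<in> D n" for t n
    unfolding idx_def using that disjD by (metis LeastI)
  have [measurable]: "idx \<in> measurable M (count_space UNIV)" unfolding idx_def by measurable
  define x where "x = (\<lambda>t. if t \<in> (\<Union>n. D n) then (1 - 2 * \<delta> (idx t)) * z t else 0)"
  have [measurable]: "x \<in> borel_measurable M" unfolding x_def by measurable
  have xD: "x t = (1 - 2 * \<delta> n) * z t" if "t \<in> D n" for t n using that idx[OF that] by (auto simp: x_def)
  have xnn: "0 \<le> x t" for t using znn \<delta>(2)[of "idx t"] by (simp add: x_def)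
  \<comment> \<open>Each summand is the slope bound of \<open>young_increment\<close> on its piece:
    \<open>x\<close> uses the factor \<open>1 - 2 \<delta>\<close>, and the chord ends at
    \<open>1 - \<delta>\<close>, where the modular is still finite.\<close>
  define \<sigma> where "\<sigma> = (\<lambda>t. \<Sum>n. ennreal (1 / \<delta> n) * \<Phi> t (ennreal ((1 - \<delta> n) * z t)) * indicator (D n) t)"
  have [measurable]: "\<sigma> \<in> borel_measurable M" unfolding \<sigma>_def by measurable
  have \<sigma>le: "(\<integral>\<^sup>+t. \<sigma> t \<partial>M) \<le> ennreal (1 / 4)"
  proof -
    have "(\<integral>\<^sup>+t. \<sigma> t \<partial>M) = (\<Sum>n. ennreal (1 / \<delta> n) * T (D n) (1 - \<delta> n))"
      unfolding \<sigma>_def T_def by (subst nn_integral_suminf) (auto simp: nn_integral_cmult mult.assoc)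
    also have "\<dots> \<le> (\<Sum>n. ennreal (1 / 4 * (1 / 2) ^ Suc n))"
      using j(1) by (intro suminf_le) (auto simp: D_def)
    also have "\<dots> = ennreal (1 / 4)"
      using sums_mult[OF power_half_series, of "1 / 4"] by (intro suminf_ennreal_eq) auto
    finally show ?thesis .
  qed
  have incr: "\<Phi> t (ennreal (\<beta> * x t)) \<le> \<Phi> t (ennreal (\<alpha> * x t)) + ennreal (\<beta> - \<alpha>) * \<sigma> t"
    if ab: "0 \<le> \<alpha>" "\<alpha> \<le> \<beta>" "\<beta> \<le> 1" for t \<alpha> \<beta>
  proof (cases "t \<in> (\<Union>n. D n)")
    case True
    then obtain n where n: "t \<in> D n" by auto
    have "ennreal (1 / \<delta> n) * \<Phi> t (ennreal ((1 - \<delta> n) * z t)) \<le> \<sigma> t"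
      unfolding \<sigma>_def using n sum_le_suminf[of "\<lambda>n. ennreal (1 / \<delta> n) * \<Phi> t (ennreal ((1 - \<delta> n) * z t)) * indicator (D n) t" "{n}"] by simp
    then have "\<Phi> t (ennreal (\<alpha> * x t)) + ennreal (\<beta> - \<alpha>) * (ennreal (1 / \<delta> n) * \<Phi> t (ennreal ((1 - \<delta> n) * z t)))
        \<le> \<Phi> t (ennreal (\<alpha> * x t)) + ennreal (\<beta> - \<alpha>) * \<sigma> t"
      by (intro add_left_mono mult_left_mono) auto
    then show ?thesis
      using young_increment[OF young znn ab \<delta>[of n], of t t] unfolding xD[OF n] by (rule order_trans[rotated])
  qed (simp add: x_def young_zero[OF young])
  \<comment> \<open>For \<open>l > 1\<close> the damping \<open>1 - 2 \<delta>\<close> is eventually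
    outweighed: \<open>l\<close> times it exceeds the level \<open>lam\<close> of the piece, so
    almost all pieces contribute at least 1. The sequence \<open>m\<close> selects the even or the
    odd ones.\<close>
  have inf: "(\<integral>\<^sup>+t\<in>B. \<Phi> t (ennreal (l * x t)) \<partial>M) = top"
    if [measurable]: "B \<in> sets M" and l: "1 < l" and m: "\<And>n. n \<le> m n" "inj m" "\<And>n. D (m n) \<subseteq> B" for B l and m :: "nat \<Rightarrow> nat"
  proof -
    have "(\<lambda>n. l * (1 - 2 * \<delta> n) - 1 / (real n + 1)) \<longlonglongrightarrow> l * (1 - 2 * 0) - 0"
    proof (intro tendsto_intros)
      have *: "(\<lambda>n. 1 / (real n + real k)) \<longlonglongrightarrow> 0" for k :: nat
        using LIMSEQ_ignore_initial_segment[OF lim_1_over_n, of k] by simp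
      show "\<delta> \<longlonglongrightarrow> 0" unfolding \<delta>_def using *[of 3] by simp
      show "(\<lambda>n. 1 / (real n + 1)) \<longlonglongrightarrow> 0" using *[of 1] by simp
    qed
    then have "eventually (\<lambda>n. 1 < l * (1 - 2 * \<delta> n) - 1 / (real n + 1)) sequentially"
      using l by (intro order_tendstoD(1)) auto
    then obtain n0 where n0: "\<And>n. n0 \<le> n \<Longrightarrow> 1 < l * (1 - 2 * \<delta> n) - 1 / (real n + 1)"
      by (auto simp: eventually_sequentially)
    have "top = (\<Sum>n. \<integral>\<^sup>+t\<in>D (m n). \<Phi> t (ennreal (l * x t)) \<partial>M)"
    proof (rule suminf_eventually_ge_one[symmetric, of n0])
      fix n assume "n0 \<le> n"
      then have "n0 \<le> m n" using m(1)[of n] by simp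
      have "lam (j (m n)) \<le> 1 + 1 / (real (m n) + 1)" unfolding lam_def using jge[of "m n"] by (simp add: frac_le)
      also have "\<dots> \<le> l * (1 - 2 * \<delta> (m n))" using n0[OF \<open>n0 \<le> m n\<close>] by simp
      finally have "T (D (m n)) (lam (j (m n))) \<le> T (D (m n)) (l * (1 - 2 * \<delta> (m n)))" by (rule Tk)
      also have "\<dots> = (\<integral>\<^sup>+t\<in>D (m n). \<Phi> t (ennreal (l * x t)) \<partial>M)"
        unfolding T_def by (intro nn_integral_cong) (auto simp: indicator_def xD mult.assoc)
      finally show "1 \<le> (\<integral>\<^sup>+t\<in>D (m n). \<Phi> t (ennreal (l * x t)) \<partial>M)"
        using C1[of "j (m n)"] unfolding D_def by (rule order_trans[rotated])
    qed
    also have "\<dots> = (\<integral>\<^sup>+t. (\<Sum>n. \<Phi> t (ennreal (l * x t)) * indicator (D (m n)) t) \<partial>M)"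
      by (rule nn_integral_suminf[symmetric]) measurable
    also have "\<dots> \<le> (\<integral>\<^sup>+t\<in>B. \<Phi> t (ennreal (l * x t)) \<partial>M)"
    proof (rule nn_integral_mono)
      fix t
      have "disjoint_family (\<lambda>n. D (m n))"
        unfolding disjoint_family_on_def using disjD m(2) by (metis disjoint_iff injD)
      then have "(\<Sum>n. indicator (D (m n)) t :: ennreal) = indicator (\<Union>n. D (m n)) t" by (rule suminf_indicator)
      then show "(\<Sum>n. \<Phi> t (ennreal (l * x t)) * indicator (D (m n)) t) \<le> \<Phi> t (ennreal (l * x t)) * indicator B t"
        using m(3) by (auto simp: ennreal_suminf_cmult indicator_def)
    qed
    finally show ?thesis by (simp add: top_unique)
  qed
  define B where "B = (\<Union>n. D (2 * n))"
  have Bm[measurable]: "B \<in> sets M" unfolding B_def by measurable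
  have odd: "D (2 * n + 1) \<subseteq> space M - B" for n
  proof
    fix t assume t: "t \<in> D (2 * n + 1)"
    have "2 * n + 1 \<noteq> 2 * k" for k by presburger
    then have "t \<notin> D (2 * k)" for k using disjD[OF t] by blast
    then show "t \<in> space M - B" using t sets.sets_into_space[OF Dm] by (auto simp: B_def)
  qed
  have "\<not> smooth_space M E N"
  proof (rule not_smooth_if_singular[of x \<sigma> B])
    show "(\<integral>\<^sup>+t\<in>B. \<Phi> t (ennreal (l * x t)) \<partial>M) = top" if "1 < l" for l
      using that by (intro inf[of B l "\<lambda>n. 2 * n"]) (auto simp: B_def inj_def)
    show "(\<integral>\<^sup>+t\<in>space M - B. \<Phi> t (ennreal (l * x t)) \<partial>M) = top" if "1 < l" for l
      using that odd by (intro inf[of "space M - B" l "\<lambda>n. 2 * n + 1"]) (auto simp: inj_def)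
  qed (use xnn \<sigma>le incr in auto)
  then show False using smooth by simp
qed

end

subsection \<open>The doubling condition\<close>

context young_family
begin

text \<open>\<open>h N\<close> is the largest excess of \<open>\<Phi> t (2 v)\<close> over
  \<open>4 ^ N * \<Phi> t v\<close>. If its integral were infinite for every \<open>N\<close>,
  pieces with modular at most \<open>(1 / 2) ^ N\<close> and doubled modular at least
  \<open>N\<close> would have a supremum violating doubling. One integrable \<open>h N\<close>
  yields the condition with \<open>K = 4 ^ N\<close>, up to a factor 2.\<close>

lemma doubling_imp_delta2:
  assumes na: "non_atomic M"
    and doubling: "\<And>u. u \<in> borel_measurable M \<Longrightarrow> (\<And>t. 0 \<le> u t) \<Longrightarrow> I u < top \<Longrightarrow> I (\<lambda>t. 2 * u t) < top"
  shows "delta2 M \<Phi>"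
proof -
  \<comment> \<open>Without the guard an infinite \<open>\<Phi> t v\<close> would give
    \<open>\<infinity> - \<infinity> = \<infinity>\<close>. With it, a positive \<open>g\<close>
    certifies that \<open>\<Phi> t v\<close> is finite.\<close>
  define g where "g = (\<lambda>(N::nat) t v. if \<Phi> t (ennreal v) < top then \<Phi> t (ennreal (2 * v)) - ennreal (4 ^ N) * \<Phi> t (ennreal v) else 0)"
  have gm[measurable]: "(\<lambda>t. g N t (v t)) \<in> borel_measurable M" if [measurable]: "v \<in> borel_measurable M" for N v
    unfolding g_def by measurable
  define vn where "vn = (\<lambda>N. rec_nat (\<lambda>t. 0) (\<lambda>n v t. if g N t (v t) < g N t (qseq n) then qseq n else v t))"
  have vn0: "vn N 0 = (\<lambda>t. 0)" and vnS: "vn N (Suc n) = (\<lambda>t. if g N t (vn N n t) < g N t (qseq n) then qseq n else vn N n t)" for N n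
    unfolding vn_def by simp_all
  have vm[measurable]: "vn N n \<in> borel_measurable M" for N n by (induction n) (simp_all add: vn0 vnS)
  have vnn: "0 \<le> vn N n t" for N n t by (induction n) (simp_all add: vn0 vnS)
  have inc: "g N t (vn N n t) \<le> g N t (vn N (Suc n) t)" for N n t by (auto simp: vnS)
  have ge: "g N t (qseq n) \<le> g N t (vn N (Suc n) t)" for N n t by (auto simp: vnS)
  define h where "h = (\<lambda>N t. SUP n. g N t (vn N n t))"
  have hm[measurable]: "h N \<in> borel_measurable M" for N unfolding h_def by measurable
  have hge: "g N t (qseq n) \<le> h N t" for N n t unfolding h_def using ge by (meson SUP_upper2 UNIV_I)
  have hint: "(\<integral>\<^sup>+t. h N t \<partial>M) = (SUP n. \<integral>\<^sup>+t. g N t (vn N n t) \<partial>M)" for N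
    unfolding h_def using inc by (intro nn_integral_monotone_convergence_SUP incseq_SucI) (auto simp: le_fun_def)
  have "\<exists>N. (\<integral>\<^sup>+t. h N t \<partial>M) < top"
  proof (rule ccontr)
    assume "\<not> ?thesis"
    then have top: "(\<integral>\<^sup>+t. h N t \<partial>M) = top" for N by (metis less_top)
    have "\<exists>y. y \<in> borel_measurable M \<and> (\<forall>t. 0 \<le> y t) \<and> I y \<le> ennreal ((1 / 2) ^ N) \<and> of_nat N \<le> I (\<lambda>t. 2 * y t)" for N :: nat
    proof -
      have "of_nat N < (SUP n. \<integral>\<^sup>+t. g N t (vn N n t) \<partial>M)" unfolding hint[symmetric] top by (rule of_nat_less_top)
      then obtain n where n: "of_nat N < (\<integral>\<^sup>+t. g N t (vn N n t) \<partial>M)" by (auto simp: less_SUP_iff)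
      define Z where "Z = {t \<in> space M. 0 < g N t (vn N n t)}"
      have [measurable]: "Z \<in> sets M" unfolding Z_def by measurable
      define u where "u = (\<lambda>t. vn N n t * indicator Z t)"
      have [measurable]: "u \<in> borel_measurable M" unfolding u_def by measurable
      have unn: "0 \<le> u t" for t using vnn by (simp add: u_def)
      define P where "P = (\<lambda>t. \<Phi> t (ennreal (2 * u t)))"
      define Q where "Q = (\<lambda>t. \<Phi> t (ennreal (u t)))"
      have [measurable]: "P \<in> borel_measurable M" "Q \<in> borel_measurable M" unfolding P_def Q_def by measurable
      have Qfin: "Q t < top" for t
      proof (cases "t \<in> Z")
        case True
        then have "0 < g N t (vn N n t)" by (simp add: Z_def)
        then show ?thesis using True by (auto simp: g_def Q_def u_def split: if_splits)
      qed (simp add: Q_def u_def young_zero[OF young])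
      have PQ: "ennreal (4 ^ N) * Q t \<le> P t" for t
      proof (cases "t \<in> Z")
        case True
        then have "0 < g N t (vn N n t)" by (simp add: Z_def)
        then have "0 < P t - ennreal (4 ^ N) * Q t" using True by (auto simp: g_def Q_def P_def u_def split: if_splits)
        then show ?thesis by (auto simp: diff_gt_0_iff_gt_ennreal)
      qed (simp add: Q_def u_def young_zero[OF young])
      have gP: "g N t (vn N n t) \<le> P t" if "t \<in> space M" for t
      proof (cases "t \<in> Z")
        case True
        then show ?thesis by (simp add: g_def P_def u_def diff_le_self_ennreal)
      next
        case False
        then show ?thesis using that by (simp add: Z_def)
      qed
      have "of_nat N < (\<integral>\<^sup>+t. P t \<partial>M)" using n nn_integral_mono[OF gP] by (rule less_le_trans)
      also have "(\<integral>\<^sup>+t. P t \<partial>M) = (\<integral>\<^sup>+t. (SUP m::nat. min (P t) (ennreal (4 ^ N) * Q t + of_nat m)) \<partial>M)"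
      proof (intro nn_integral_cong antisym)
        fix t
        show "P t \<le> (SUP m::nat. min (P t) (ennreal (4 ^ N) * Q t + of_nat m))"
        proof (rule dense_le)
          fix c assume c: "c < P t"
          then have "c < top" by (rule less_le_trans) simp
          then obtain m :: nat where "c < of_nat m" using ennreal_Ex_less_of_nat by blast
          also have "\<dots> \<le> ennreal (4 ^ N) * Q t + of_nat m" by (simp add: add_increasing)
          finally show "c \<le> (SUP m::nat. min (P t) (ennreal (4 ^ N) * Q t + of_nat m))" using c by (intro SUP_upper2[of m]) auto
        qed
      qed (auto intro!: SUP_least)
      also have "\<dots> = (SUP m::nat. \<integral>\<^sup>+t. min (P t) (ennreal (4 ^ N) * Q t + of_nat m) \<partial>M)"
      proof (rule nn_integral_monotone_convergence_SUP)
        have "min (P t) (ennreal (4 ^ N) * Q t + of_nat m) \<le> min (P t) (ennreal (4 ^ N) * Q t + of_nat k)" if "m \<le> k" for t and m k :: nat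
          using of_nat_mono[OF that, where 'a = ennreal] by (intro min.mono add_left_mono) auto
        then show "incseq (\<lambda>m t. min (P t) (ennreal (4 ^ N) * Q t + of_nat m))" by (auto simp: incseq_def le_fun_def)
      qed measurable
      finally obtain m :: nat where m: "of_nat N < (\<integral>\<^sup>+t. min (P t) (ennreal (4 ^ N) * Q t + of_nat m) \<partial>M)" by (auto simp: less_SUP_iff)
      \<comment> \<open>\<open>R\<close> lies between \<open>4 ^ N * Q\<close> and \<open>P\<close>
        and is finite, so a set \<open>A\<close> with integral exactly \<open>N\<close> exists. The
        lower bound makes \<open>I y\<close> small and the upper bound makes \<open>I (2 y)\<close>
        large.\<close>
      define R where "R = (\<lambda>t. min (P t) (ennreal (4 ^ N) * Q t + of_nat m))"
      have [measurable]: "R \<in> borel_measurable M" unfolding R_def by measurable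
      have Rfin: "R t < top" for t
        using Qfin[of t] unfolding R_def by (intro min.strict_coboundedI2) (simp add: ennreal_mult_less_top of_nat_less_top)
      have "of_nat N \<le> (\<integral>\<^sup>+t\<in>space M. R t \<partial>M)"
        using m by (simp add: R_def nn_integral_set_ennreal less_imp_le cong: nn_integral_cong)
      then obtain A where A[measurable]: "A \<in> sets M" and AR: "(\<integral>\<^sup>+t\<in>A. R t \<partial>M) = of_nat N"
        using Rfin of_nat_less_top by (rule_tac exact_integral[OF na sets.top, of R "of_nat N"]) auto
      define y where "y = (\<lambda>t. u t * indicator A t)"
      have ynn: "0 \<le> y t" for t using unn by (simp add: y_def)
      have y[measurable]: "y \<in> borel_measurable M" unfolding y_def by measurable
      have Iy: "I y = (\<integral>\<^sup>+t\<in>A. Q t \<partial>M)"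
        unfolding modular_def using unn by (intro nn_integral_cong) (auto simp: y_def Q_def indicator_def young_zero[OF young])
      have I2y: "I (\<lambda>t. 2 * y t) = (\<integral>\<^sup>+t\<in>A. P t \<partial>M)"
        unfolding modular_def using unn by (intro nn_integral_cong) (auto simp: y_def P_def indicator_def young_zero[OF young])
      have "of_nat N \<le> I (\<lambda>t. 2 * y t)"
        unfolding I2y AR[symmetric] by (intro nn_integral_mono mult_right_mono) (auto simp: R_def)
      moreover have "I y \<le> ennreal ((1 / 2) ^ N)"
      proof -
        \<comment> \<open>The base 4 leaves room for \<open>N \<le> 2 ^ N\<close>: dividing by
          \<open>4 ^ N\<close> gives a summable bound.\<close>
        have "ennreal (4 ^ N) * I y = (\<integral>\<^sup>+t\<in>A. (ennreal (4 ^ N) * Q t) \<partial>M)"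
          unfolding Iy by (subst nn_integral_cmult[symmetric]) (auto simp: mult.assoc)
        also have "\<dots> \<le> (\<integral>\<^sup>+t\<in>A. R t \<partial>M)"
          using PQ by (intro nn_integral_mono mult_right_mono) (auto simp: R_def)
        also have "\<dots> = ennreal (real N)" by (simp add: AR ennreal_of_nat_eq_real_of_nat)
        also have "\<dots> \<le> ennreal (2 ^ N)" by (intro ennreal_leI) (simp add: of_nat_less_two_power less_imp_le)
        also have "(2 ^ N :: real) = 4 ^ N * (1 / 2) ^ N" by (simp add: power_mult_distrib[symmetric])
        also have "ennreal (4 ^ N * (1 / 2) ^ N) = ennreal (4 ^ N) * ennreal ((1 / 2) ^ N)" by (intro ennreal_mult) auto
        finally show ?thesis by (subst (asm) ennreal_mult_le_mult_iff) auto
      qed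
      ultimately show ?thesis using y ynn by blast
    qed
    then obtain y where y: "\<And>N. y N \<in> borel_measurable M" "\<And>N t. 0 \<le> y N t" "\<And>N. I (y N) \<le> ennreal ((1 / 2) ^ N)"
        "\<And>N. of_nat N \<le> I (\<lambda>t. 2 * y N t)" by metis
    note [measurable] = y(1)
    \<comment> \<open>A supremum rather than a sum: \<open>\<Phi> t (U t)\<close> is at most the sum
      of the single values, with no disjointness of supports required.\<close>
    define U where "U = (\<lambda>t. SUP N. ennreal (y N t))"
    have [measurable]: "U \<in> borel_measurable M" unfolding U_def by measurable
    have "(\<integral>\<^sup>+t. \<Phi> t (U t) \<partial>M) \<le> (\<integral>\<^sup>+t. (\<Sum>N. \<Phi> t (ennreal \<bar>y N t\<bar>)) \<partial>M)"
    proof (rule nn_integral_mono)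
      fix t
      show "\<Phi> t (U t) \<le> (\<Sum>N. \<Phi> t (ennreal \<bar>y N t\<bar>))"
        unfolding U_def
      proof (rule young_SUP_le[OF young])
        fix N
        show "\<Phi> t (ennreal (y N t)) \<le> (\<Sum>N. \<Phi> t (ennreal \<bar>y N t\<bar>))"
          using sum_le_suminf[of "\<lambda>N. \<Phi> t (ennreal \<bar>y N t\<bar>)" "{N}"] y(2) by simp
      qed
    qed
    also have "\<dots> = (\<Sum>N. I (y N))" unfolding modular_def by (rule nn_integral_suminf) measurable
    also have "\<dots> \<le> (\<Sum>N. ennreal ((1 / 2) ^ N))" using y(3) by (intro suminf_le) auto
    also have "\<dots> = ennreal 2"
      using geometric_sums[of "1 / 2 :: real"] by (intro suminf_ennreal_eq) auto
    also have "\<dots> < top" by simp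
    finally have IU: "(\<integral>\<^sup>+t. \<Phi> t (U t) \<partial>M) < top" .
    have "AE t in M. \<Phi> t (U t) \<noteq> \<infinity>" using IU by (intro nn_integral_PInf_AE) auto
    then have Ufin: "AE t in M. U t < top"
    proof eventually_elim
      case (elim t)
      then show ?case using young_top[OF young, of t] by (metis infinity_ennreal_def less_top)
    qed
    define u where "u = (\<lambda>t. enn2real (U t))"
    have u: "u \<in> borel_measurable M" "\<And>t. 0 \<le> u t" unfolding u_def by auto
    have "ennreal (u t) \<le> U t" for t unfolding u_def by (cases "U t") auto
    then have "I u \<le> (\<integral>\<^sup>+t. \<Phi> t (U t) \<partial>M)"
      unfolding modular_def using u(2) by (intro nn_integral_mono young_mono[OF young]) auto
    then have "I u < top" using IU by (rule le_less_trans)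
    then have "I (\<lambda>t. 2 * u t) < top" by (rule doubling[OF u])
    moreover have "of_nat N \<le> I (\<lambda>t. 2 * u t)" for N
    proof -
      have "I (\<lambda>t. 2 * y N t) \<le> I (\<lambda>t. 2 * u t)"
        unfolding modular_def
      proof (rule nn_integral_mono_AE)
        show "AE t in M. \<Phi> t (ennreal \<bar>2 * y N t\<bar>) \<le> \<Phi> t (ennreal \<bar>2 * u t\<bar>)"
          using Ufin
        proof eventually_elim
          case (elim t)
          have "ennreal (y N t) \<le> U t" unfolding U_def by (rule SUP_upper) simp
          also have "\<dots> = ennreal (u t)" using elim by (simp add: u_def ennreal_enn2real)
          finally have "y N t \<le> u t" using u(2) by (simp add: ennreal_le_iff)
          then show ?case using y(2)[of N t] u(2)[of t] by (intro young_mono[OF young] ennreal_leI) simp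
        qed
      qed
      then show ?thesis using y(4)[of N] by (rule order_trans[rotated])
    qed
    ultimately show False by (metis ennreal_Ex_less_of_nat not_le)
  qed
  then obtain N where N: "(\<integral>\<^sup>+t. h N t \<partial>M) < top" by blast
  define K :: real where "K = 4 ^ N"
  have K: "1 \<le> K" by (simp add: K_def)
  have K': "x \<le> ennreal K * x" for x using mult_right_mono[of 1 "ennreal K" x] K by (simp add: ennreal_ge_1)
  have hfin: "AE t in M. h N t \<noteq> \<infinity>" using N by (intro nn_integral_PInf_AE) auto
  have hK: "\<Phi> t (ennreal (2 * qseq i)) \<le> ennreal K * \<Phi> t (ennreal (qseq i)) + h N t" for t i
  proof (cases "\<Phi> t (ennreal (qseq i)) < top")
    case True
    then have "\<Phi> t (ennreal (2 * qseq i)) - ennreal K * \<Phi> t (ennreal (qseq i)) \<le> h N t"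
      using hge[of N t i] by (simp add: g_def K_def)
    then show ?thesis by (simp add: ennreal_minus_le_iff)
  next
    case False
    then show ?thesis using K by (simp add: less_top[symmetric] ennreal_mult_top)
  qed
  \<comment> \<open>The threshold is the largest argument at which \<open>K * \<Phi> t\<close> has
    not yet overtaken \<open>h N t\<close>. At it \<open>\<Phi> t\<close> is still below the
    integrable \<open>h N\<close>; beyond it the excess is absorbed by another
    \<open>K * \<Phi> t u\<close>.\<close>
  define fe where "fe = (\<lambda>t. SUP i. if ennreal K * \<Phi> t (ennreal (qseq i)) \<le> h N t then ennreal (qseq i) else 0)"
  have [measurable]: "fe \<in> borel_measurable M"
    unfolding fe_def by measurable
  define f where "f = (\<lambda>t. enn2real (fe t))"
  have f: "f \<in> borel_measurable M" "\<And>t. 0 \<le> f t" unfolding f_def by auto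
  have "\<Phi> t (fe t) \<le> h N t" for t
    unfolding fe_def
    by (rule young_SUP_le[OF young]) (auto simp: young_zero[OF young] intro: order_trans[OF K'])
  moreover have "ennreal (f t) \<le> fe t" for t unfolding f_def by (cases "fe t") auto
  ultimately have fh: "\<Phi> t (ennreal (f t)) \<le> h N t" for t using young_mono[OF young] order_trans by blast
  have "I f \<le> (\<integral>\<^sup>+t. h N t \<partial>M)"
    unfolding modular_def using f(2) fh by (intro nn_integral_mono) simp
  then have "I (\<lambda>t. 2 * f t) < top" using N by (intro doubling[OF f]) auto
  then have f2: "(\<lambda>t. 2 * f t) \<in> mo_class M \<Phi>" using f(1) by (simp add: mo_class_def)
  \<comment> \<open>The threshold is doubled to leave room for a rational strictly between
    \<open>f t\<close> and \<open>u\<close> whenever \<open>u\<close> is positive;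
    \<open>2 f\<close> stays in the class by doubling itself.\<close>
  have "AE t in M. \<forall>u\<ge>ennreal (2 * f t). \<Phi> t (2 * u) \<le> ennreal (2 * K) * \<Phi> t u"
    using hfin
  proof eventually_elim
    case (elim t)
    then have "h N t < top" by (simp add: less_top)
    then obtain u0 where u0: "0 < u0" "h N t < \<Phi> t (ennreal u0)" using young_large[OF young] by blast
    have "fe t \<le> ennreal u0"
      unfolding fe_def
    proof (rule SUP_least, clarsimp)
      fix i assume i: "ennreal K * \<Phi> t (ennreal (qseq i)) \<le> h N t"
      show "ennreal (qseq i) \<le> ennreal u0"
      proof (rule ccontr)
        assume "\<not> ?thesis"
        then have "\<Phi> t (ennreal u0) \<le> \<Phi> t (ennreal (qseq i))" by (intro young_mono[OF young]) (simp only: not_le less_imp_le)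
        also have "\<dots> \<le> h N t" using i K' order_trans by blast
        finally show False using u0 by simp
      qed
    qed
    then have fef: "fe t = ennreal (f t)" unfolding f_def
      by (intro ennreal_enn2real[symmetric]) (auto intro: le_less_trans)
    show ?case
    proof (intro allI impI)
      fix v assume v: "ennreal (2 * f t) \<le> v"
      show "\<Phi> t (2 * v) \<le> ennreal (2 * K) * \<Phi> t v"
      proof (cases v)
        case top
        then show ?thesis using K young_top[OF young] by (simp add: ennreal_mult_top)
      next
        case (real u)
        then have 2: "2 * v = ennreal (2 * u)" by (simp add: ennreal_mult)
        show ?thesis
        proof (cases "u = 0")
          case True
          then show ?thesis using 2 real young_zero[OF young] by simp
        next
          case False
          have "2 * f t \<le> u" using v real f(2)[of t] by (simp add: ennreal_le_iff)
          then have "f t < u" using False real f(2)[of t] by (cases "f t = 0") auto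
          then obtain i where i: "f t < qseq i" "qseq i < u" using qseq_dense f(2) by blast
          have "h N t \<le> ennreal K * \<Phi> t (ennreal (qseq i))"
          proof (rule ccontr)
            assume "\<not> ?thesis"
            then have "ennreal (qseq i) \<le> fe t" unfolding fe_def by (intro SUP_upper2[of i]) auto
            then show False using i(1) f(2)[of t] by (simp add: fef ennreal_le_iff)
          qed
          also have "\<dots> \<le> ennreal K * \<Phi> t (ennreal u)"
            using i by (intro mult_left_mono young_mono[OF young] ennreal_leI) auto
          finally have hu: "h N t \<le> ennreal K * \<Phi> t (ennreal u)" .
          have "\<Phi> t (ennreal (2 * u)) \<le> ennreal K * \<Phi> t (ennreal u) + h N t"
          proof (rule dense_le)
            fix c assume "c < \<Phi> t (ennreal (2 * u))"
            then obtain k where k: "ennreal (qseq k) < ennreal (2 * u)" "c < \<Phi> t (ennreal (qseq k))"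
              using young_left_lsc[OF young] by blast
            then have "qseq k / 2 < u" by (simp add: ennreal_less_iff)
            then obtain l where l: "qseq k / 2 < qseq l" "qseq l < u" using qseq_dense[of "qseq k / 2" u] by auto
            have "c \<le> \<Phi> t (ennreal (qseq k))" using k by simp
            also have "\<dots> \<le> \<Phi> t (ennreal (2 * qseq l))" using l by (intro young_mono[OF young] ennreal_leI) auto
            also have "\<dots> \<le> ennreal K * \<Phi> t (ennreal (qseq l)) + h N t" by (rule hK)
            also have "\<dots> \<le> ennreal K * \<Phi> t (ennreal u) + h N t"
              using l by (intro add_right_mono mult_left_mono young_mono[OF young] ennreal_leI) auto
            finally show "c \<le> ennreal K * \<Phi> t (ennreal u) + h N t" .
          qed
          also have "\<dots> \<le> ennreal K * \<Phi> t (ennreal u) + ennreal K * \<Phi> t (ennreal u)" using hu by (rule add_left_mono)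
          also have "\<dots> = ennreal (2 * K) * \<Phi> t (ennreal u)"
          proof -
            have "ennreal (2 * K) = ennreal K + ennreal K" using K ennreal_plus[of K K] by simp
            then show ?thesis by (simp only: distrib_right)
          qed
          finally show ?thesis using 2 real by simp
        qed
      qed
    qed
  qed
  then show ?thesis
    unfolding delta2_def using f(2) K
    by (intro bexI[OF _ f2] exI[of _ "2 * K"]) auto
qed

section \<open>Consequences of the doubling condition, and attainment in the Amemiya formula\<close>

lemma delta2_doubling:
  assumes d2: "delta2 M \<Phi>" and [measurable]: "x \<in> borel_measurable M" and x: "I x < top"
  shows "I (\<lambda>t. 2 * x t) < top"
proof -
  obtain f K where f: "f \<in> mo_class M \<Phi>" "\<And>t. t \<in> space M \<Longrightarrow> 0 \<le> f t" "0 < K"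
    "AE t in M. \<forall>u\<ge>ennreal (f t). \<Phi> t (2 * u) \<le> ennreal K * \<Phi> t u"
    using d2 unfolding delta2_def by blast
  have [measurable]: "f \<in> borel_measurable M" using f(1) by (simp add: mo_class_def)
  have "I (\<lambda>t. 2 * x t) \<le> (\<integral>\<^sup>+t. ennreal K * \<Phi> t (ennreal \<bar>x t\<bar>) + ennreal K * \<Phi> t (ennreal \<bar>f t\<bar>) \<partial>M)"
    unfolding modular_def
  proof (rule nn_integral_mono_AE)
    show "AE t in M. \<Phi> t (ennreal \<bar>2 * x t\<bar>) \<le> ennreal K * \<Phi> t (ennreal \<bar>x t\<bar>) + ennreal K * \<Phi> t (ennreal \<bar>f t\<bar>)"
      using f(4) AE_space
    proof eventually_elim
      case (elim t)
      define m where "m = max \<bar>x t\<bar> (f t)"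
      have m: "0 \<le> m" "ennreal (f t) \<le> ennreal m" by (auto simp: m_def intro: ennreal_leI)
      have "\<Phi> t (ennreal \<bar>2 * x t\<bar>) \<le> \<Phi> t (2 * ennreal m)"
        using m(1) by (simp add: abs_mult ennreal_mult m_def) (intro young_mono[OF young] mult_left_mono ennreal_leI; simp)
      also have "\<dots> \<le> ennreal K * \<Phi> t (ennreal m)" using elim(1) m by blast
      also have "\<dots> \<le> ennreal K * \<Phi> t (ennreal \<bar>x t\<bar>) + ennreal K * \<Phi> t (ennreal \<bar>f t\<bar>)"
        using f(2)[OF elim(2)] by (auto simp: m_def max_def add_increasing add_increasing2)
      finally show ?case .
    qed
  qed
  also have "\<dots> = ennreal K * I x + ennreal K * I f"
    unfolding modular_def by (subst nn_integral_add) (auto simp: nn_integral_cmult)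
  also have "\<dots> < top" using x f(1) by (auto simp: mo_class_def ennreal_mult_less_top)
  finally show ?thesis .
qed

lemma delta2_I_finite:
  assumes d2: "delta2 M \<Phi>" and x: "x \<in> E"
  shows "I (\<lambda>t. k * x t) < top"
proof -
  note [measurable] = measurable_E[OF x]
  obtain l where l: "0 < l" "I (\<lambda>t. l * x t) < top" using E_E x by blast
  have pow: "I (\<lambda>t. 2 ^ n * (l * x t)) < top" for n
  proof (induction n)
    case (Suc n)
    show ?case using delta2_doubling[OF d2 _ Suc] by (simp add: mult.assoc)
  qed (use l in simp)
  obtain n where n: "\<bar>k\<bar> / l < 2 ^ n" using real_arch_pow[of 2 "\<bar>k\<bar> / l"] by auto
  have "I (\<lambda>t. k * x t) \<le> I (\<lambda>t. 2 ^ n * (l * x t))"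
  proof (rule I_mono)
    fix t
    have "\<bar>k\<bar> \<le> 2 ^ n * l" using n l by (simp add: field_simps)
    then have "\<bar>k\<bar> * \<bar>x t\<bar> \<le> 2 ^ n * l * \<bar>x t\<bar>" by (rule mult_right_mono) simp
    then show "\<bar>k * x t\<bar> \<le> \<bar>2 ^ n * (l * x t)\<bar>" using l by (simp add: abs_mult mult.assoc)
  qed
  then show ?thesis using pow by (rule le_less_trans)
qed

text \<open>The doubling inequality propagates finiteness upwards from any positive argument above
  \<open>f t\<close> with a finite value. The maximum with \<open>d\<close> provides one even where
  \<open>f t = 0\<close>.\<close>

lemma delta2_finite:
  assumes d2: "delta2 M \<Phi>"
  shows "AE t in M. \<forall>u<top. \<Phi> t u < top"
proof -
  obtain f K where f: "f \<in> mo_class M \<Phi>" "\<And>t. t \<in> space M \<Longrightarrow> 0 \<le> f t" "0 < K"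
    "AE t in M. \<forall>u\<ge>ennreal (f t). \<Phi> t (2 * u) \<le> ennreal K * \<Phi> t u"
    using d2 unfolding delta2_def by blast
  have [measurable]: "f \<in> borel_measurable M" using f(1) by (simp add: mo_class_def)
  have "AE t in M. \<Phi> t (ennreal \<bar>f t\<bar>) \<noteq> \<infinity>"
    using f(1) unfolding mo_class_def modular_def by (intro nn_integral_PInf_AE) auto
  with f(4) AE_space show ?thesis
  proof eventually_elim
    case (elim t)
    obtain d where d: "0 < d" "\<Phi> t (ennreal d) < top" using young_small[OF young, of top t] by auto
    define v where "v = max d (f t)"
    have v: "0 < v" "ennreal (f t) \<le> ennreal v" using d by (auto simp: v_def intro: ennreal_leI)
    have v0: "\<Phi> t (ennreal v) < top" using d elim(3) f(2)[OF elim(2)] by (auto simp: v_def max_def less_top)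
    have pow: "\<Phi> t (ennreal (2 ^ n * v)) < top" for n
    proof (induction n)
      case (Suc n)
      have "1 * v \<le> 2 ^ n * v" using v by (intro mult_right_mono) auto
      then have "ennreal (f t) \<le> ennreal (2 ^ n * v)" using v(2) ennreal_leI order_trans by fastforce
      then have "\<Phi> t (2 * ennreal (2 ^ n * v)) \<le> ennreal K * \<Phi> t (ennreal (2 ^ n * v))" using elim(1) by blast
      also have "\<dots> < top" using Suc by (simp add: ennreal_mult_less_top)
      also have "2 * ennreal (2 ^ n * v) = ennreal (2 ^ Suc n * v)"
        using v ennreal_mult[of 2 "2 ^ n * v"] by (simp add: mult.assoc)
      finally show ?case .
    qed (use v0 in simp)
    show ?case
    proof (intro allI impI)
      fix u :: ennreal assume "u < top"
      then obtain r where r: "u = ennreal r" "0 \<le> r" by (auto simp: less_top_ennreal)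
      obtain n where "r / v < 2 ^ n" using real_arch_pow[of 2 "r / v"] by auto
      then have "u \<le> ennreal (2 ^ n * v)" using v r by (intro ord_eq_le_trans[OF r(1)] ennreal_leI) (simp add: field_simps)
      then have "\<Phi> t u \<le> \<Phi> t (ennreal (2 ^ n * v))" by (rule young_mono[OF young])
      then show "\<Phi> t u < top" using pow by (rule le_less_trans)
    qed
  qed
qed

text \<open>Pointwise equality in Young's inequality together with \<open>J w = 1\<close> makes the
  upper bound by the modular and the lower bound by the pairing coincide. It serves both the kink
  construction and the sufficiency part.\<close>

lemma amemiya_attained:
  assumes [measurable]: "x \<in> borel_measurable M" "w \<in> borel_measurable M" and k: "0 < k"
    and eq: "\<And>t. ennreal (k * \<bar>x t\<bar> * \<bar>w t\<bar>) = \<Phi> t (ennreal (k * \<bar>x t\<bar>)) + \<Psi> t (ennreal \<bar>w t\<bar>)"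
    and nn: "\<And>t. 0 \<le> x t * w t" and J: "J w = 1" and I: "I (\<lambda>t. k * x t) < top"
  shows "x \<in> E" "w \<in> V" "ennreal (k * (\<integral>t. x t * w t \<partial>M)) = 1 + I (\<lambda>t. k * x t)"
    "N x = (\<integral>t. x t * w t \<partial>M)" "0 < N x"
proof -
  show x: "x \<in> E" by (rule E_I[OF _ k I]) measurable
  show w: "w \<in> V" using J by (simp add: V_def)
  have int: "integrable M (\<lambda>t. x t * w t)" by (rule integrable_pairing[OF x V_D(1,3)[OF w]])
  have "ennreal (k * (\<integral>t. x t * w t \<partial>M)) = ennreal (\<integral>t. k * (x t * w t) \<partial>M)" by simp
  also have "\<dots> = (\<integral>\<^sup>+t. ennreal (k * (x t * w t)) \<partial>M)"
    using int nn k by (intro nn_integral_eq_integral[symmetric]) auto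
  also have "\<dots> = (\<integral>\<^sup>+t. \<Phi> t (ennreal \<bar>k * x t\<bar>) + \<Psi> t (ennreal \<bar>w t\<bar>) \<partial>M)"
  proof (rule nn_integral_cong)
    fix t
    have "k * (x t * w t) = k * \<bar>x t\<bar> * \<bar>w t\<bar>" using nn[of t] by (metis abs_mult abs_of_nonneg mult.assoc)
    then show "ennreal (k * (x t * w t)) = \<Phi> t (ennreal \<bar>k * x t\<bar>) + \<Psi> t (ennreal \<bar>w t\<bar>)"
      using eq[of t] k by (simp add: abs_mult mult.assoc)
  qed
  also have "\<dots> = I (\<lambda>t. k * x t) + J w" unfolding modular_def J_def by (rule nn_integral_add) measurable
  finally show *: "ennreal (k * (\<integral>t. x t * w t \<partial>M)) = 1 + I (\<lambda>t. k * x t)" by (simp add: J add.commute)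
  have "N x \<le> (\<integral>t. x t * w t \<partial>M)" using * by (intro N_le_modular[OF x k]) simp
  moreover have "(\<integral>t. x t * w t \<partial>M) \<le> N x" using pairing_le_N[OF x w] by simp
  ultimately show **: "N x = (\<integral>t. x t * w t \<partial>M)" by simp
  have "0 < ennreal (k * N x)" unfolding ** * by (simp add: add_pos_nonneg)
  then show "0 < N x" using k by (simp add: zero_less_mult_iff)
qed

end

subsection \<open>Kinks\<close>

text \<open>Finite values give a derivative at every argument. Under the doubling condition they
  hold almost everywhere, and everywhere after a further change on a null set.\<close>

locale finite_young_family = young_family +
  assumes finite_values: "\<And>t u. u < top \<Longrightarrow> \<Phi> t u < top"
begin

lemma finite_young: "finite_young (\<Phi> t)"
  by unfold_locales (auto intro: young finite_values)

lemmas eq_rf = finite_young.eq_rf[OF finite_young]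
  and rd_nonneg = finite_young.rd_nonneg[OF finite_young]
  and rf_ge_tangent = finite_young.rf_ge_tangent[OF finite_young]
  and rd_mono = finite_young.rd_mono[OF finite_young]
  and rf_le_rd = finite_young.rf_le_rd[OF finite_young]
  and rd_le_rf = finite_young.rd_le_rf[OF finite_young]
  and conjugate_rd = finite_young.conjugate_rd[OF finite_young]
  and conjugate_slope_mono = finite_young.conjugate_slope_mono[OF finite_young]

lemma measurable_rf[measurable]:
  assumes [measurable]: "w \<in> borel_measurable M"
  shows "(\<lambda>t. rf (\<Phi> t) (w t)) \<in> borel_measurable M"
  unfolding rf_def by measurable

lemma measurable_rd[measurable]:
  assumes [measurable]: "w \<in> borel_measurable M"
  shows "(\<lambda>t. rd (\<Phi> t) (w t)) \<in> borel_measurable M"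
  unfolding rd_def
proof (rule borel_measurable_cINF)
  show "bdd_below (range (\<lambda>n::nat. (rf (\<Phi> t) (w t + 1 / (real n + 1)) - rf (\<Phi> t) (w t)) * (real n + 1)))" for t
    by (rule bdd_belowI2[of _ 0]) (auto intro!: finite_young.rf_mono[OF finite_young] mult_nonneg_nonneg)
qed (auto intro!: countableI_type)

lemma tangent_eq:
  assumes "0 \<le> u"
  shows "ennreal (u * rd (\<Phi> t) u) = \<Phi> t (ennreal u) + \<Psi> t (ennreal (rd (\<Phi> t) u))"
proof -
  have "0 \<le> u * rd (\<Phi> t) u - rf (\<Phi> t) u" using rf_le_rd[OF assms] by simp
  then have "ennreal (rf (\<Phi> t) u + (u * rd (\<Phi> t) u - rf (\<Phi> t) u)) = ennreal (rf (\<Phi> t) u) + ennreal (u * rd (\<Phi> t) u - rf (\<Phi> t) u)"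
    by (intro ennreal_plus) (auto simp: rf_def)
  then show ?thesis by (simp add: conjugate_rd[OF assms] eq_rf)
qed

text \<open>Where \<open>y t > 0\<close>, the endpoint condition makes the conjugate along the
  derivative unbounded. Monotone convergence transfers this to the integrals, so \<open>J\<close>
  can be raised past any level.\<close>

lemma integral_slope_unbounded:
  assumes inf: "AE t in M. \<Psi> t (b t) = top" and y[measurable]: "y \<in> borel_measurable M" and ynn: "\<And>t. 0 \<le> y t"
    and pos: "\<not> (AE t in M. y t = 0)"
  shows "(SUP m::nat. \<integral>\<^sup>+t. \<Psi> t (ennreal (rd (\<Phi> t) (m * y t))) \<partial>M) = top"
proof -
  have slope: "\<Psi> t (ennreal (rd (\<Phi> t) (real m * y t))) = ennreal (m * y t * rd (\<Phi> t) (m * y t) - rf (\<Phi> t) (m * y t))" for t m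
    using ynn by (intro conjugate_rd) simp
  have "(SUP m::nat. \<integral>\<^sup>+t. \<Psi> t (ennreal (rd (\<Phi> t) (m * y t))) \<partial>M) = (\<integral>\<^sup>+t. (SUP m::nat. \<Psi> t (ennreal (rd (\<Phi> t) (m * y t)))) \<partial>M)"
    using ynn
    by (intro nn_integral_monotone_convergence_SUP[symmetric])
      (auto simp: incseq_def le_fun_def intro!: conjugate_mono ennreal_leI rd_mono mult_right_mono)
  also have "\<dots> = top"
  proof (rule ccontr)
    assume "\<not> ?thesis"
    then have "AE t in M. (SUP m::nat. \<Psi> t (ennreal (rd (\<Phi> t) (m * y t)))) \<noteq> \<infinity>"
      by (intro nn_integral_PInf_AE) (auto simp: infinity_ennreal_def)
    with inf have "AE t in M. y t = 0"
    proof eventually_elim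
      case (elim t)
      show ?case
      proof (rule ccontr)
        assume "y t \<noteq> 0"
        then have yt: "0 < y t" using ynn[of t] by simp
        obtain L where L: "(SUP m::nat. \<Psi> t (ennreal (rd (\<Phi> t) (m * y t)))) = ennreal L" "0 \<le> L"
          using elim(2) by (metis infinity_ennreal_def less_top less_top_ennreal)
        obtain u where u: "0 \<le> u" "L < u * rd (\<Phi> t) u - rf (\<Phi> t) u"
          using finite_young.conjugate_slope_unbounded[OF finite_young, of t L] elim(1) unfolding b_def by blast
        obtain m :: nat where m: "u / y t < m" using reals_Archimedean2 by blast
        then have um: "u \<le> m * y t" using yt by (simp add: field_simps)
        have "ennreal (m * y t * rd (\<Phi> t) (m * y t) - rf (\<Phi> t) (m * y t)) \<le> ennreal L"
          unfolding slope[symmetric] L(1)[symmetric] by (rule SUP_upper) simp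
        then have "m * y t * rd (\<Phi> t) (m * y t) - rf (\<Phi> t) (m * y t) \<le> L" using L(2) by (simp add: ennreal_le_iff)
        then show False using conjugate_slope_mono[OF u(1) um, of t] u(2) by simp
      qed
    qed
    then show False using pos by simp
  qed
  finally show ?thesis .
qed

lemma smooth_imp_no_kink:
  assumes na: "non_atomic M" and smooth: "smooth_space M E N" and inf: "AE t in M. \<Psi> t (b t) = top"
  assumes v: "0 \<le> v" "v < w"
  shows "AE t in M. \<Psi> t (ennreal w) < top \<longrightarrow> \<Psi> t (ennreal v) + \<Psi> t (ennreal w) \<noteq> 2 * \<Psi> t (ennreal ((v + w) / 2))"
proof (rule ccontr)
  assume "\<not> ?thesis"
  then have pos: "0 < emeasure M {t \<in> space M. \<not> (\<Psi> t (ennreal w) < top \<longrightarrow> \<Psi> t (ennreal v) + \<Psi> t (ennreal w) \<noteq> 2 * \<Psi> t (ennreal ((v + w) / 2)))}"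
    by (intro not_AE_positive) auto
  define A where "A = {t \<in> space M. \<not> (\<Psi> t (ennreal w) < top \<longrightarrow> \<Psi> t (ennreal v) + \<Psi> t (ennreal w) \<noteq> 2 * \<Psi> t (ennreal ((v + w) / 2)))}"
  have [measurable]: "A \<in> sets M" unfolding A_def by measurable
  \<comment> \<open>The slope of the affine piece of the conjugate is the location of the kink: both
    \<open>v\<close> and \<open>w\<close> give equality in Young's inequality at
    \<open>a t\<close>.\<close>
  define a where "a = (\<lambda>t. (enn2real (\<Psi> t (ennreal w)) - enn2real (\<Psi> t (ennreal v))) / (w - v))"
  have [measurable]: "a \<in> borel_measurable M" unfolding a_def by measurable
  have aA: "0 \<le> a t" "ennreal (a t * v) = \<Phi> t (ennreal (a t)) + \<Psi> t (ennreal v)"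
      "ennreal (a t * w) = \<Phi> t (ennreal (a t)) + \<Psi> t (ennreal w)" "\<Psi> t (ennreal w) < top" "\<Psi> t (ennreal v) < top" if "t \<in> A" for t
  proof -
    have *: "\<Psi> t (ennreal w) < top" "\<Psi> t (ennreal v) + \<Psi> t (ennreal w) = 2 * \<Psi> t (ennreal ((v + w) / 2))"
      using that by (auto simp: A_def)
    show "0 \<le> a t" "ennreal (a t * v) = \<Phi> t (ennreal (a t)) + \<Psi> t (ennreal v)"
      "ennreal (a t * w) = \<Phi> t (ennreal (a t)) + \<Psi> t (ennreal w)"
      unfolding a_def by (rule conjugate_affine[OF young v *])+
    show "\<Psi> t (ennreal w) < top" by fact
    show "\<Psi> t (ennreal v) < top" using conjugate_mono[of "ennreal v" "ennreal w"] * v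
      by (meson ennreal_leI le_less_trans less_imp_le)
  qed
  \<comment> \<open>The two selections will differ on a part of \<open>A1\<close>; the disjoint part
    \<open>A - A1\<close> is reserved for filling \<open>J\<close> up to 1.\<close>
  obtain A1 where A1[measurable]: "A1 \<in> sets M" and A1A: "A1 \<subseteq> A" and A1p: "0 < emeasure M A1" and A2p: "0 < emeasure M (A - A1)"
    using non_atomic_split[OF na \<open>A \<in> sets M\<close>] pos by (auto simp: A_def)
  obtain S :: "nat \<Rightarrow> 'a set" where S: "\<And>n. S n \<in> sets M" "incseq S" "(\<Union>n. S n) = space M" "\<And>n. emeasure M (S n) < top"
    using indicator_in_E by metis
  note [measurable] = S(1)
  \<comment> \<open>Bounding \<open>\<Phi> t (a t)\<close> on a set of finite measure keeps the
    modular of \<open>x\<close> finite.\<close>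
  define S' where "S' = (\<lambda>n. {t \<in> space M. t \<in> S n \<and> \<Phi> t (ennreal (a t)) \<le> of_nat n})"
  have [measurable]: "S' n \<in> sets M" for n unfolding S'_def by measurable
  have "A1 \<subseteq> (\<Union>n. S' n)"
  proof
    fix t assume "t \<in> A1"
    then have t: "t \<in> space M" using A1A by (auto simp: A_def)
    obtain i where i: "t \<in> S i" using S(3) t by auto
    have "\<Phi> t (ennreal (a t)) < top" by (rule finite_values) simp
    then obtain j :: nat where j: "\<Phi> t (ennreal (a t)) < of_nat j" using ennreal_Ex_less_of_nat by blast
    have "(of_nat j :: ennreal) \<le> of_nat (max i j)" by (intro of_nat_mono) simp
    then have "\<Phi> t (ennreal (a t)) \<le> of_nat (max i j)" using j by (rule order_trans[OF less_imp_le, rotated])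
    moreover have "t \<in> S (max i j)" using incseqD[OF S(2), of i "max i j"] i by auto
    ultimately have "t \<in> S' (max i j)" using t by (simp add: S'_def)
    then show "t \<in> (\<Union>n. S' n)" by blast
  qed
  then obtain n where n: "0 < emeasure M (A1 \<inter> S' n)" using incseq_positive_measure[OF A1 A1p, of S'] by auto
  define D where "D = A1 \<inter> S' n"
  have D[measurable]: "D \<in> sets M" unfolding D_def by measurable
  have DA: "t \<in> A" if "t \<in> D" for t using that A1A by (auto simp: D_def)
  \<comment> \<open>The bound \<open>1/2\<close> keeps the contribution of \<open>B\<close> to
    \<open>J\<close> below 1, so a nonnegative rest \<open>1 - r0\<close> remains to be filled. The
    summand 1 in the integrand guarantees that the value \<open>c > 0\<close> is reached.\<close>
  define c where "c = min (ennreal (1 / 2)) (emeasure M D)"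
  have "0 < ennreal (1 / 2)" by (rule ennreal_less_zero_iff[THEN iffD2]) simp
  then have c: "0 < c" "c \<le> ennreal (1 / 2)" using n unfolding c_def D_def by (simp_all only: min_less_iff_conj min.cobounded1)
  have "c \<le> (\<integral>\<^sup>+t. indicator D t \<partial>M)" by (simp add: c_def)
  also have "\<dots> \<le> (\<integral>\<^sup>+t\<in>D. (\<Psi> t (ennreal w) + 1) \<partial>M)" by (intro nn_integral_mono) (auto simp: indicator_def)
  finally have cD: "c \<le> (\<integral>\<^sup>+t\<in>D. (\<Psi> t (ennreal w) + 1) \<partial>M)" .
  have ctop: "c < top" using c(2) ennreal_less_top by (rule le_less_trans)
  obtain B where B[measurable]: "B \<in> sets M" and BD: "B \<subseteq> D" and Bc: "(\<integral>\<^sup>+t\<in>B. (\<Psi> t (ennreal w) + 1) \<partial>M) = c"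
    using aA(4) DA by (rule_tac exact_integral[OF na D _ _ cD ctop]) auto
  have BA: "t \<in> A" if "t \<in> B" for t using that BD DA by blast
  have Bpos: "B \<notin> null_sets M"
  proof
    assume "B \<in> null_sets M"
    then have "(\<integral>\<^sup>+t\<in>B. (\<Psi> t (ennreal w) + 1) \<partial>M) = 0" by (rule nn_integral_null_set)
    then show False using Bc c by simp
  qed
  have "(\<integral>\<^sup>+t\<in>B. \<Psi> t (ennreal w) \<partial>M) \<le> (\<integral>\<^sup>+t\<in>B. (\<Psi> t (ennreal w) + 1) \<partial>M)"
    by (intro nn_integral_mono mult_right_mono) auto
  then have Bw: "(\<integral>\<^sup>+t\<in>B. \<Psi> t (ennreal w) \<partial>M) \<le> ennreal (1 / 2)" using Bc c by simp
  \<comment> \<open>\<open>d\<close> is the cost of choosing \<open>w\<close> instead of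
    \<open>v\<close>. Halving its integral over \<open>B\<close> allows the choices on the two
    halves to be exchanged without changing \<open>J\<close>.\<close>
  define d where "d = (\<lambda>t. \<Psi> t (ennreal w) - \<Psi> t (ennreal v))"
  have [measurable]: "d \<in> borel_measurable M" unfolding d_def by measurable
  have dw: "\<Psi> t (ennreal w) = \<Psi> t (ennreal v) + d t" for t
    unfolding d_def using v by (intro add_diff_inverse_ennreal[symmetric] conjugate_mono ennreal_leI) auto
  have dle: "d t \<le> \<Psi> t (ennreal w)" for t unfolding d_def by (rule diff_le_self_ennreal)
  have "(\<integral>\<^sup>+t\<in>B. d t \<partial>M) \<le> ennreal (1 / 2)"
    using dle by (intro order_trans[OF nn_integral_mono Bw] mult_right_mono) auto
  then obtain e where e: "(\<integral>\<^sup>+t\<in>B. d t \<partial>M) = ennreal e" "0 \<le> e"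
    using le_less_trans[OF _ ennreal_less_top] by (metis less_top_ennreal)
  obtain B1 where B1[measurable]: "B1 \<in> sets M" and B1B: "B1 \<subseteq> B" and B1e: "(\<integral>\<^sup>+t\<in>B1. d t \<partial>M) = ennreal (e / 2)"
    using e aA(4) BA
    by (rule_tac exact_integral[OF na B, of d "ennreal (e / 2)"]) (auto intro: ennreal_leI le_less_trans[OF dle])
  have split: "(\<integral>\<^sup>+t\<in>B. f t \<partial>M) = (\<integral>\<^sup>+t\<in>C. f t \<partial>M) + (\<integral>\<^sup>+t\<in>B - C. f t \<partial>M)"
    if [measurable]: "f \<in> borel_measurable M" "C \<in> sets M" and "C \<subseteq> B" for f C
    using that(3) by (subst nn_integral_add[symmetric]) (auto intro!: nn_integral_cong simp: indicator_def)
  have "ennreal e = ennreal (e / 2) + (\<integral>\<^sup>+t\<in>B - B1. d t \<partial>M)" using split[of d B1] B1B e B1e by simp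
  then have B2e: "(\<integral>\<^sup>+t\<in>B - B1. d t \<partial>M) = ennreal (e / 2)"
  proof -
    assume *: "ennreal e = ennreal (e / 2) + (\<integral>\<^sup>+t\<in>B - B1. d t \<partial>M)"
    have "ennreal e = ennreal (e / 2) + ennreal (e / 2)" using e by (simp add: ennreal_plus[symmetric] del: ennreal_plus)
    then have "ennreal (e / 2) + (\<integral>\<^sup>+t\<in>B - B1. d t \<partial>M) = ennreal (e / 2) + ennreal (e / 2)"
      using * by (simp only:)
    then show ?thesis by (simp only: ennreal_add_left_cancel) simp
  qed
  \<comment> \<open>The selections use \<open>C = B1\<close> and \<open>C = B - B1\<close>: each
    takes the value \<open>w\<close> exactly on the half of \<open>B\<close> where the other takes
    \<open>v\<close>.\<close>
  define s where "s = (\<lambda>(C :: 'a set) t. if t \<in> C then v else w)"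
  have [measurable]: "s C \<in> borel_measurable M" if [measurable]: "C \<in> sets M" for C unfolding s_def by measurable
  define c0 where "c0 = (\<integral>\<^sup>+t\<in>B. \<Psi> t (ennreal v) \<partial>M) + ennreal (e / 2)"
  have sc: "(\<integral>\<^sup>+t\<in>B. \<Psi> t (ennreal (s C t)) \<partial>M) = c0"
    if C[measurable]: "C \<in> sets M" "C \<subseteq> B" "(\<integral>\<^sup>+t\<in>B - C. d t \<partial>M) = ennreal (e / 2)" for C
  proof -
    have "(\<integral>\<^sup>+t\<in>B. \<Psi> t (ennreal (s C t)) \<partial>M) = (\<integral>\<^sup>+t. \<Psi> t (ennreal v) * indicator B t + d t * indicator (B - C) t \<partial>M)"
      by (intro nn_integral_cong) (auto simp: s_def indicator_def dw)
    also have "\<dots> = c0" unfolding c0_def C(3)[symmetric] by (rule nn_integral_add) measurable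
    finally show ?thesis .
  qed
  have s1: "(\<integral>\<^sup>+t\<in>B. \<Psi> t (ennreal (s B1 t)) \<partial>M) = c0" using sc[OF B1 B1B B2e] .
  have "B - (B - B1) = B1" using B1B by auto
  then have s2: "(\<integral>\<^sup>+t\<in>B. \<Psi> t (ennreal (s (B - B1) t)) \<partial>M) = c0" using B1e by (intro sc) auto
  have "c0 \<le> (\<integral>\<^sup>+t\<in>B. \<Psi> t (ennreal w) \<partial>M)"
    unfolding s1[symmetric] using v by (intro nn_integral_mono mult_right_mono conjugate_mono ennreal_leI) (auto simp: s_def)
  then have "c0 \<le> ennreal (1 / 2)" using Bw by (rule order_trans)
  then obtain r0 where r0: "c0 = ennreal r0" "0 \<le> r0" "r0 \<le> 1 / 2"
    using le_less_trans[OF _ ennreal_less_top] unfolding less_top_ennreal by (metis ennreal_le_iff half_gt_zero_iff less_imp_le zero_less_one)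
  obtain n2 where n2: "0 < emeasure M ((A - A1) \<inter> S n2)"
    using incseq_positive_measure[OF _ A2p, of S] S by (auto simp: A_def)
  \<comment> \<open>On this set \<open>x\<close> is a constant \<open>m\<close>, taken so large that
    the conjugate modular of \<open>rd (\<Phi> t) m\<close> exceeds 1; a subset then supplies
    exactly \<open>1 - r0\<close>.\<close>
  define C0 where "C0 = (A - A1) \<inter> S n2"
  have C0[measurable]: "C0 \<in> sets M" unfolding C0_def by measurable
  have "(SUP m::nat. \<integral>\<^sup>+t. \<Psi> t (ennreal (rd (\<Phi> t) (real m * indicator C0 t))) \<partial>M) = top"
  proof (rule integral_slope_unbounded[OF inf])
    show "\<not> (AE t in M. (indicator C0 t :: real) = 0)"
    proof
      assume "AE t in M. (indicator C0 t :: real) = 0"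
      then have "AE t in M. t \<notin> C0" by eventually_elim (auto simp: indicator_def)
      then have "C0 \<in> null_sets M" by (subst AE_iff_null_sets) auto
      then show False using n2 by (auto simp: C0_def)
    qed
  qed auto
  then have "1 < (SUP m::nat. \<integral>\<^sup>+t. \<Psi> t (ennreal (rd (\<Phi> t) (real m * indicator C0 t))) \<partial>M)" by (simp only: ennreal_one_less_top)
  then obtain m :: nat where m: "1 < (\<integral>\<^sup>+t. \<Psi> t (ennreal (rd (\<Phi> t) (real m * indicator C0 t))) \<partial>M)" by (auto simp: less_SUP_iff)
  define g where "g = (\<lambda>t. \<Psi> t (ennreal (rd (\<Phi> t) (real m))))"
  have [measurable]: "g \<in> borel_measurable M" unfolding g_def by measurable
  have gfin: "g t < top" for t unfolding g_def by (subst conjugate_rd) auto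
  have zero: "\<Psi> t (ennreal (rd (\<Phi> t) 0)) = 0" for t by (subst conjugate_rd) (auto simp: rf_def young_zero[OF young])
  have "(\<integral>\<^sup>+t. \<Psi> t (ennreal (rd (\<Phi> t) (real m * indicator C0 t))) \<partial>M) = (\<integral>\<^sup>+t\<in>C0. g t \<partial>M)"
    by (intro nn_integral_cong) (auto simp: g_def indicator_def zero)
  then have g1: "1 < (\<integral>\<^sup>+t\<in>C0. g t \<partial>M)" using m by simp
  \<comment> \<open>This truncation bounds \<open>\<Phi> t m\<close>, so the filling set also
    contributes only a finite amount to the modular of \<open>x\<close>.\<close>
  define G where "G = (\<lambda>p::nat. {t \<in> space M. t \<in> C0 \<and> \<Phi> t (ennreal (real m)) \<le> of_nat p})"
  have [measurable]: "G p \<in> sets M" for p unfolding G_def by measurable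
  have "\<exists>p. 1 < (\<integral>\<^sup>+t\<in>G p. g t \<partial>M)"
  proof (rule ccontr)
    assume "\<not> ?thesis"
    then have le: "(\<integral>\<^sup>+t\<in>G p. g t \<partial>M) \<le> 1" for p by (simp add: not_less)
    have "(\<integral>\<^sup>+t. g t * indicator C0 t \<partial>M) \<le> 1"
    proof (rule nn_integral_exhaust_le[where S = G])
      show "incseq G"
      proof (rule incseq_SucI, rule subsetI)
        fix p t assume "t \<in> G p"
        moreover have "(of_nat p :: ennreal) \<le> of_nat (Suc p)" by (intro of_nat_mono) simp
        ultimately show "t \<in> G (Suc p)" by (auto simp: G_def intro: order_trans)
      qed
      show "\<exists>p. t \<in> G p" if "t \<in> space M" "0 < g t * indicator C0 t" for t
      proof -
        have "t \<in> C0" using that by (cases "t \<in> C0") auto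
        obtain p :: nat where "\<Phi> t (ennreal (real m)) < of_nat p" using ennreal_Ex_less_of_nat[OF finite_values[of "ennreal (real m)" t]] by auto
        then show ?thesis using that \<open>t \<in> C0\<close> by (intro exI[of _ p]) (simp add: G_def)
      qed
      fix p
      have "(\<integral>\<^sup>+t\<in>G p. (g t * indicator C0 t) \<partial>M) = (\<integral>\<^sup>+t\<in>G p. g t \<partial>M)"
        by (intro nn_integral_cong) (auto simp: G_def indicator_def)
      then show "(\<integral>\<^sup>+t\<in>G p. (g t * indicator C0 t) \<partial>M) \<le> 1" using le by simp
    qed measurable
    then show False using g1 by simp
  qed
  then obtain p where p: "1 < (\<integral>\<^sup>+t\<in>G p. g t \<partial>M)" by blast
  have "ennreal (1 - r0) \<le> 1" using r0 by (simp add: ennreal_le_1)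
  then have "ennreal (1 - r0) \<le> (\<integral>\<^sup>+t\<in>G p. g t \<partial>M)" using p by (meson less_imp_le order_trans)
  then obtain C where C[measurable]: "C \<in> sets M" and CG: "C \<subseteq> G p" and Cg: "(\<integral>\<^sup>+t\<in>C. g t \<partial>M) = ennreal (1 - r0)"
    using gfin by (rule_tac exact_integral[OF na _ _ _ _ ennreal_less_top]) auto
  have BC: "t \<notin> B" if "t \<in> C" for t using that CG BD by (auto simp: G_def C0_def D_def)
  define x where "x = (\<lambda>t. if t \<in> B then a t else if t \<in> C then real m else 0)"
  define W where "W = (\<lambda>H t. if t \<in> B then s H t else if t \<in> C then rd (\<Phi> t) (real m) else 0)"
  have [measurable]: "x \<in> borel_measurable M" unfolding x_def by measurable
  have [measurable]: "W H \<in> borel_measurable M" if [measurable]: "H \<in> sets M" for H unfolding W_def by measurable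
  have xnn: "0 \<le> x t" for t using aA(1) BA by (auto simp: x_def)
  have snn: "0 \<le> s H t" for H t using v by (auto simp: s_def)
  have Wnn: "0 \<le> W H t" for H t using snn rd_nonneg by (auto simp: W_def)
  have eq: "ennreal (1 * \<bar>x t\<bar> * \<bar>W H t\<bar>) = \<Phi> t (ennreal (1 * \<bar>x t\<bar>)) + \<Psi> t (ennreal \<bar>W H t\<bar>)" for H t
  proof -
    have "ennreal (x t * W H t) = \<Phi> t (ennreal (x t)) + \<Psi> t (ennreal (W H t))"
      using aA(2,3)[OF BA[of t]] tangent_eq[of "real m" t] by (auto simp: x_def W_def s_def young_zero[OF young])
    then show ?thesis using xnn Wnn by simp
  qed
  have Ix: "I (\<lambda>t. 1 * x t) < top"
  proof -
    have "I (\<lambda>t. 1 * x t) \<le> (\<integral>\<^sup>+t. of_nat n * indicator (S n) t + of_nat p * indicator (S n2) t \<partial>M)"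
      unfolding modular_def
    proof (rule nn_integral_mono)
      fix t assume "t \<in> space M"
      consider "t \<in> B" | "t \<in> C" "t \<notin> B" | "t \<notin> B" "t \<notin> C" by blast
      then show "\<Phi> t (ennreal \<bar>1 * x t\<bar>) \<le> of_nat n * indicator (S n) t + of_nat p * indicator (S n2) t"
      proof cases
        case 1
        then have "t \<in> S n" "\<Phi> t (ennreal (a t)) \<le> of_nat n" using BD by (auto simp: D_def S'_def)
        then show ?thesis using 1 aA(1)[OF BA] by (simp add: x_def add_increasing2)
      next
        case 2
        then have "t \<in> S n2" "\<Phi> t (ennreal (real m)) \<le> of_nat p" using CG by (auto simp: G_def C0_def)
        then show ?thesis using 2 by (simp add: x_def add_increasing)
      qed (simp add: x_def young_zero[OF young])
    qed
    also have "\<dots> = of_nat n * emeasure M (S n) + of_nat p * emeasure M (S n2)"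
      by (subst nn_integral_add) (auto simp: nn_integral_cmult_indicator)
    also have "\<dots> < top" using S(4) by (simp add: ennreal_mult_less_top of_nat_less_top)
    finally show ?thesis .
  qed
  have JW: "J (W H) = 1" if [measurable]: "H \<in> sets M" and H: "(\<integral>\<^sup>+t\<in>B. \<Psi> t (ennreal (s H t)) \<partial>M) = c0" for H
  proof -
    have "J (W H) = (\<integral>\<^sup>+t. \<Psi> t (ennreal (s H t)) * indicator B t + g t * indicator C t \<partial>M)"
      unfolding J_def
      using BC snn rd_nonneg by (intro nn_integral_cong) (auto simp: W_def g_def indicator_def)
    also have "\<dots> = c0 + ennreal (1 - r0)" unfolding H[symmetric] Cg[symmetric] by (rule nn_integral_add) measurable
    also have "\<dots> = 1" using r0 by (simp add: ennreal_plus[symmetric] del: ennreal_plus)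
    finally show ?thesis .
  qed
  have B2: "B - B1 \<in> sets M" by measurable
  have xm: "x \<in> borel_measurable M" and Wm: "W B1 \<in> borel_measurable M" "W (B - B1) \<in> borel_measurable M" by measurable
  note at1 = amemiya_attained[OF xm Wm(1) zero_less_one eq mult_nonneg_nonneg[OF xnn Wnn] JW[OF B1 s1] Ix]
  note at2 = amemiya_attained[OF xm Wm(2) zero_less_one eq mult_nonneg_nonneg[OF xnn Wnn] JW[OF B2 s2] Ix]
  \<comment> \<open>The selections disagree at every point of \<open>B\<close>, which is not null;
    this holds even if \<open>e = 0\<close>.\<close>
  have ne: "\<not> (AE t in M. W B1 t = W (B - B1) t)"
  proof
    assume "AE t in M. W B1 t = W (B - B1) t"
    then have "AE t in M. t \<notin> B"
    proof eventually_elim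
      case (elim t)
      then show ?case using v B1B by (auto simp: W_def s_def split: if_splits)
    qed
    then have "B \<in> null_sets M" by (subst AE_iff_null_sets) auto
    then show False using Bpos by simp
  qed
  have "\<not> smooth_space M E N"
    by (rule not_smooth_if_two[OF at1(1,2) at2(2) at1(5) eq_refl[OF at1(4)] eq_refl[OF at2(4)] ne])
  then show False using smooth by simp
qed

text \<open>The exceptional null set for an affine piece depends on its endpoints, so only the
  countably many rational pairs are collected; \<open>no_kink\<close> needs no others.\<close>

lemma smooth_imp_differentiable:
  assumes na: "non_atomic M" and smooth: "smooth_space M E N" and inf: "AE t in M. \<Psi> t (b t) = top"
  shows "AE t in M. continuously_differentiable (\<Phi> t) \<and> has_right_derivative (\<Phi> t) 0 0"
proof -
  have "AE t in M. qseq i < qseq j \<longrightarrow> \<Psi> t (ennreal (qseq j)) < top \<longrightarrow>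
      \<Psi> t (ennreal (qseq i)) + \<Psi> t (ennreal (qseq j)) \<noteq> 2 * \<Psi> t (ennreal ((qseq i + qseq j) / 2))" for i j
    using smooth_imp_no_kink[OF na smooth inf, of "qseq i" "qseq j"] by (cases "qseq i < qseq j") auto
  then have "AE t in M. \<forall>i j. qseq i < qseq j \<longrightarrow> \<Psi> t (ennreal (qseq j)) < top \<longrightarrow>
      \<Psi> t (ennreal (qseq i)) + \<Psi> t (ennreal (qseq j)) \<noteq> 2 * \<Psi> t (ennreal ((qseq i + qseq j) / 2))"
    unfolding AE_all_countable by blast
  then show ?thesis
  proof eventually_elim
    case (elim t)
    then show ?case using finite_young.no_kink_imp_smooth[OF finite_young, of t] by blast
  qed
qed

end

subsection \<open>Sufficiency\<close>

context finite_young_family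
begin

lemma smooth_if_differentiable:
  assumes inf: "AE t in M. \<Psi> t (b t) = top" and d2: "delta2 M \<Phi>"
    and diff: "AE t in M. continuously_differentiable (\<Phi> t) \<and> has_right_derivative (\<Phi> t) 0 0"
  shows "smooth_space M E N"
  unfolding smooth_space_def smooth_point_def
proof (intro ballI impI conjI)
  fix x assume x: "x \<in> E" and x0: "\<not> (AE t in M. x t = 0)"
  note [measurable] = measurable_E[OF x]
  have cont: "AE t in M. continuous_on {0..} (rf (\<Phi> t)) \<and> continuous_on {0..} (rd (\<Phi> t)) \<and> rd (\<Phi> t) 0 = 0"
    using diff by eventually_elim (use rd_continuous[OF young] in blast)
  have rf0: "0 \<le> rf (\<Phi> t) u" for t u by (simp add: rf_def)
  have int_rf: "integrable M (\<lambda>t. rf (\<Phi> t) (k * \<bar>u t\<bar>))" "I (\<lambda>t. k * u t) = ennreal (\<integral>t. rf (\<Phi> t) (k * \<bar>u t\<bar>) \<partial>M)"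
    if u: "u \<in> E" and k: "0 \<le> k" for u k
  proof -
    note [measurable] = measurable_E[OF u]
    have I: "I (\<lambda>t. k * u t) = (\<integral>\<^sup>+t. ennreal (rf (\<Phi> t) (k * \<bar>u t\<bar>)) \<partial>M)"
      unfolding modular_def using k by (simp add: eq_rf abs_mult)
    then have "(\<integral>\<^sup>+t. ennreal (rf (\<Phi> t) (k * \<bar>u t\<bar>)) \<partial>M) < \<infinity>" using delta2_I_finite[OF d2 u, of k] by simp
    then show int: "integrable M (\<lambda>t. rf (\<Phi> t) (k * \<bar>u t\<bar>))"
      using rf0 by (intro integrableI_nonneg) auto
    show "I (\<lambda>t. k * u t) = ennreal (\<integral>t. rf (\<Phi> t) (k * \<bar>u t\<bar>) \<partial>M)"
      unfolding I using int rf0 by (intro nn_integral_eq_integral) auto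
  qed
  \<comment> \<open>\<open>s k t\<close> is the conjugate at the derivative
    \<open>rd (\<Phi> t) (k \<bar>x t\<bar>)\<close>. It is bounded by \<open>\<Phi> t\<close> at
    twice the argument, which the doubling condition makes integrable.\<close>
  define s where "s = (\<lambda>k t. k * \<bar>x t\<bar> * rd (\<Phi> t) (k * \<bar>x t\<bar>) - rf (\<Phi> t) (k * \<bar>x t\<bar>))"
  have sm[measurable]: "s k \<in> borel_measurable M" for k unfolding s_def by measurable
  have s0: "0 \<le> s k t" if "0 \<le> k" for k t unfolding s_def using rf_le_rd[of "k * \<bar>x t\<bar>" t] that by simp
  have sle: "s k t \<le> rf (\<Phi> t) (2 * m * \<bar>x t\<bar>)" if "0 \<le> k" "k \<le> m" for k m t
  proof -
    have "s k t \<le> m * \<bar>x t\<bar> * rd (\<Phi> t) (m * \<bar>x t\<bar>) - rf (\<Phi> t) (m * \<bar>x t\<bar>)"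
      unfolding s_def using that by (intro conjugate_slope_mono mult_right_mono) auto
    also have "\<dots> \<le> m * \<bar>x t\<bar> * rd (\<Phi> t) (m * \<bar>x t\<bar>)" using rf0 by simp
    also have "\<dots> \<le> rf (\<Phi> t) (2 * (m * \<bar>x t\<bar>))" using that by (intro rd_le_rf) auto
    finally show ?thesis by (simp add: mult.assoc)
  qed
  have ints: "integrable M (s k)" if "0 \<le> k" for k
  proof (rule Bochner_Integration.integrable_bound[OF int_rf(1)[OF x, of "2 * k"] sm])
    show "0 \<le> 2 * k" using that by simp
    show "AE t in M. norm (s k t) \<le> norm (rf (\<Phi> t) (2 * k * \<bar>x t\<bar>))"
    proof (rule AE_I2)
      fix t
      show "norm (s k t) \<le> norm (rf (\<Phi> t) (2 * k * \<bar>x t\<bar>))"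
        using s0[OF that, of t] sle[OF that order_refl, of t] by (simp only: real_norm_def)
    qed
  qed
  have \<Psi>s: "\<Psi> t (ennreal (rd (\<Phi> t) (k * \<bar>x t\<bar>))) = ennreal (s k t)" if "0 \<le> k" for k t
    unfolding s_def using that by (intro conjugate_rd) auto
  define G where "G = (\<lambda>k. \<integral>t. s k t \<partial>M)"
  have G: "(\<integral>\<^sup>+t. \<Psi> t (ennreal (rd (\<Phi> t) (k * \<bar>x t\<bar>))) \<partial>M) = ennreal (G k)" if "0 \<le> k" for k
    unfolding G_def \<Psi>s[OF that] using ints[OF that] s0[OF that] by (intro nn_integral_eq_integral) auto
  have "(SUP m::nat. \<integral>\<^sup>+t. \<Psi> t (ennreal (rd (\<Phi> t) (m * \<bar>x t\<bar>))) \<partial>M) = top"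
    using x0 by (intro integral_slope_unbounded[OF inf]) auto
  then have "1 < (SUP m::nat. \<integral>\<^sup>+t. \<Psi> t (ennreal (rd (\<Phi> t) (m * \<bar>x t\<bar>))) \<partial>M)" by (simp only: ennreal_one_less_top)
  then obtain m :: nat where "1 < (\<integral>\<^sup>+t. \<Psi> t (ennreal (rd (\<Phi> t) (m * \<bar>x t\<bar>))) \<partial>M)" by (auto simp: less_SUP_iff)
  then have Gm: "1 \<le> G (real m)" by (simp add: G)
  have G0: "G 0 = 0" by (simp add: G_def s_def rf_def young_zero[OF young])
  \<comment> \<open>Continuity of \<open>rd\<close> gives pointwise convergence, and the value at
    \<open>2 m \<bar>x t\<bar>\<close> is a common majorant on \<open>{0..m}\<close>.\<close>
  have contG: "continuous_on {0..real m} G"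
  proof (rule continuous_on_sequentiallyI)
    fix l a assume l: "\<forall>n. l n \<in> {0..real m}" and a: "a \<in> {0..real m}" and lim: "l \<longlonglongrightarrow> a"
    show "(\<lambda>n. G (l n)) \<longlonglongrightarrow> G a"
      unfolding G_def
    proof (rule integral_dominated_convergence)
      show "integrable M (\<lambda>t. rf (\<Phi> t) (2 * real m * \<bar>x t\<bar>))" by (rule int_rf[OF x]) simp
      show "AE t in M. (\<lambda>n. s (l n) t) \<longlonglongrightarrow> s a t"
        using cont
      proof eventually_elim
        case (elim t)
        have lx: "(\<lambda>n. l n * \<bar>x t\<bar>) \<longlonglongrightarrow> a * \<bar>x t\<bar>" using lim by (intro tendsto_intros)
        have "a * \<bar>x t\<bar> \<in> {0..}" "eventually (\<lambda>n. l n * \<bar>x t\<bar> \<in> {0..}) sequentially" using l a by auto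
        then have "(\<lambda>n. rf (\<Phi> t) (l n * \<bar>x t\<bar>)) \<longlonglongrightarrow> rf (\<Phi> t) (a * \<bar>x t\<bar>)"
            "(\<lambda>n. rd (\<Phi> t) (l n * \<bar>x t\<bar>)) \<longlonglongrightarrow> rd (\<Phi> t) (a * \<bar>x t\<bar>)"
          by (rule continuous_on_tendsto_compose[OF conjunct1[OF elim] lx], rule continuous_on_tendsto_compose[OF conjunct1[OF conjunct2[OF elim]] lx])
        then show ?case unfolding s_def using lim by (intro tendsto_intros)
      qed
      show "AE t in M. norm (s (l n) t) \<le> rf (\<Phi> t) (2 * real m * \<bar>x t\<bar>)" for n
      proof (rule AE_I2)
        fix t
        have "0 \<le> l n" "l n \<le> real m" using l by auto
        then show "norm (s (l n) t) \<le> rf (\<Phi> t) (2 * real m * \<bar>x t\<bar>)"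
          using s0[of "l n" t] sle[of "l n" "real m" t] by (simp only: real_norm_def abs_of_nonneg)
      qed
    qed measurable
  qed
  obtain k where k: "0 \<le> k" "k \<le> real m" "G k = 1"
    using IVT'[of G 0 1 "real m"] G0 Gm contG by auto
  then have kpos: "0 < k" using G0 by (cases "k = 0") auto
  define w where "w = (\<lambda>t. rd (\<Phi> t) (k * \<bar>x t\<bar>) * sgn (x t))"
  have [measurable]: "w \<in> borel_measurable M" unfolding w_def by measurable
  \<comment> \<open>Where \<open>x t = 0\<close> the sign makes \<open>w t = 0\<close>, while
    \<open>rd (\<Phi> t) 0\<close> vanishes only for almost every \<open>t\<close>. Both have
    conjugate 0, so \<open>J w = G k\<close> needs no exception.\<close>
  have zero: "\<Psi> t (ennreal (rd (\<Phi> t) 0)) = 0" for t by (subst conjugate_rd) (auto simp: rf_def young_zero[OF young])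
  have wabs: "\<Psi> t (ennreal \<bar>w t\<bar>) = \<Psi> t (ennreal (rd (\<Phi> t) (k * \<bar>x t\<bar>)))" for t
    using rd_nonneg[of t] zero by (cases "x t = 0") (auto simp: w_def abs_mult abs_sgn_eq)
  have J: "J w = 1" unfolding J_def wabs G[OF k(1)] by (simp add: k)
  have eq: "ennreal (k * \<bar>x t\<bar> * \<bar>w t\<bar>) = \<Phi> t (ennreal (k * \<bar>x t\<bar>)) + \<Psi> t (ennreal \<bar>w t\<bar>)" for t
  proof (cases "x t = 0")
    case True
    then show ?thesis by (simp add: w_def young_zero[OF young])
  next
    case False
    then have "\<bar>w t\<bar> = rd (\<Phi> t) (k * \<bar>x t\<bar>)" using rd_nonneg by (auto simp: w_def abs_mult abs_sgn_eq)
    then show ?thesis using tangent_eq[of "k * \<bar>x t\<bar>" t] k(1) by simp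
  qed
  have xw: "0 \<le> x t * w t" for t
  proof -
    have "x t * w t = rd (\<Phi> t) (k * \<bar>x t\<bar>) * \<bar>x t\<bar>" by (simp add: w_def sgn_if)
    then show ?thesis using rd_nonneg by simp
  qed
  note att = amemiya_attained[OF _ _ kpos eq xw J delta2_I_finite[OF d2 x]]
  have wV: "w \<in> V" and Nx: "N x = (\<integral>t. x t * w t \<partial>M)" and Npos: "0 < N x" using att by auto
  have kN: "k * N x = 1 + (\<integral>t. rf (\<Phi> t) (k * \<bar>x t\<bar>) \<partial>M)"
  proof -
    have "0 \<le> (\<integral>t. rf (\<Phi> t) (k * \<bar>x t\<bar>) \<partial>M)" using rf0 by simp
    then have "ennreal (k * N x) = ennreal (1 + (\<integral>t. rf (\<Phi> t) (k * \<bar>x t\<bar>) \<partial>M))"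
      using att(3) int_rf(2)[OF x k(1)] Nx by simp
    moreover have "0 \<le> k * N x" using Npos kpos by simp
    moreover have "0 \<le> 1 + (\<integral>t. rf (\<Phi> t) (k * \<bar>x t\<bar>) \<partial>M)" using \<open>0 \<le> (\<integral>t. rf (\<Phi> t) (k * \<bar>x t\<bar>) \<partial>M)\<close> by simp
    ultimately show ?thesis by (simp only: ennreal_inj)
  qed
  have supp: "support_functional M E N x (\<lambda>u\<in>E. \<integral>t. u t * w t \<partial>M)"
    by (rule support_functional_pairing[OF x wV Npos]) (simp add: Nx)
  \<comment> \<open>At this fixed \<open>k\<close> the Amemiya expression dominates \<open>N\<close>
    everywhere and equals it at \<open>x\<close>, so \<open>F h\<close> is bounded by its difference
    quotients in direction \<open>h\<close>.\<close>
  have le: "F h \<le> (\<integral>t. h t * w t \<partial>M)" if F: "support_functional M E N x F" and h: "h \<in> E" for F h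
  proof -
    note [measurable] = measurable_E[OF h]
    note FD = support_functionalD[OF F x]
    define r where "r = (\<lambda>n::nat. 1 / (real n + 1))"
    have r: "0 < r n" "r n \<le> 1" for n by (auto simp: r_def)
    define z where "z = (\<lambda>n t. x t + r n * h t)"
    have z: "z n \<in> E" for n unfolding z_def by (intro E_add E_scale x h)
    note [measurable] = measurable_E[OF z]
    \<comment> \<open>The quotient is bounded by the slope at its far end \<open>z n\<close>, which
      needs only convexity; continuity of the derivative enters in the limit.\<close>
    define D where "D = (\<lambda>n t. rd (\<Phi> t) (k * \<bar>z n t\<bar>) * sgn (z n t) * h t)"
    have [measurable]: "D n \<in> borel_measurable M" for n unfolding D_def by measurable
    define q where "q = (\<lambda>t. \<bar>x t\<bar> + \<bar>h t\<bar>)"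
    have q: "q \<in> E" unfolding q_def by (intro E_add E_abs x h)
    have qabs: "\<bar>q t\<bar> = q t" for t by (simp add: q_def)
    have intq: "integrable M (\<lambda>t. rf (\<Phi> t) (2 * k * \<bar>q t\<bar>) / k)" using int_rf(1)[OF q, of "2 * k"] k by simp
    have Dle: "\<bar>D n t\<bar> \<le> rf (\<Phi> t) (2 * k * \<bar>q t\<bar>) / k" for n t
    proof -
      have "r n * \<bar>h t\<bar> \<le> 1 * \<bar>h t\<bar>" using r by (intro mult_right_mono) auto
      then have zq: "\<bar>z n t\<bar> \<le> q t" using abs_triangle_ineq[of "x t" "r n * h t"] r[of n] by (simp add: z_def q_def abs_mult)
      have "\<bar>D n t\<bar> \<le> rd (\<Phi> t) (k * \<bar>z n t\<bar>) * 1 * \<bar>h t\<bar>"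
        unfolding D_def abs_mult using rd_nonneg by (intro mult_mono) (auto simp: abs_sgn_eq)
      also have "\<dots> \<le> rd (\<Phi> t) (k * q t) * 1 * q t"
        using zq k rd_nonneg by (intro mult_mono rd_mono) (auto simp: q_def)
      also have "\<dots> = (k * q t * rd (\<Phi> t) (k * q t)) / k" using kpos by simp
      also have "\<dots> \<le> rf (\<Phi> t) (2 * (k * q t)) / k"
        using k by (intro divide_right_mono rd_le_rf) (auto simp: q_def)
      finally show ?thesis by (simp add: qabs mult.assoc)
    qed
    have intD: "integrable M (D n)" for n
    proof (rule Bochner_Integration.integrable_bound[OF intq])
      show "AE t in M. norm (D n t) \<le> norm (rf (\<Phi> t) (2 * k * \<bar>q t\<bar>) / k)"
        using order_trans[OF Dle abs_ge_self] by (intro AE_I2) (simp only: real_norm_def)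
    qed measurable
    have Fle: "F h \<le> (\<integral>t. D n t \<partial>M)" for n
    proof -
      define Z where "Z = (\<integral>t. rf (\<Phi> t) (k * \<bar>z n t\<bar>) \<partial>M)"
      have Z0: "0 \<le> Z" unfolding Z_def using rf0 by simp
      have "N (z n) \<le> (1 + Z) / k"
      proof (rule N_le_modular[OF z kpos])
        have "1 + I (\<lambda>t. k * z n t) = ennreal (1 + Z)" using int_rf(2)[OF z k(1)] Z0 by (simp add: Z_def)
        then show "1 + I (\<lambda>t. k * z n t) \<le> ennreal (k * ((1 + Z) / k))" using kpos by simp
      qed
      moreover have "F (z n) = N x + r n * F h"
        unfolding z_def using FD(3)[OF x E_scale[OF h]] FD(2)[OF h] FD(4)[OF h] by simp
      moreover have "F (z n) \<le> N (z n)" by (rule FD(1)[OF z])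
      ultimately have "N x + r n * F h \<le> (1 + Z) / k" by simp
      then have "k * (N x + r n * F h) \<le> 1 + Z" using kpos by (simp add: pos_le_divide_eq mult.commute)
      then have "k * r n * F h \<le> Z - (\<integral>t. rf (\<Phi> t) (k * \<bar>x t\<bar>) \<partial>M)" using kN by (simp add: algebra_simps)
      also have "\<dots> = (\<integral>t. rf (\<Phi> t) (k * \<bar>z n t\<bar>) - rf (\<Phi> t) (k * \<bar>x t\<bar>) \<partial>M)"
        unfolding Z_def using int_rf(1)[OF z k(1)] int_rf(1)[OF x k(1)] by simp
      also have "\<dots> \<le> (\<integral>t. k * r n * D n t \<partial>M)"
      proof (rule integral_mono)
        show "integrable M (\<lambda>t. k * r n * D n t)" using intD by simp
        show "integrable M (\<lambda>t. rf (\<Phi> t) (k * \<bar>z n t\<bar>) - rf (\<Phi> t) (k * \<bar>x t\<bar>))"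
          using int_rf(1)[OF z k(1)] int_rf(1)[OF x k(1)] by simp
        fix t
        have "rf (\<Phi> t) (k * \<bar>z n t\<bar>) - rf (\<Phi> t) (k * \<bar>x t\<bar>) \<le> rd (\<Phi> t) (k * \<bar>z n t\<bar>) * (k * \<bar>z n t\<bar> - k * \<bar>x t\<bar>)"
          using rf_ge_tangent[of "k * \<bar>z n t\<bar>" "k * \<bar>x t\<bar>" t] k by (simp add: algebra_simps)
        also have "\<dots> \<le> rd (\<Phi> t) (k * \<bar>z n t\<bar>) * (k * (sgn (z n t) * (z n t - x t)))"
        proof (rule mult_left_mono[OF _ rd_nonneg])
          have "\<bar>z n t\<bar> - \<bar>x t\<bar> \<le> sgn (z n t) * (z n t - x t)" by (auto simp: sgn_if)
          then have "k * (\<bar>z n t\<bar> - \<bar>x t\<bar>) \<le> k * (sgn (z n t) * (z n t - x t))" using k by (intro mult_left_mono) auto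
          then show "k * \<bar>z n t\<bar> - k * \<bar>x t\<bar> \<le> k * (sgn (z n t) * (z n t - x t))" by (simp add: right_diff_distrib)
        qed
        also have "\<dots> = k * r n * D n t" by (simp add: D_def z_def)
        finally show "rf (\<Phi> t) (k * \<bar>z n t\<bar>) - rf (\<Phi> t) (k * \<bar>x t\<bar>) \<le> k * r n * D n t" .
      qed
      also have "\<dots> = k * r n * (\<integral>t. D n t \<partial>M)" by simp
      finally show ?thesis using kpos r[of n] by simp
    qed
    have "(\<lambda>n. \<integral>t. D n t \<partial>M) \<longlonglongrightarrow> (\<integral>t. h t * w t \<partial>M)"
    proof (rule integral_dominated_convergence[OF _ _ intq])
      show "AE t in M. norm (D n t) \<le> rf (\<Phi> t) (2 * k * \<bar>q t\<bar>) / k" for n using Dle by simp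
      show "AE t in M. (\<lambda>n. D n t) \<longlonglongrightarrow> h t * w t"
        using cont
      proof eventually_elim
        case (elim t)
        have "r \<longlonglongrightarrow> 0" unfolding r_def
          using LIMSEQ_inverse_real_of_nat by (simp add: inverse_eq_divide add.commute)
        then have "(\<lambda>n. x t + r n * h t) \<longlonglongrightarrow> x t + 0 * h t" by (intro tendsto_intros)
        then have zx: "(\<lambda>n. z n t) \<longlonglongrightarrow> x t" by (simp add: z_def)
        have "(\<lambda>n. k * \<bar>z n t\<bar>) \<longlonglongrightarrow> k * \<bar>x t\<bar>" using zx by (intro tendsto_intros)
        then have rdz: "(\<lambda>n. rd (\<Phi> t) (k * \<bar>z n t\<bar>)) \<longlonglongrightarrow> rd (\<Phi> t) (k * \<bar>x t\<bar>)"
          using elim k by (intro continuous_on_tendsto_compose[of "{0..}" "rd (\<Phi> t)"]) auto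
        show ?case
        proof (cases "x t = 0")
          case False
          have "(\<lambda>n. D n t) \<longlonglongrightarrow> rd (\<Phi> t) (k * \<bar>x t\<bar>) * sgn (x t) * h t"
            unfolding D_def using zx rdz False by (intro tendsto_intros)
          then show ?thesis by (simp add: w_def mult.commute)
        next
          case True
          \<comment> \<open>The signs of \<open>z n t\<close> need not converge to
            \<open>sgn 0\<close>, but the factor \<open>rd (\<Phi> t) (k \<bar>z n t\<bar>)\<close>
            tends to \<open>rd (\<Phi> t) 0 = 0\<close>. This is where the vanishing right
            derivative at 0 is needed.\<close>
          have "(\<lambda>n. D n t) \<longlonglongrightarrow> 0"
          proof (rule Lim_null_comparison)
            show "eventually (\<lambda>n. norm (D n t) \<le> rd (\<Phi> t) (k * \<bar>z n t\<bar>) * \<bar>h t\<bar>) sequentially"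
              using rd_nonneg[of t] by (intro always_eventually) (auto simp: D_def abs_mult abs_sgn_eq)
            have "(\<lambda>n. rd (\<Phi> t) (k * \<bar>z n t\<bar>) * \<bar>h t\<bar>) \<longlonglongrightarrow> 0 * \<bar>h t\<bar>"
              using rdz True elim by (intro tendsto_intros) auto
            then show "(\<lambda>n. rd (\<Phi> t) (k * \<bar>z n t\<bar>) * \<bar>h t\<bar>) \<longlonglongrightarrow> 0" by simp
          qed
          then show ?thesis using True by (simp add: w_def)
        qed
      qed
    qed measurable
    then show ?thesis using Fle by (intro LIMSEQ_le_const) auto
  qed
  show "x \<in> E" by fact
  show "\<not> (AE t in M. x t = 0)" by fact
  show "\<exists>!F. support_functional M E N x F"
  proof (rule ex1I[where P = "support_functional M E N x"], rule supp)
    fix F assume F: "support_functional M E N x F"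
    note FD = support_functionalD[OF F x]
    show "F = (\<lambda>u\<in>E. \<integral>t. u t * w t \<partial>M)"
    proof
      fix h
      show "F h = (\<lambda>u\<in>E. \<integral>t. u t * w t \<partial>M) h"
      proof (cases "h \<in> E")
        case True
        \<comment> \<open>A linear functional dominated by a linear functional equals it, by
          applying the bound to \<open>- h\<close>.\<close>
        have "F (\<lambda>t. - h t) \<le> (\<integral>t. - h t * w t \<partial>M)" by (rule le[OF F E_uminus[OF True]])
        moreover have "F (\<lambda>t. - h t) = - F h" using FD(4)[OF True, of "- 1"] by simp
        ultimately show ?thesis using le[OF F True] True by simp
      next
        case False
        then show ?thesis using FD(5)[OF x] by (simp add: extensional_def)
      qed
    qed
  qed
qed

end

subsection \<open>Modification on null sets\<close>

lemma AE_equal_transfer: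
  assumes eq: "AE t in M. \<Phi> t = \<Phi>' t"
  shows "smooth_space M (mo_space M \<Phi>) (orlicz_norm M \<Phi>) \<longleftrightarrow> smooth_space M (mo_space M \<Phi>') (orlicz_norm M \<Phi>')"
    "(AE t in M. complementary \<Phi> t (b_fun (complementary \<Phi>) t) = \<infinity>) \<longleftrightarrow>
      (AE t in M. complementary \<Phi>' t (b_fun (complementary \<Phi>') t) = \<infinity>)"
    "delta2 M \<Phi> \<longleftrightarrow> delta2 M \<Phi>'"
    "(AE t in M. P (\<Phi> t)) \<longleftrightarrow> (AE t in M. P (\<Phi>' t))"
proof -
  have modular: "modular M \<Phi> = modular M \<Phi>'" if "AE t in M. \<Phi> t = \<Phi>' t" for \<Phi> \<Phi>' :: "'a \<Rightarrow> ennreal \<Rightarrow> ennreal"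
    unfolding modular_def using that by (intro ext nn_integral_cong_AE) auto
  have ceq: "AE t in M. complementary \<Phi> t = complementary \<Phi>' t"
    using eq by eventually_elim (simp add: fun_eq_iff complementary_def)
  have "orlicz_norm M \<Phi> = orlicz_norm M \<Phi>'"
    unfolding orlicz_norm_def[abs_def] mo_class_def modular[OF ceq] ..
  moreover have "mo_space M \<Phi> = mo_space M \<Phi>'" unfolding mo_space_def modular[OF eq] ..
  ultimately show "smooth_space M (mo_space M \<Phi>) (orlicz_norm M \<Phi>) \<longleftrightarrow> smooth_space M (mo_space M \<Phi>') (orlicz_norm M \<Phi>')"
    by simp
  have "AE t in M. (complementary \<Phi> t (b_fun (complementary \<Phi>) t) = \<infinity>) = (complementary \<Phi>' t (b_fun (complementary \<Phi>') t) = \<infinity>)"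
    using ceq by eventually_elim (simp add: b_fun_def)
  then show "(AE t in M. complementary \<Phi> t (b_fun (complementary \<Phi>) t) = \<infinity>) \<longleftrightarrow>
      (AE t in M. complementary \<Phi>' t (b_fun (complementary \<Phi>') t) = \<infinity>)" by (rule eventually_subst)
  have "mo_class M \<Phi> = mo_class M \<Phi>'" unfolding mo_class_def modular[OF eq] ..
  moreover have "(AE t in M. \<forall>u\<ge>ennreal (f t). \<Phi> t (2 * u) \<le> ennreal K * \<Phi> t u) \<longleftrightarrow>
      (AE t in M. \<forall>u\<ge>ennreal (f t). \<Phi>' t (2 * u) \<le> ennreal K * \<Phi>' t u)" for f and K :: real
    by (rule eventually_subst) (use eq in eventually_elim, simp)
  ultimately show "delta2 M \<Phi> \<longleftrightarrow> delta2 M \<Phi>'" by (simp add: delta2_def)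
  show "(AE t in M. P (\<Phi> t)) \<longleftrightarrow> (AE t in M. P (\<Phi>' t))"
    by (rule eventually_subst) (use eq in eventually_elim, simp)
qed

text \<open>The identity is the replacement on null sets; being finite at finite arguments, it
  serves both modifications of \<open>\<Phi>\<close>.\<close>

lemma young_ident: "young (\<lambda>u. u)"
proof -
  have "u \<le> Liminf (at u) (\<lambda>u. u)" for u :: ennreal
    unfolding le_Liminf_iff using order_tendstoD(1)[OF tendsto_ident_at] by blast
  moreover have "((\<lambda>u. u) \<longlongrightarrow> (0::ennreal)) (at_right 0)" by (rule tendsto_ident_at)
  ultimately show ?thesis by (simp add: young_def convex_ennreal_def lsc_ennreal_def)
qed

text \<open>The property \<open>P\<close> is kept general because the modification happens twice:
  once for being a Young function and once for finite values in addition.\<close>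

lemma AE_modify:
  fixes \<Phi> :: "'a \<Rightarrow> ennreal \<Rightarrow> ennreal"
  assumes P: "AE t in M. P (\<Phi> t)" "P (\<lambda>u. u)" and meas: "\<And>u. (\<lambda>t. \<Phi> t u) \<in> borel_measurable M"
  obtains \<Phi>' where "AE t in M. \<Phi> t = \<Phi>' t" "\<And>t. P (\<Phi>' t)" "\<And>u. (\<lambda>t. \<Phi>' t u) \<in> borel_measurable M"
proof -
  obtain Z where Z: "\<And>t. t \<in> space M - Z \<Longrightarrow> P (\<Phi> t)" "Z \<in> null_sets M"
    using AE_E3[OF P(1)] by blast
  then have Zm[measurable]: "Z \<in> sets M" by auto
  note [measurable] = meas
  define \<Phi>' where "\<Phi>' = (\<lambda>t. if t \<in> space M - Z then \<Phi> t else (\<lambda>u. u))"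
  show ?thesis
  proof (rule that[of \<Phi>'])
    show "AE t in M. \<Phi> t = \<Phi>' t"
      using AE_not_in[OF Z(2)] AE_space by eventually_elim (simp add: \<Phi>'_def)
    show "P (\<Phi>' t)" for t using Z(1) P(2) by (auto simp: \<Phi>'_def)
    have "(\<lambda>t. if t \<in> space M - Z then \<Phi> t u else u) \<in> borel_measurable M" for u by measurable
    then show "(\<lambda>t. \<Phi>' t u) \<in> borel_measurable M" for u by (simp add: \<Phi>'_def if_distrib[of "\<lambda>f. f u"])
  qed
qed

theorem proposition16:
  fixes M :: "'a measure" and \<Phi> :: "'a \<Rightarrow> ennreal \<Rightarrow> ennreal"
  assumes "sigma_finite_measure M" and "non_atomic M"
    and "musielak_orlicz M \<Phi>"
  shows "smooth_space M (mo_space M \<Phi>) (orlicz_norm M \<Phi>) \<longleftrightarrow>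
    (AE t in M. complementary \<Phi> t (b_fun (complementary \<Phi>) t) = \<infinity>) \<and>
    delta2 M \<Phi> \<and>
    (AE t in M. continuously_differentiable (\<Phi> t) \<and> has_right_derivative (\<Phi> t) 0 0)"
proof -
  have mo: "AE t in M. young (\<Phi> t)" and meas: "\<And>u. (\<lambda>t. \<Phi> t u) \<in> borel_measurable M"
    using assms(3) unfolding musielak_orlicz_def young_def by blast+
  obtain \<Phi>' where \<Phi>': "AE t in M. \<Phi> t = \<Phi>' t" "\<And>t. young (\<Phi>' t)" "\<And>u. (\<lambda>t. \<Phi>' t u) \<in> borel_measurable M"
    using AE_modify[OF mo young_ident meas] by blast
  interpret young_family M \<Phi>'
    using assms(1) \<Phi>' by (simp add: young_family_def young_family_axioms_def)
  have b: "(AE t in M. \<Psi> t (b t) = top) \<longleftrightarrow> (AE t in M. complementary \<Phi>' t (b_fun (complementary \<Phi>') t) = \<infinity>)"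
    by (simp add: b_def b_fun_def complementary_eq_conjugate)
  have delta2: "delta2 M \<Phi>'" if "smooth_space M E N"
    using smooth_imp_doubling[OF assms(2) that] by (rule doubling_imp_delta2[OF assms(2)])
  have infinite: "AE t in M. complementary \<Phi>' t (b_fun (complementary \<Phi>') t) = \<infinity>" if "smooth_space M E N"
    using smooth_imp_conjugate_infinite[OF assms(2) that] b by simp
  \<comment> \<open>The finite-valued setting becomes available only after the doubling condition is
    known, hence a second change on a null set and a transfer of all conditions back.\<close>
  have main: "smooth_space M E N \<longleftrightarrow> (AE t in M. continuously_differentiable (\<Phi>' t) \<and> has_right_derivative (\<Phi>' t) 0 0)"
    if d2: "delta2 M \<Phi>'" and inf: "AE t in M. complementary \<Phi>' t (b_fun (complementary \<Phi>') t) = \<infinity>"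
  proof -
    have fin: "AE t in M. young (\<Phi>' t) \<and> (\<forall>u<top. \<Phi>' t u < top)"
      using delta2_finite[OF d2] \<Phi>'(2) by simp
    obtain X where X: "AE t in M. \<Phi>' t = X t" "\<And>t. young (X t) \<and> (\<forall>u<top. X t u < top)" "\<And>u. (\<lambda>t. X t u) \<in> borel_measurable M"
      using AE_modify[OF fin _ \<Phi>'(3)] young_ident by blast
    interpret X: finite_young_family M X
      using assms(1) X by (simp add: finite_young_family_def finite_young_family_axioms_def young_family_def young_family_axioms_def)
    note tr = AE_equal_transfer[OF X(1)]
    have Xb: "AE t in M. conjugate (X t) (X.b t) = top"
      using inf tr(2) by (simp add: X.b_def b_fun_def complementary_eq_conjugate)
    show ?thesis
      using X.smooth_imp_differentiable[OF assms(2) _ Xb] X.smooth_if_differentiable[OF Xb] d2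
      unfolding tr(1) tr(3) tr(4)[of "\<lambda>\<phi>. continuously_differentiable \<phi> \<and> has_right_derivative \<phi> 0 0"] by blast
  qed
  note tr = AE_equal_transfer[OF \<Phi>'(1)]
  show ?thesis
    unfolding tr(1) tr(2) tr(3) tr(4)[of "\<lambda>\<phi>. continuously_differentiable \<phi> \<and> has_right_derivative \<phi> 0 0"]
    using delta2 infinite main by blast
qed

end
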